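(* Let $d>0$, $\mu>0$, $\tau>0$, and let $f\in C^1(\mathbb R_+,\mathbb R_+)$ satisfy $f'(0)>1$, $f'(u)\ge0$ and $f(u)<f'(0)u$ for all $u>0$, and suppose $f$ has a unique positive fixed point $u^*>0$, with $f(u)>u$ for $u\in(0,u^* )$ and $f(u)<u$ for $u>u^*$. Let $\mathcal C_+$ be the set of bounded continuous $\varphi:[-\tau,0]\times\mathbb R_+\to\mathbb R_+$ with $\varphi(\theta,0)=0$ for all $\theta$, and for $\varphi\in\mathcal C_+$ let $u^\varphi(t,x)$ be the solution of $$\begin{cases}\dfrac{\partial u}{\partial t}(t,x)=d\dfrac{\partial^2u}{\partial x^2}(t,x)-\mu u(t,x)+\mu f(u(t-\tau,x)),&t,x>0,\\ u(t,x)=\varphi(t,x),&(t,x)\in[-\tau,0]\times\mathbb R_+,\\ u(t,0)=0,&t\in[-\tau,\infty).\end{cases}$$ Let $c^*>0$ be the spreading speed of the corresponding equation on $\mathbb R$. Then the problem has a unique nontrivial steady state $W(x)$ connecting $0$ to $u^*$ (i.e. $W(0)=0$ and $\lim_{x\to\infty}W(x)=u^*$), such that for any $\varepsilon\in(0,c^* )$ and $\varphi\in\mathcal C_+\setminus\{0\}$, $$\lim_{t\to\infty}\max\{|u^\varphi(t,x)-W(x)|:0\le x\le t(c^*-\varepsilon)\}=0.$$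
   Context: Well-posedness: for each $\varphi\in\mathcal C_+$ the Dirichlet problem has a unique mild solution on $[0,\infty)$ (classical for $t>\tau$). Spreading speed: $c^*>0$ is the (asymptotic) spreading speed of $\frac{\partial u}{\partial t}(t,x)=d\frac{\partial^2u}{\partial x^2}(t,x)-\mu u(t,x)+\mu f(u(t-\tau,x))$ for $(t,x)\in(0,\infty)\times\mathbb R$ with bounded continuous nonnegative initial data $u=\phi$ on $[-\tau,0]\times\mathbb R$, i.e. the number such that for every $\varepsilon>0$ the solution satisfies $\lim_{t\to\infty}\sup_{|x|\ge t(c^*+\varepsilon)}u(t,x)=0$ if $\phi$ has compact support, and $\lim_{t\to\infty}\max_{|x|\le t(c^*-\varepsilon)}|u(t,x)-u^*|=0$ if $\phi\not\equiv0$. *)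

theory Defs
  imports "HOL-Analysis.Analysis"
begin

definition heat_kernel :: "real \<Rightarrow> real \<Rightarrow> real \<Rightarrow> real" where
  "heat_kernel d t x = exp (- (x\<^sup>2 / (4 * d * t))) / sqrt (4 * pi * d * t)"

text \<open>The semigroup generated by \<open>d \<partial>\<^sub>x\<^sub>x - \<mu>\<close> on the whole line, for \<open>t > 0\<close>.\<close>

definition line_semigroup ::
    "real \<Rightarrow> real \<Rightarrow> real \<Rightarrow> (real \<Rightarrow> real) \<Rightarrow> real \<Rightarrow> real" where
  "line_semigroup d \<mu> t g x =
     exp (- \<mu> * t) * (LBINT y. heat_kernel d t (x - y) * g y)"

text \<open>The semigroup generated by \<open>d \<partial>\<^sub>x\<^sub>x - \<mu>\<close> on the half-line with the Dirichlet condition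
  at \<open>0\<close>, for \<open>t > 0\<close>; the kernel is the odd reflection of the heat kernel.\<close>

definition dirichlet_semigroup ::
    "real \<Rightarrow> real \<Rightarrow> real \<Rightarrow> (real \<Rightarrow> real) \<Rightarrow> real \<Rightarrow> real" where
  "dirichlet_semigroup d \<mu> t g x =
     exp (- \<mu> * t) *
       (LBINT y:{0..}. (heat_kernel d t (x - y) - heat_kernel d t (x + y)) * g y)"

text \<open>Mild solutions, on the spatial domain \<open>X\<close>, of
  \<open>u\<^sub>t = d u\<^sub>x\<^sub>x - \<mu> u + \<mu> f(u(t - \<tau>, x))\<close> with initial history \<open>\<phi>\<close> on \<open>[-\<tau>, 0]\<close>:
  \<open>S\<close> is the semigroup of the linear part \<open>d \<partial>\<^sub>x\<^sub>x - \<mu>\<close> and the integral equation is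
  the variation of constants formula.  Only the values of \<open>u\<close> on \<open>[-\<tau>, \<infinity>) \<times> X\<close> matter, and
  \<open>f\<close> is only evaluated at nonnegative arguments.\<close>

definition mild_solution ::
    "(real \<Rightarrow> (real \<Rightarrow> real) \<Rightarrow> real \<Rightarrow> real) \<Rightarrow> real set \<Rightarrow> real \<Rightarrow> real \<Rightarrow>
     (real \<Rightarrow> real) \<Rightarrow> (real \<Rightarrow> real \<Rightarrow> real) \<Rightarrow> (real \<Rightarrow> real \<Rightarrow> real) \<Rightarrow> bool" where
  "mild_solution S X \<mu> \<tau> f \<phi> u \<longleftrightarrow>
     continuous_on ({-\<tau>..} \<times> X) (\<lambda>(t, x). u t x) \<and>
     (\<forall>t\<ge>-\<tau>. \<forall>x\<in>X. 0 \<le> u t x) \<and>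
     (\<forall>T. bounded ((\<lambda>(t, x). u t x) ` ({-\<tau>..T} \<times> X))) \<and>
     (\<forall>\<theta>\<in>{-\<tau>..0}. \<forall>x\<in>X. u \<theta> x = \<phi> \<theta> x) \<and>
     (\<forall>t>0. \<forall>x\<in>X.
        u t x = S t (u 0) x + (LBINT s:{0<..<t}. S (t - s) (\<lambda>y. \<mu> * f (u (s - \<tau>) y)) x))"

definition line_solution ::
    "real \<Rightarrow> real \<Rightarrow> real \<Rightarrow> (real \<Rightarrow> real) \<Rightarrow> (real \<Rightarrow> real \<Rightarrow> real) \<Rightarrow>
     (real \<Rightarrow> real \<Rightarrow> real) \<Rightarrow> bool" where
  "line_solution d \<mu> \<tau> f \<phi> u \<longleftrightarrow> mild_solution (line_semigroup d \<mu>) UNIV \<mu> \<tau> f \<phi> u"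

definition dirichlet_solution ::
    "real \<Rightarrow> real \<Rightarrow> real \<Rightarrow> (real \<Rightarrow> real) \<Rightarrow> (real \<Rightarrow> real \<Rightarrow> real) \<Rightarrow>
     (real \<Rightarrow> real \<Rightarrow> real) \<Rightarrow> bool" where
  "dirichlet_solution d \<mu> \<tau> f \<phi> u \<longleftrightarrow>
     mild_solution (dirichlet_semigroup d \<mu>) {0..} \<mu> \<tau> f \<phi> u \<and>
     (\<forall>t\<ge>-\<tau>. u t 0 = 0)"

text \<open>Bounded continuous nonnegative functions on \<open>[-\<tau>, 0] \<times> X\<close>.\<close>

definition bc_nonneg :: "real \<Rightarrow> real set \<Rightarrow> (real \<Rightarrow> real \<Rightarrow> real) set" where
  "bc_nonneg \<tau> X =
     {\<phi>. continuous_on ({-\<tau>..0} \<times> X) (\<lambda>(\<theta>, x). \<phi> \<theta> x) \<and>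
         bounded ((\<lambda>(\<theta>, x). \<phi> \<theta> x) ` ({-\<tau>..0} \<times> X)) \<and>
         (\<forall>\<theta>\<in>{-\<tau>..0}. \<forall>x\<in>X. 0 \<le> \<phi> \<theta> x)}"

definition C_plus :: "real \<Rightarrow> (real \<Rightarrow> real \<Rightarrow> real) set" where
  "C_plus \<tau> = {\<phi> \<in> bc_nonneg \<tau> {0..}. \<forall>\<theta>\<in>{-\<tau>..0}. \<phi> \<theta> 0 = 0}"

definition vanishes_on :: "real \<Rightarrow> real set \<Rightarrow> (real \<Rightarrow> real \<Rightarrow> real) \<Rightarrow> bool" where
  "vanishes_on \<tau> X \<phi> \<longleftrightarrow> (\<forall>\<theta>\<in>{-\<tau>..0}. \<forall>x\<in>X. \<phi> \<theta> x = 0)"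

text \<open>In the second limit, \<open>\<epsilon> \<le> c\<close> is exactly the condition under which the set
  \<open>{x. \<bar>x\<bar> \<le> t (c - \<epsilon>)}\<close> is nonempty for \<open>t > 0\<close>; for \<open>t \<ge> 0\<close> it is then compact, so that
  the supremum is a maximum.  In the first limit the supremum is over a bounded set of
  values, since solutions are bounded at each time.\<close>

definition is_spreading_speed ::
    "real \<Rightarrow> real \<Rightarrow> real \<Rightarrow> (real \<Rightarrow> real) \<Rightarrow> real \<Rightarrow> real \<Rightarrow> bool" where
  "is_spreading_speed d \<mu> \<tau> f ustar c \<longleftrightarrow>
     0 < c \<and>
     (\<forall>\<epsilon>>0. \<forall>\<phi>\<in>bc_nonneg \<tau> UNIV. \<forall>u. line_solution d \<mu> \<tau> f \<phi> u \<longrightarrow>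
        (compact (closure {(\<theta>, x). \<theta> \<in> {-\<tau>..0} \<and> \<phi> \<theta> x \<noteq> 0}) \<longrightarrow>
           ((\<lambda>t. SUP x\<in>{x. t * (c + \<epsilon>) \<le> \<bar>x\<bar>}. u t x) \<longlongrightarrow> 0) at_top) \<and>
        (\<not> vanishes_on \<tau> UNIV \<phi> \<and> \<epsilon> \<le> c \<longrightarrow>
           ((\<lambda>t. SUP x\<in>{x. \<bar>x\<bar> \<le> t * (c - \<epsilon>)}. \<bar>u t x - ustar\<bar>) \<longlongrightarrow> 0) at_top))"

text \<open>Nonnegative classical steady states of the half-line problem with
  \<open>W(0) = 0\<close>; values at negative arguments are irrelevant.\<close>

definition dirichlet_steady_state ::
    "real \<Rightarrow> real \<Rightarrow> (real \<Rightarrow> real) \<Rightarrow> (real \<Rightarrow> real) \<Rightarrow> bool" where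
  "dirichlet_steady_state d \<mu> f W \<longleftrightarrow>
     continuous_on {0..} W \<and> (\<forall>x\<ge>0. 0 \<le> W x) \<and> W 0 = 0 \<and>
     (\<exists>W' W''. \<forall>x>0.
        (W has_real_derivative W' x) (at x) \<and>
        (W' has_real_derivative W'' x) (at x) \<and>
        d * W'' x - \<mu> * W x + \<mu> * f (W x) = 0)"

definition connecting_steady_state ::
    "real \<Rightarrow> real \<Rightarrow> (real \<Rightarrow> real) \<Rightarrow> real \<Rightarrow> (real \<Rightarrow> real) \<Rightarrow> bool" where
  "connecting_steady_state d \<mu> f ustar W \<longleftrightarrow>
     dirichlet_steady_state d \<mu> f W \<and> (\<exists>x>0. W x \<noteq> 0) \<and> (W \<longlongrightarrow> ustar) at_top"

end

theory Submission
  imports Defs "HOL-Probability.Probability" "HOL-Real_Asymp.Real_Asymp"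
begin

text \<open>Let \<open>a = sqrt (\<mu> / d)\<close>. The mild formulation is rewritten by
  means of the expected occupation density, discounted at rate \<open>\<mu>\<close>, of the
  Brownian motion with generator \<open>d \<partial>\<^sub>x\<^sub>x\<close>, either on the
  line (\<open>line_occ\<close>) or killed at the origin (\<open>half_occ\<close>): the
  value of a solution at \<open>(t, x)\<close> is the decayed contribution of the data plus
  the integral of \<open>f (u (t - s - \<tau>) y)\<close> against the density at \<open>(s,
  y)\<close>. The density has mass at most one, uniformly negligible mass at large times,
  and exponential moments in space over bounded times. If \<open>u\<close> no longer depends
  on time, the time integral is a Laplace transform of the heat kernel, and what remains is
  the operator \<open>green\<close>, the inverse of \<open>1 - a\<^sup>-\<^sup>2
  \<partial>\<^sub>x\<^sub>x\<close> with the Dirichlet condition; the delay disappears.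
  Hence the map \<open>w \<mapsto> green (f \<circ> w)\<close>, called \<open>step\<close>,
  turns asymptotic upper bounds of the solution into asymptotic upper bounds
  (\<open>upper_green\<close>), and lower bounds in the cones \<open>x \<le> c' t\<close>,
  \<open>c' < c\<close>, into such lower bounds (\<open>lower_green\<close>). Its fixed
  points are the steady states.

  The constant \<open>ustar\<close> is an asymptotic upper bound
  (\<open>upper_ustar\<close>), and its iterates decrease to the maximal steady state. If
  some small nondecreasing ramp is a subsolution and an asymptotic lower bound in cones,
  its iterates increase to a steady state as well. Both limits tend to
  \<open>ustar\<close> at infinity, and there is only one steady state that does: the
  first integral of the ordinary differential equation fixes its slope at the origin, the
  slope is an integral of \<open>f \<circ> W\<close> with a positive weight, and by
  maximality one only has to compare ordered steady states, for which equality of these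
  integrals forces equality (\<open>steady_unique\<close>). All functions being
  nondecreasing in space, the convergence of the iterates is uniform
  (\<open>monotone_uniform_approx\<close>), which gives the claim
  (\<open>cone_convergence\<close>).

  The ramp is a supremum of translates of a cosine bump. Since \<open>f'(0) > 1\<close>, a
  small multiple of a wide enough bump is a strict subsolution, already for a bounded time
  window and away from the boundary (\<open>bump_subsolution\<close>). A nontrivial
  solution is positive after one delay, so that it eventually stays above each such bump,
  with a height \<open>\<kappa>\<close> that depends neither on the solution nor on the
  position (\<open>bump_growth\<close>). To reach all positions up to \<open>c t\<close>
  at once, let \<open>v\<close> be the solution on the line started from the bump
  (\<open>line_solution_exists\<close>). As the spreading speed is \<open>cstar\<close>,
  at some time \<open>T0\<close> it is close to \<open>ustar\<close> on an interval that
  is wider than \<open>2 c T0\<close>. Far from the origin the boundary is not felt during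
  the time \<open>T0\<close>: a half-line solution above a translated bump stays above the
  translate of \<open>v\<close> up to an error \<open>C exp (- x)\<close> with
  \<open>C\<close> independent of the translation (\<open>line_half_comparison\<close>).
  So a bump reproduces within the time \<open>T0 + \<tau>\<close> all its translates by at
  most \<open>c (T0 + \<tau>)\<close>, and this finite-time statement can be iterated
  (\<open>bump_spreading\<close>).\<close>

section \<open>The heat kernel\<close>

lemma heat_kernel_normal:
  assumes "0 < d" "0 < t"
  shows "heat_kernel d t z = normal_density 0 (sqrt (2 * d * t)) z"
  using assms unfolding heat_kernel_def normal_density_def
  by (simp add: real_sqrt_mult[symmetric] mult.assoc mult.left_commute)

lemma heat_kernel_nonneg: "0 < d \<Longrightarrow> 0 < t \<Longrightarrow> 0 \<le> heat_kernel d t z"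
  by (simp add: heat_kernel_def)

lemma heat_kernel_uminus [simp]: "heat_kernel d t (- z) = heat_kernel d t z"
  by (simp add: heat_kernel_def)

lemma heat_kernel_measurable [measurable]:
  "(\<lambda>(t, z). heat_kernel d t z) \<in> borel_measurable (borel \<Otimes>\<^sub>M borel)"
  unfolding heat_kernel_def by measurable

lemma heat_kernel_measurable' [measurable (raw)]:
  assumes [measurable]: "F \<in> borel_measurable M" "Z \<in> borel_measurable M"
  shows "(\<lambda>x. heat_kernel d (F x) (Z x)) \<in> borel_measurable M"
  unfolding heat_kernel_def by measurable

lemma heat_kernel_mass:
  assumes "0 < d" "0 < t"
  shows "has_bochner_integral lborel (\<lambda>y. heat_kernel d t (x - y)) 1"
proof -
  have "has_bochner_integral lborel (\<lambda>y. heat_kernel d t y) 1"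
    using assms by (simp add: heat_kernel_normal has_bochner_integral_iff)
  then show ?thesis
    using lborel_has_bochner_integral_real_affine_iff[of "-1" "\<lambda>y. heat_kernel d t y" 1 x] by simp
qed

text \<open>Completing the square turns the exponential weight into a translation of the
  kernel. These moments carry all the estimates that say that far away regions matter little
  over a bounded time.\<close>
lemma heat_kernel_exp_moment:
  assumes "0 < d" "0 < t" "\<bar>\<sigma>\<bar> = 1"
  shows "has_bochner_integral lborel (\<lambda>y. heat_kernel d t (x - y) * exp (\<sigma> * (x - y))) (exp (d * t))"
proof -
  have s: "\<sigma> * \<sigma> = 1" using assms(3) by (metis abs_mult_self_eq mult_1)
  have e: "- ((x - y)\<^sup>2 / (4 * d * t)) + \<sigma> * (x - y) = d * t - ((x - 2 * d * t * \<sigma>) - y)\<^sup>2 / (4 * d * t)" for y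
  proof -
    have "((x - 2 * d * t * \<sigma>) - y)\<^sup>2 = (x - y)\<^sup>2 - 4 * d * t * (\<sigma> * (x - y)) + 4 * d * t * (d * t) * (\<sigma> * \<sigma>)"
      by (simp add: power2_eq_square algebra_simps)
    then show ?thesis using assms s by (simp add: field_simps)
  qed
  have "heat_kernel d t (x - y) * exp (\<sigma> * (x - y)) = exp (d * t) * heat_kernel d t ((x - 2 * d * t * \<sigma>) - y)" for y
    unfolding heat_kernel_def times_divide_eq_left times_divide_eq_right exp_add[symmetric] using e[of y] by simp
  then show ?thesis
    using has_bochner_integral_mult_right[rotated, OF heat_kernel_mass[OF assms(1,2), of "x - 2 * d * t * \<sigma>"], of "exp (d * t)"]
    by simp
qed

lemma heat_kernel_convolution:
  assumes "0 < d" "0 < t" "0 < s"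
  shows "has_bochner_integral lborel (\<lambda>z. heat_kernel d t (x - z) * heat_kernel d s (z - y)) (heat_kernel d (t + s) (x - y))"
proof -
  let ?h = "\<lambda>z. heat_kernel d t ((x - y) - z) * heat_kernel d s z"
  have "(\<integral>\<^sup>+z. ennreal (?h z) \<partial>lborel) = ennreal (heat_kernel d (t + s) (x - y))"
    using fun_cong[OF conv_normal_density_zero_mean[of "sqrt (2 * d * t)" "sqrt (2 * d * s)"], of "x - y"] assms
    by (simp add: heat_kernel_normal distrib_left)
  then have "has_bochner_integral lborel ?h (heat_kernel d (t + s) (x - y))"
    using assms by (intro has_bochner_integral_nn_integral) (auto simp: heat_kernel_nonneg)
  then show ?thesis
    using lborel_has_bochner_integral_real_affine_iff[of 1 ?h "heat_kernel d (t + s) (x - y)" "- y"]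
    by (simp add: algebra_simps)
qed

section \<open>Discounted occupation densities\<close>

text \<open>Expected time density at time \<open>s\<close> and position \<open>y\<close> of
  Brownian motion started at \<open>x\<close> and killed at rate \<open>\<mu>\<close>,
  normalised by the factor \<open>\<mu>\<close> to be a probability density on the
  plane.\<close>
definition line_occ :: "real \<Rightarrow> real \<Rightarrow> real \<Rightarrow> real \<times> real \<Rightarrow> real" where
  "line_occ d \<mu> x = (\<lambda>(s, y). indicator {0<..} s * (\<mu> * exp (- \<mu> * s) * heat_kernel d s (x - y)))"

text \<open>By the reflection principle, subtracting the density at the mirror point
  \<open>- y\<close> leaves the density of the process that is also killed on reaching the
  origin.\<close>
definition half_occ :: "real \<Rightarrow> real \<Rightarrow> real \<Rightarrow> real \<times> real \<Rightarrow> real" where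
  "half_occ d \<mu> x = (\<lambda>(s, y). indicator {0..} y * (line_occ d \<mu> x (s, y) - line_occ d \<mu> x (s, - y)))"

lemma line_occ_measurable [measurable]:
  "line_occ d \<mu> x \<in> borel_measurable (borel \<Otimes>\<^sub>M borel)"
  unfolding line_occ_def by measurable

lemma line_occ_measurable' [measurable (raw)]:
  assumes [measurable]: "X \<in> borel_measurable M" "F \<in> borel_measurable M" "Z \<in> borel_measurable M"
  shows "(\<lambda>w. line_occ d \<mu> (X w) (F w, Z w)) \<in> borel_measurable M"
  unfolding line_occ_def by simp

lemma half_occ_measurable [measurable]:
  "half_occ d \<mu> x \<in> borel_measurable (borel \<Otimes>\<^sub>M borel)"
  unfolding half_occ_def by measurable

lemma half_occ_measurable' [measurable (raw)]:
  assumes [measurable]: "X \<in> borel_measurable M" "F \<in> borel_measurable M" "Z \<in> borel_measurable M"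
  shows "(\<lambda>w. half_occ d \<mu> (X w) (F w, Z w)) \<in> borel_measurable M"
  unfolding half_occ_def by simp

locale diffusion =
  fixes d \<mu> :: real
  assumes d_pos: "0 < d" and mu_pos: "0 < \<mu>"
begin

abbreviation "plane \<equiv> (lborel \<Otimes>\<^sub>M lborel :: (real \<times> real) measure)"

lemma line_occ_nonneg: "0 \<le> line_occ d \<mu> x z"
  using heat_kernel_nonneg[OF d_pos] mu_pos by (auto simp: line_occ_def indicator_def split: prod.splits)

lemma heat_kernel_antimono:
  assumes "0 < s" "\<bar>x\<bar> \<le> \<bar>y\<bar>"
  shows "heat_kernel d s y \<le> heat_kernel d s x"
  using assms d_pos unfolding heat_kernel_def
  by (intro divide_right_mono) (auto intro!: divide_right_mono abs_le_square_iff[THEN iffD1])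

lemma half_occ_nonneg: 
  assumes "0 \<le> x" shows "0 \<le> half_occ d \<mu> x z"
proof (cases z)
  case (Pair s y)
  have "0 < s \<Longrightarrow> 0 \<le> y \<Longrightarrow> heat_kernel d s (x + y) \<le> heat_kernel d s (x - y)"
    using assms by (intro heat_kernel_antimono) auto
  then show ?thesis using mu_pos by (auto simp: Pair half_occ_def line_occ_def indicator_def)
qed

lemma half_occ_le_line_occ: "half_occ d \<mu> x z \<le> line_occ d \<mu> x z"
  using line_occ_nonneg[of x] by (auto simp: half_occ_def indicator_def split: prod.splits)

lemma exp_density_integral:
  assumes "0 \<le> K"
  shows "has_bochner_integral lborel (\<lambda>s. indicator {K..} s * (\<mu> * exp (- \<mu> * s))) (exp (- \<mu> * K))"
proof -
  have "(\<integral>\<^sup>+s. ennreal (\<mu> * exp (- \<mu> * s)) * indicator {K..} s \<partial>lborel) = ennreal (0 - (- exp (- \<mu> * K)))"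
  proof (rule nn_integral_FTC_atLeast)
    show "((\<lambda>s. - exp (- \<mu> * s)) \<longlongrightarrow> 0) at_top"
      using mu_pos by real_asymp
  qed (use mu_pos in \<open>auto intro!: derivative_eq_intros\<close>)
  then show ?thesis using mu_pos
    by (intro has_bochner_integral_nn_integral) (auto simp: ennreal_mult' ennreal_indicator mult.commute intro!: AE_I2)
qed

text \<open>Tonelli for the occupation density: integrals over the plane reduce to Gaussian
  integrals at each time, followed by an integral over an exponential time. Nonnegativity of
  the integrand makes integrability part of the conclusion.\<close>
lemma occ_slices:
  fixes h :: "real \<times> real \<Rightarrow> real" and H :: "real \<Rightarrow> real"
  assumes [measurable]: "h \<in> borel_measurable (borel \<Otimes>\<^sub>M borel)"
    and h: "\<And>z. 0 \<le> h z" 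
    and H: "\<And>s. 0 < s \<Longrightarrow> has_bochner_integral lborel (\<lambda>y. heat_kernel d s (x - y) * h (s, y)) (H s)"
    and I: "has_bochner_integral lborel (\<lambda>s. indicator {0<..} s * (\<mu> * exp (- \<mu> * s)) * H s) I"
  shows "has_bochner_integral plane (\<lambda>z. line_occ d \<mu> x z * h z) I"
proof -
  have H0: "0 \<le> H s" if "0 < s" for s
    unfolding has_bochner_integral_integral_eq[OF H[OF that], symmetric]
    using heat_kernel_nonneg[OF d_pos that] h by (intro integral_nonneg_AE) auto
  have s: "(\<integral>\<^sup>+y. ennreal (line_occ d \<mu> x (s, y) * h (s, y)) \<partial>lborel) = ennreal (indicator {0<..} s * (\<mu> * exp (- \<mu> * s)) * H s)" for s
  proof (cases "0 < s")
    case True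
    have "has_bochner_integral lborel (\<lambda>y. line_occ d \<mu> x (s, y) * h (s, y)) (indicator {0<..} s * (\<mu> * exp (- \<mu> * s)) * H s)"
      using has_bochner_integral_mult_right[rotated, OF H[OF True], of "\<mu> * exp (- \<mu> * s)"] True
      by (simp add: line_occ_def mult_ac)
    then show ?thesis 
      using h line_occ_nonneg by (subst nn_integral_eq_integral) (auto simp: has_bochner_integral_iff)
  qed (simp add: line_occ_def)
  have "(\<integral>\<^sup>+z. ennreal (line_occ d \<mu> x z * h z) \<partial>plane) = (\<integral>\<^sup>+s. (\<integral>\<^sup>+y. ennreal (line_occ d \<mu> x (s, y) * h (s, y)) \<partial>lborel) \<partial>lborel)"
    by (subst lborel.nn_integral_fst[symmetric]) auto
  also have "\<dots> = ennreal I"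
    unfolding s using I H0 mu_pos
    by (subst nn_integral_eq_integral) (auto simp: has_bochner_integral_iff indicator_def intro!: AE_I2)
  finally show ?thesis
    using h line_occ_nonneg has_bochner_integral_integral_eq[OF I] H0 mu_pos
    by (intro has_bochner_integral_nn_integral)
       (auto intro!: integral_nonneg_AE simp: indicator_def)
qed

lemma line_occ_tail:
  assumes "0 \<le> K"
  shows "has_bochner_integral plane (\<lambda>(s, y). line_occ d \<mu> x (s, y) * indicator {K..} s) (exp (- \<mu> * K))"
proof -
  have "has_bochner_integral plane (\<lambda>z. line_occ d \<mu> x z * (\<lambda>(s, y). indicator {K..} s) z) (exp (- \<mu> * K))"
  proof (rule occ_slices)
    show "has_bochner_integral lborel (\<lambda>y. heat_kernel d s (x - y) * (case (s, y) of (s, y) \<Rightarrow> indicator {K..} s)) (indicator {K..} s)"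
      if "0 < s" for s
      using has_bochner_integral_mult_left[rotated, OF heat_kernel_mass[OF d_pos that]] by simp
    show "has_bochner_integral lborel (\<lambda>s. indicator {0<..} s * (\<mu> * exp (- \<mu> * s)) * indicator {K..} s) (exp (- \<mu> * K))"
      using has_bochner_integral_discrete_difference[of "{0::real}" lborel "\<lambda>s. indicator {K..} s * (\<mu> * exp (- \<mu> * s))" "\<lambda>s. indicator {0<..} s * (\<mu> * exp (- \<mu> * s)) * indicator {K..} s"] exp_density_integral[OF assms] assms
      by (auto simp: indicator_def)
  qed auto
  then show ?thesis by (simp add: case_prod_beta')
qed

lemma line_occ_mass: "has_bochner_integral plane (line_occ d \<mu> x) 1"
proof -
  have "line_occ d \<mu> x = (\<lambda>(s, y). line_occ d \<mu> x (s, y) * indicator {0..} s)"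
    by (auto simp: line_occ_def indicator_def)
  then show ?thesis using line_occ_tail[of 0 x] by simp
qed

text \<open>A Chernoff bound in the making: the Gaussian moment grows like \<open>exp (d
  s)\<close>, hence the restriction to bounded times.\<close>
lemma line_occ_exp_moment:
  assumes "0 \<le> K" "\<bar>\<sigma>\<bar> = 1"
  shows "integrable plane (\<lambda>(s, y). line_occ d \<mu> x (s, y) * (indicator {..<K} s * exp (\<sigma> * (x - y))))" (is ?A)
    and "(\<integral>(s, y). line_occ d \<mu> x (s, y) * (indicator {..<K} s * exp (\<sigma> * (x - y))) \<partial>plane) \<le> exp (d * K)" (is ?B)
proof -
  let ?g = "\<lambda>s. indicator {0<..} s * (\<mu> * exp (- \<mu> * s)) * (indicator {..<K} s * exp (d * s))"
  have e0: "has_bochner_integral lborel (\<lambda>s. indicator {0..} s * (\<mu> * exp (- \<mu> * s))) 1"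
    using exp_density_integral[of 0] by simp
  have le: "?g s \<le> exp (d * K) * (indicator {0..} s * (\<mu> * exp (- \<mu> * s)))" for s
    using d_pos mu_pos by (auto simp: indicator_def mult_ac intro!: mult_left_mono)
  have i: "integrable lborel ?g"
  proof (rule Bochner_Integration.integrable_bound)
    show "integrable lborel (\<lambda>s. exp (d * K) * (indicator {0..} s * (\<mu> * exp (- \<mu> * s))))"
      using e0 by (auto simp: has_bochner_integral_iff)
    show "AE s in lborel. norm (?g s) \<le> norm (exp (d * K) * (indicator {0..} s * (\<mu> * exp (- \<mu> * s))))"
      using le mu_pos by (auto intro!: AE_I2 simp: abs_mult indicator_def)
  qed measurable
  have b: "integral\<^sup>L lborel ?g \<le> exp (d * K)"
    using integral_mono[OF i _ le] e0 by (auto simp: has_bochner_integral_iff)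
  have "has_bochner_integral plane (\<lambda>z. line_occ d \<mu> x z * (\<lambda>(s, y). indicator {..<K} s * exp (\<sigma> * (x - y))) z) (integral\<^sup>L lborel ?g)"
  proof (rule occ_slices)
    show "has_bochner_integral lborel (\<lambda>y. heat_kernel d s (x - y) * (case (s, y) of (s, y) \<Rightarrow> indicator {..<K} s * exp (\<sigma> * (x - y)))) (indicator {..<K} s * exp (d * s))"
      if "0 < s" for s
      using has_bochner_integral_mult_left[rotated, OF heat_kernel_exp_moment[OF d_pos that assms(2), of x], of "indicator {..<K} s"] by (simp add: mult_ac)
    show "has_bochner_integral lborel ?g (integral\<^sup>L lborel ?g)"
      using i by (rule has_bochner_integral_integrable)
  qed auto
  then show ?A ?B using b by (auto simp: case_prod_beta' has_bochner_integral_iff)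
qed

end

section \<open>Laplace transform of the heat kernel and the Green operator\<close>

text \<open>The antiderivative of \<open>exp (- x\<^sup>2)\<close> that vanishes at \<open>-
  \<infinity>\<close>, an error function in a normalisation that keeps constants out of the
  Laplace transform below.\<close>
lemma gauss_cdf:
  obtains \<Phi> :: "real \<Rightarrow> real" where
    "\<And>x. (\<Phi> has_real_derivative exp (- x\<^sup>2)) (at x)"
    "(\<Phi> \<longlongrightarrow> sqrt pi) at_top" "(\<Phi> \<longlongrightarrow> 0) at_bot"
proof -
  define \<Phi> where "\<Phi> x = (LBINT y:{..x}. exp (- y\<^sup>2))" for x :: real
  have i: "has_bochner_integral lborel (\<lambda>x::real. exp (- x\<^sup>2)) (sqrt pi)"
  proof -
    have "exp (- (x\<^sup>2)) = sqrt pi * normal_density 0 (1 / sqrt 2) x" for x :: real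
      by (simp add: normal_density_def power2_eq_square field_simps)
    then show ?thesis
      using integral_normal_density[of "1 / sqrt 2" 0] integrable_normal_density[of "1 / sqrt 2" 0]
      by (simp add: has_bochner_integral_iff)
  qed
  have si: "set_integrable lborel A (\<lambda>y::real. exp (- y\<^sup>2))" if "A \<in> sets lborel" for A
    using i that integrable_mult_indicator[of A lborel "\<lambda>y::real. exp (- y\<^sup>2)"]
    by (auto simp: has_bochner_integral_iff set_integrable_def)
  have diff: "(\<Phi> has_real_derivative exp (- x\<^sup>2)) (at x)" for x
  proof -
    have eq: "\<Phi> z = \<Phi> (x - 1) + (LBINT y=x-1..z. exp (- y\<^sup>2))" if "z \<ge> x - 1" for z
    proof -
      have "\<Phi> z = (LBINT y:{..x-1} \<union> {x-1<..z}. exp (- y\<^sup>2))"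
        unfolding \<Phi>_def using that by (simp add: ivl_disj_un)
      also have "\<dots> = \<Phi> (x - 1) + (LBINT y:{x-1<..z}. exp (- y\<^sup>2))"
        unfolding \<Phi>_def by (rule set_integral_Un) (auto intro!: si)
      finally show ?thesis using that by (simp add: interval_integral_Ioc)
    qed
    have "((\<lambda>z. LBINT y=x-1..z. exp (- y\<^sup>2)) has_vector_derivative exp (- x\<^sup>2)) (at x within {x-1..x+1})"
      by (rule interval_integral_FTC2) (auto intro!: continuous_intros)
    then have "((\<lambda>z. LBINT y=x-1..z. exp (- y\<^sup>2)) has_real_derivative exp (- x\<^sup>2)) (at x)"
      by (subst (asm) at_within_interior) (auto simp: has_real_derivative_iff_has_vector_derivative)
    then have "((\<lambda>z. \<Phi> (x - 1) + (LBINT y=x-1..z. exp (- y\<^sup>2))) has_real_derivative exp (- x\<^sup>2)) (at x)"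
      by (auto intro!: derivative_eq_intros)
    then show ?thesis
      by (rule has_field_derivative_transform_within[where d=1]) (auto simp: dist_real_def intro!: eq[symmetric])
  qed
  have top: "(\<Phi> \<longlongrightarrow> sqrt pi) at_top"
    using tendsto_integral_at_top[of lborel "\<lambda>x::real. exp (- x\<^sup>2)"] i
    by (auto simp: has_bochner_integral_iff \<Phi>_def[abs_def] set_lebesgue_integral_def)
  have "(\<lambda>x. \<Phi> (- x)) = (\<lambda>x. sqrt pi - \<Phi> x)"
  proof
    fix x
    have "\<Phi> (-x) = (\<integral>y. indicator {x..} y * exp (- y\<^sup>2) \<partial>lborel)"
      unfolding \<Phi>_def set_lebesgue_integral_def
      by (subst lborel_integral_real_affine[where c="-1" and t=0]) (auto simp: indicator_def intro!: Bochner_Integration.integral_cong)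
    also have "\<dots> = (LBINT y:{x<..}. exp (- y\<^sup>2))"
      unfolding set_lebesgue_integral_def
      by (rule integral_discrete_difference[of "{x}"]) (auto simp: indicator_def)
    also have "\<dots> = sqrt pi - \<Phi> x"
    proof -
      have "(LBINT y:{..x} \<union> {x<..}. exp (- y\<^sup>2)) = \<Phi> x + (LBINT y:{x<..}. exp (- y\<^sup>2))"
        unfolding \<Phi>_def by (rule set_integral_Un) (auto intro!: si)
      moreover have "{..x} \<union> {x<..} = UNIV" by auto
      ultimately show ?thesis using i by (simp add: set_lebesgue_integral_def has_bochner_integral_iff)
    qed
    finally show "\<Phi> (-x) = sqrt pi - \<Phi> x" .
  qed
  moreover have "((\<lambda>x. sqrt pi - \<Phi> x) \<longlongrightarrow> sqrt pi - sqrt pi) at_top"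
    by (intro tendsto_intros top)
  ultimately have "(\<Phi> \<longlongrightarrow> 0) at_bot"
    by (simp add: filterlim_at_bot_mirror)
  then show thesis using that diff top by blast
qed

context diffusion
begin

text \<open>The decay rate of the bounded solutions of \<open>d w'' = \<mu>
  w\<close>.\<close>
definition a :: real where "a = sqrt (\<mu> / d)"

lemma a_pos: "0 < a" using d_pos mu_pos by (simp add: a_def)

lemma a_sq: "d * a\<^sup>2 = \<mu>" using d_pos mu_pos by (simp add: a_def)

text \<open>The integrand has the explicit antiderivative \<open>c (exp (- 2 A B) \<Phi> (A
  sqrt s - B / sqrt s) + exp (2 A B) \<Phi> (A sqrt s + B / sqrt s))\<close> with \<open>A =
  sqrt \<mu>\<close> and \<open>B = \<bar>z\<bar> / (2 sqrt d)\<close>, whose limits at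
  \<open>0\<close> and \<open>\<infinity>\<close> are read off from those of
  \<open>\<Phi>\<close>. For \<open>z = 0\<close> the arguments would not diverge at
  \<open>0\<close>; a single point does not matter for what follows.\<close>
lemma heat_kernel_laplace_nz:
  assumes "z \<noteq> 0"
  shows "has_bochner_integral lborel (\<lambda>s. indicator {0<..} s * (\<mu> * exp (- \<mu> * s) * heat_kernel d s z)) (a / 2 * exp (- a * \<bar>z\<bar>))"
proof -
  obtain \<Phi> where P: "\<And>x. (\<Phi> has_real_derivative exp (- x\<^sup>2)) (at x)"
    "(\<Phi> \<longlongrightarrow> sqrt pi) at_top" "(\<Phi> \<longlongrightarrow> 0) at_bot" by (rule gauss_cdf) blast
  define A where "A = sqrt \<mu>"
  define B where "B = \<bar>z\<bar> / (2 * sqrt d)"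
  have A: "0 < A" "A\<^sup>2 = \<mu>" and B: "0 < B" "B\<^sup>2 = z\<^sup>2 / (4 * d)"
    using mu_pos d_pos assms by (auto simp: A_def B_def power_divide power_mult_distrib)
  have AB: "2 * (A * B) = a * \<bar>z\<bar>"
    using d_pos by (simp add: A_def B_def a_def real_sqrt_divide)
  define c where "c = \<mu> / (A * sqrt (4 * pi * d))"
  define F where "F s = c * (exp (- (2 * (A * B))) * \<Phi> (A * sqrt s - B / sqrt s) + exp (2 * (A * B)) * \<Phi> (A * sqrt s + B / sqrt s))" for s
  let ?f = "\<lambda>s. \<mu> * exp (- \<mu> * s) * heat_kernel d s z"
  have dF: "(F has_real_derivative ?f s) (at s)" if "0 < s" for s
  proof -
    define q where "q = sqrt s"
    have q: "0 < q" "q\<^sup>2 = s" "sqrt s = q" using that by (auto simp: q_def)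
    have "((\<lambda>s. A * sqrt s - B / sqrt s) has_real_derivative A * (inverse q / 2) + B * (inverse q / 2) / q\<^sup>2) (at s)"
      using that q(1) by (auto intro!: derivative_eq_intros simp: q(3)[symmetric] power2_eq_square)
    moreover have "((\<lambda>s. A * sqrt s + B / sqrt s) has_real_derivative A * (inverse q / 2) - B * (inverse q / 2) / q\<^sup>2) (at s)"
      using that q(1) by (auto intro!: derivative_eq_intros simp: q(3)[symmetric] power2_eq_square)
    ultimately have "(F has_real_derivative c * (exp (- (2 * (A * B))) * (exp (- (A * q - B / q)\<^sup>2) * (A * (inverse q / 2) + B * (inverse q / 2) / q\<^sup>2))
        + exp (2 * (A * B)) * (exp (- (A * q + B / q)\<^sup>2) * (A * (inverse q / 2) - B * (inverse q / 2) / q\<^sup>2)))) (at s)"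
      unfolding F_def q(3)[symmetric] by (intro DERIV_cmult DERIV_add DERIV_chain2[OF P(1)])
    moreover have e1: "exp (- (2 * (A * B))) * exp (- (A * q - B / q)\<^sup>2) = exp (- (\<mu> * s) - B\<^sup>2 / s)"
      unfolding exp_add[symmetric] using q(1) A(2) q(2)[symmetric]
      by (simp add: power2_diff power_mult_distrib power_divide)
    moreover have e2: "exp (2 * (A * B)) * exp (- (A * q + B / q)\<^sup>2) = exp (- (\<mu> * s) - B\<^sup>2 / s)"
      unfolding exp_add[symmetric] using q(1) A(2) q(2)[symmetric]
      by (simp add: power2_sum power_mult_distrib power_divide)
    ultimately have 1: "(F has_real_derivative c * (exp (- (\<mu> * s) - B\<^sup>2 / s) * (A * inverse q))) (at s)"
      unfolding mult.assoc[symmetric] e1 e2 by (simp add: algebra_simps)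
    have "c * (exp (- (\<mu> * s) - B\<^sup>2 / s) * (A * inverse q)) = ?f s"
    proof -
      have "z\<^sup>2 / (4 * d * s) = B\<^sup>2 / s" "sqrt (4 * pi * d * s) = sqrt (4 * pi * d) * q"
        using q by (simp_all add: B(2) real_sqrt_mult)
      then have "?f s = \<mu> * exp (- (\<mu> * s)) * (exp (- (B\<^sup>2 / s)) / (sqrt (4 * pi * d) * q))"
        by (simp add: heat_kernel_def)
      also have "\<dots> = \<mu> * exp (- (\<mu> * s) - B\<^sup>2 / s) / (sqrt (4 * pi * d) * q)"
        by (simp only: diff_conv_add_uminus exp_add times_divide_eq_right mult.assoc)
      also have "\<dots> = c * (exp (- (\<mu> * s) - B\<^sup>2 / s) * (A * inverse q))"
        using A(1) q(1) by (simp add: c_def divide_inverse)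
      finally show ?thesis by simp
    qed
    with 1 show ?thesis by simp
  qed
  have lim0: "((F \<circ> real_of_ereal) \<longlongrightarrow> c * (exp (- (2 * (A * B))) * 0 + exp (2 * (A * B)) * sqrt pi)) (at_right (ereal 0))"
  proof -
    have "filterlim (\<lambda>s. A * sqrt s - B / sqrt s) at_bot (at_right 0)" using A B by real_asymp
    moreover have "filterlim (\<lambda>s. A * sqrt s + B / sqrt s) at_top (at_right 0)" using A B by real_asymp
    ultimately have "(F \<longlongrightarrow> c * (exp (- (2 * (A * B))) * 0 + exp (2 * (A * B)) * sqrt pi)) (at_right 0)"
      unfolding F_def by (intro tendsto_intros filterlim_compose[OF P(2)] filterlim_compose[OF P(3)])
    then show ?thesis by (subst ereal_tendsto_simps1)
  qed
  have lim1: "((F \<circ> real_of_ereal) \<longlongrightarrow> c * (exp (- (2 * (A * B))) * sqrt pi + exp (2 * (A * B)) * sqrt pi)) (at_left \<infinity>)"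
  proof -
    have "filterlim (\<lambda>s. A * sqrt s - B / sqrt s) at_top at_top" using A B by real_asymp
    moreover have "filterlim (\<lambda>s. A * sqrt s + B / sqrt s) at_top at_top" using A B by real_asymp
    ultimately have "(F \<longlongrightarrow> c * (exp (- (2 * (A * B))) * sqrt pi + exp (2 * (A * B)) * sqrt pi)) at_top"
      unfolding F_def by (intro tendsto_intros filterlim_compose[OF P(2)])
    then show ?thesis by (subst ereal_tendsto_simps1)
  qed
  have cont: "isCont ?f s" if "ereal 0 < ereal s" "ereal s < \<infinity>" for s
    using that d_pos unfolding heat_kernel_def by (auto intro!: continuous_intros)
  have nn: "AE s in lborel. ereal 0 < ereal s \<longrightarrow> ereal s < \<infinity> \<longrightarrow> 0 \<le> ?f s"
    using heat_kernel_nonneg[OF d_pos] mu_pos by auto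
  have dF': "\<And>x. ereal 0 < ereal x \<Longrightarrow> ereal x < \<infinity> \<Longrightarrow> DERIV F x :> ?f x" using dF by simp
  have "set_integrable lborel (einterval (ereal 0) \<infinity>) ?f"
    and "(LBINT s=ereal 0..\<infinity>. ?f s) = c * (exp (- (2 * (A * B))) * sqrt pi)"
    using interval_integral_FTC_nonneg[of "ereal 0" "\<infinity>" F ?f, OF _ dF' cont nn lim0 lim1]
    by (auto simp: algebra_simps)
  moreover have "c * (exp (- (2 * (A * B))) * sqrt pi) = a / 2 * exp (- a * \<bar>z\<bar>)"
    unfolding AB unfolding c_def a_def A_def using d_pos mu_pos
    by (simp add: real_sqrt_mult real_sqrt_divide field_simps)
  ultimately show ?thesis
    by (simp add: has_bochner_integral_iff set_integrable_def interval_lebesgue_integral_def set_lebesgue_integral_def einterval_def greaterThan_def)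
qed

lemma line_occ_integrable [intro]:
  assumes "h \<in> borel_measurable (borel \<Otimes>\<^sub>M borel)" "\<And>z. \<bar>h z\<bar> \<le> B"
  shows "integrable plane (\<lambda>z. line_occ d \<mu> x z * h z)"
proof (rule Bochner_Integration.integrable_bound)
  show "integrable plane (\<lambda>z. line_occ d \<mu> x z * B)"
    using line_occ_mass by (auto simp: has_bochner_integral_iff)
  show "AE z in plane. norm (line_occ d \<mu> x z * h z) \<le> norm (line_occ d \<mu> x z * B)"
    using assms(2) line_occ_nonneg order_trans[OF assms(2) abs_ge_self]
    by (auto intro!: AE_I2 mult_left_mono simp: abs_mult)
qed (use assms in measurable)

lemma half_occ_integrable [intro]:
  assumes "h \<in> borel_measurable (borel \<Otimes>\<^sub>M borel)" "\<And>z. \<bar>h z\<bar> \<le> B" "0 \<le> x"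
  shows "integrable plane (\<lambda>z. half_occ d \<mu> x z * h z)"
proof (rule Bochner_Integration.integrable_bound)
  show "integrable plane (\<lambda>z. line_occ d \<mu> x z * B)"
    using line_occ_mass by (auto simp: has_bochner_integral_iff)
  have "half_occ d \<mu> x z * \<bar>h z\<bar> \<le> line_occ d \<mu> x z * \<bar>B\<bar>" for z
    using half_occ_le_line_occ[of x z] assms(2)[of z] half_occ_nonneg[OF assms(3), of z]
    by (intro mult_mono) auto
  then show "AE z in plane. norm (half_occ d \<mu> x z * h z) \<le> norm (line_occ d \<mu> x z * B)"
    using line_occ_nonneg half_occ_nonneg[OF assms(3)] by (auto simp: abs_mult)
qed (use assms in measurable)

lemma half_occ_mass_le: "0 \<le> x \<Longrightarrow> integral\<^sup>L plane (half_occ d \<mu> x) \<le> 1"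
  using integral_mono[of plane "half_occ d \<mu> x" "line_occ d \<mu> x"] half_occ_integrable[of "\<lambda>_. 1" 1 x]
    line_occ_mass[of x] half_occ_le_line_occ by (auto simp: has_bochner_integral_iff)

abbreviation green_kernel :: "real \<Rightarrow> real \<Rightarrow> real" where
  "green_kernel x y \<equiv> a / 2 * (exp (- a * \<bar>x - y\<bar>) - exp (- a * (x + y)))"

text \<open>The solution operator of \<open>w - w'' / a\<^sup>2 = g\<close> on the
  half-line, \<open>w(0) = 0\<close>, for bounded \<open>g\<close>.\<close>
definition green :: "(real \<Rightarrow> real) \<Rightarrow> real \<Rightarrow> real" where
  "green g x = (LBINT y:{0..}. green_kernel x y * g y)"

text \<open>A function that does not depend on time sees only the time marginal of the
  occupation density, which is the Green kernel by the Laplace transform. This is why the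
  delay does not occur in the steady state equation.\<close>
lemma half_occ_green:
  assumes [measurable]: "g \<in> borel_measurable borel" and B: "\<And>y. \<bar>g y\<bar> \<le> B" and x: "0 \<le> x"
  shows "(\<integral>(s, y). half_occ d \<mu> x (s, y) * g y \<partial>plane) = green g x"
proof -
  have i: "integrable plane (\<lambda>(s, y). half_occ d \<mu> x (s, y) * g y)"
    using half_occ_integrable[of "\<lambda>(s, y). g y" B x] B x by (simp add: case_prod_beta')
  have "(\<integral>(s, y). half_occ d \<mu> x (s, y) * g y \<partial>plane) = (\<integral>y. (\<integral>s. half_occ d \<mu> x (s, y) * g y \<partial>lborel) \<partial>lborel)"
    using lborel_pair.integral_snd[OF i] by simp
  also have "\<dots> = green g x"
    unfolding green_def set_lebesgue_integral_def
  proof (rule integral_cong_AE)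
    have *: "(\<integral>s. half_occ d \<mu> x (s, y) * g y \<partial>lborel) = indicator {0..} y *\<^sub>R (green_kernel x y * g y)"
      if "y \<noteq> x" "y \<noteq> - x" for y
    proof (cases "0 \<le> y")
      case True
      have "half_occ d \<mu> x (s, y) * g y = (indicator {0<..} s * (\<mu> * exp (- \<mu> * s) * heat_kernel d s (x - y))
          - indicator {0<..} s * (\<mu> * exp (- \<mu> * s) * heat_kernel d s (x + y))) * g y" for s
        using True by (simp add: half_occ_def line_occ_def)
      note e = this
      show ?thesis
        unfolding e
        using heat_kernel_laplace_nz[of "x - y"] heat_kernel_laplace_nz[of "x + y"] that x True
        by (simp add: has_bochner_integral_iff right_diff_distrib)
    qed (simp add: half_occ_def)
    show "AE y in lborel. (\<integral>s. half_occ d \<mu> x (s, y) * g y \<partial>lborel) = indicator {0..} y *\<^sub>R (green_kernel x y * g y)"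
      using AE_lborel_singleton[of x] AE_lborel_singleton[of "- x"]
      by eventually_elim (use * in auto)
  qed measurable
  finally show ?thesis .
qed

section \<open>The variation of constants formula as an occupation integral\<close>

text \<open>The Duhamel term looks back over the age \<open>s = t - r\<close> of the
  reaction; after this time reversal Fubini makes the iterated integral one integral over
  the plane. The kernel \<open>\<rho>\<close> is \<open>line_occ\<close> or
  \<open>half_occ\<close>.\<close>
lemma duhamel_occupation:
  fixes S :: "real \<Rightarrow> (real \<Rightarrow> real) \<Rightarrow> real" and \<rho> :: "real \<times> real \<Rightarrow> real"
  assumes S: "\<And>s g. 0 < s \<Longrightarrow> S s (\<lambda>y. \<mu> * g y) = (\<integral>y. \<rho> (s, y) * g y \<partial>lborel)"
    and int: "\<And>h B. h \<in> borel_measurable (borel \<Otimes>\<^sub>M borel) \<Longrightarrow> (\<And>z. \<bar>h z\<bar> \<le> B) \<Longrightarrow> integrable plane (\<lambda>z. \<rho> z * h z)"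
    and F: "(\<lambda>(r, y). F r y) \<in> borel_measurable (borel \<Otimes>\<^sub>M borel)"
    and B: "\<And>r y. r \<le> t - \<tau> \<Longrightarrow> \<bar>F r y\<bar> \<le> B" and t: "0 < t"
  shows "(LBINT r:{0<..<t}. S (t - r) (\<lambda>y. \<mu> * F (r - \<tau>) y))
    = (\<integral>(s, y). \<rho> (s, y) * (indicator {0<..<t} s * F (t - s - \<tau>) y) \<partial>plane)"
proof -
  have m: "(\<lambda>z. F (fst z) (snd z)) \<in> borel_measurable (borel \<Otimes>\<^sub>M borel)"
    using F by (simp add: case_prod_beta')
  have [measurable]: "(\<lambda>z. F (t - fst z - \<tau>) (snd z)) \<in> borel_measurable (borel \<Otimes>\<^sub>M borel)"
    using measurable_compose[of "\<lambda>z. (t - fst z - \<tau>, snd z)" "borel \<Otimes>\<^sub>M borel" "borel \<Otimes>\<^sub>M borel", OF _ m] by simp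
  have i: "integrable plane (\<lambda>z. \<rho> z * (indicator {0<..<t} (fst z) * F (t - fst z - \<tau>) (snd z)))"
  proof (rule int)
    show "\<bar>indicator {0<..<t} (fst z) * F (t - fst z - \<tau>) (snd z)\<bar> \<le> \<bar>B\<bar>" for z
      using B[of "t - fst z - \<tau>" "snd z"] by (auto simp: indicator_def)
  qed measurable
  have "(\<integral>(s, y). \<rho> (s, y) * (indicator {0<..<t} s * F (t - s - \<tau>) y) \<partial>plane)
    = (\<integral>z. \<rho> z * (indicator {0<..<t} (fst z) * F (t - fst z - \<tau>) (snd z)) \<partial>plane)"
    by (simp add: case_prod_beta')
  also have "\<dots> = (\<integral>s. (\<integral>y. \<rho> (s, y) * (indicator {0<..<t} s * F (t - s - \<tau>) y) \<partial>lborel) \<partial>lborel)"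
    using lborel_pair.integral_fst'[OF i] by simp
  also have "\<dots> = (\<integral>s. indicator {0<..<t} s * S s (\<lambda>y. \<mu> * F (t - s - \<tau>) y) \<partial>lborel)"
  proof (intro Bochner_Integration.integral_cong refl)
    fix s
    show "(\<integral>y. \<rho> (s, y) * (indicator {0<..<t} s * F (t - s - \<tau>) y) \<partial>lborel) = indicator {0<..<t} s * S s (\<lambda>y. \<mu> * F (t - s - \<tau>) y)"
      by (cases "s \<in> {0<..<t}") (simp_all add: S)
  qed
  also have "\<dots> = (\<integral>r. indicator {0<..<t} (t - r) * S (t - r) (\<lambda>y. \<mu> * F (t - (t - r) - \<tau>) y) \<partial>lborel)"
    by (subst lborel_integral_real_affine[where c="-1" and t=t]) auto
  also have "\<dots> = (LBINT r:{0<..<t}. S (t - r) (\<lambda>y. \<mu> * F (r - \<tau>) y))"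
    unfolding set_lebesgue_integral_def by (intro Bochner_Integration.integral_cong) (auto simp: indicator_def)
  finally show ?thesis by simp
qed

lemma half_duhamel:
  assumes "0 < t" "0 \<le> x" "(\<lambda>(r, y). F r y) \<in> borel_measurable (borel \<Otimes>\<^sub>M borel)"
    and "\<And>r y. r \<le> t - \<tau> \<Longrightarrow> \<bar>F r y\<bar> \<le> B"
  shows "(LBINT r:{0<..<t}. dirichlet_semigroup d \<mu> (t - r) (\<lambda>y. \<mu> * F (r - \<tau>) y) x)
    = (\<integral>(s, y). half_occ d \<mu> x (s, y) * (indicator {0<..<t} s * F (t - s - \<tau>) y) \<partial>plane)"
proof (rule duhamel_occupation[where S="\<lambda>s g. dirichlet_semigroup d \<mu> s g x", OF _ _ assms(3,4,1)])
  fix s :: real and g assume "0 < s"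
  then have e: "half_occ d \<mu> x (s, y) * g y = exp (- \<mu> * s) * (indicator {0..} y * ((heat_kernel d s (x - y) - heat_kernel d s (x + y)) * (\<mu> * g y)))" for y
    by (auto simp: half_occ_def line_occ_def indicator_def algebra_simps)
  show "dirichlet_semigroup d \<mu> s (\<lambda>y. \<mu> * g y) x = (\<integral>y. half_occ d \<mu> x (s, y) * g y \<partial>lborel)"
    unfolding e by (simp add: dirichlet_semigroup_def set_lebesgue_integral_def)
qed (rule half_occ_integrable[OF _ _ assms(2)])

lemma line_duhamel:
  assumes "0 < t" "(\<lambda>(r, y). F r y) \<in> borel_measurable (borel \<Otimes>\<^sub>M borel)"
    and "\<And>r y. r \<le> t - \<tau> \<Longrightarrow> \<bar>F r y\<bar> \<le> B"
  shows "(LBINT r:{0<..<t}. line_semigroup d \<mu> (t - r) (\<lambda>y. \<mu> * F (r - \<tau>) y) x)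
    = (\<integral>(s, y). line_occ d \<mu> x (s, y) * (indicator {0<..<t} s * F (t - s - \<tau>) y) \<partial>plane)"
proof (rule duhamel_occupation[where S="\<lambda>s g. line_semigroup d \<mu> s g x", OF _ _ assms(2,3,1)])
  fix s :: real and g assume "0 < s"
  then have e: "line_occ d \<mu> x (s, y) * g y = exp (- \<mu> * s) * (heat_kernel d s (x - y) * (\<mu> * g y))" for y
    by (auto simp: line_occ_def indicator_def algebra_simps)
  show "line_semigroup d \<mu> s (\<lambda>y. \<mu> * g y) x = (\<integral>y. line_occ d \<mu> x (s, y) * g y \<partial>lborel)"
    unfolding e by (simp add: line_semigroup_def)
qed (rule line_occ_integrable)

abbreviation dirichlet_kernel :: "real \<Rightarrow> real \<Rightarrow> real \<Rightarrow> real" where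
  "dirichlet_kernel t x y \<equiv> heat_kernel d t (x - y) - heat_kernel d t (x + y)"

section \<open>The Dirichlet semigroup\<close>

lemma dirichlet_kernel_nonneg: "0 < t \<Longrightarrow> 0 \<le> x \<Longrightarrow> 0 \<le> y \<Longrightarrow> 0 \<le> dirichlet_kernel t x y"
  using heat_kernel_antimono[of t "x - y" "x + y"] by auto

lemma half_occ_eq: "half_occ d \<mu> x (s, y) = indicator {0..} y * (indicator {0<..} s * (\<mu> * exp (- \<mu> * s) * dirichlet_kernel s x y))"
  by (simp add: half_occ_def line_occ_def indicator_def algebra_simps)

lemma dirichlet_kernel_integrable:
  assumes "0 < t" "0 \<le> x" and [measurable]: "g \<in> borel_measurable borel" and B: "\<And>y. 0 \<le> y \<Longrightarrow> \<bar>g y\<bar> \<le> B"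
  shows "integrable lborel (\<lambda>y. indicator {0..} y * (dirichlet_kernel t x y * g y))"
proof (rule Bochner_Integration.integrable_bound)
  show "integrable lborel (\<lambda>y. heat_kernel d t (x - y) * B)"
    using heat_kernel_mass[OF d_pos assms(1)] by (auto simp: has_bochner_integral_iff)
  have "dirichlet_kernel t x y * \<bar>g y\<bar> \<le> heat_kernel d t (x - y) * \<bar>B\<bar>" if "0 \<le> y" for y
    using dirichlet_kernel_nonneg[OF assms(1,2) that] B[OF that] heat_kernel_nonneg[OF d_pos assms(1), of "x + y"]
    by (intro mult_mono) auto
  then show "AE y in lborel. norm (indicator {0..} y * (dirichlet_kernel t x y * g y)) \<le> norm (heat_kernel d t (x - y) * B)"
    using dirichlet_kernel_nonneg[OF assms(1,2)] heat_kernel_nonneg[OF d_pos assms(1)] by (auto simp: abs_mult indicator_def)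
qed measurable

lemma dirichlet_kernel_mass_le:
  assumes "0 < t" "0 \<le> x"
  shows "(\<integral>y. indicator {0..} y * dirichlet_kernel t x y \<partial>lborel) \<le> 1"
proof -
  have "(\<integral>y. indicator {0..} y * dirichlet_kernel t x y \<partial>lborel) \<le> (\<integral>y. heat_kernel d t (x - y) \<partial>lborel)"
    using dirichlet_kernel_integrable[OF assms, of "\<lambda>_. 1" 1] heat_kernel_mass[OF d_pos assms(1), of x]
      heat_kernel_nonneg[OF d_pos assms(1)]
    by (intro integral_mono) (auto simp: has_bochner_integral_iff indicator_def)
  then show ?thesis using heat_kernel_mass[OF d_pos assms(1), of x] by (simp add: has_bochner_integral_iff)
qed

text \<open>The integrand is even in the intermediate point, so that the integral over the
  half-line is half of the one over the line. The latter consists of four convolutions of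
  heat kernels.\<close>
lemma dirichlet_kernel_chapman_kolmogorov:
  assumes "0 < t" "0 < s"
  shows "(\<integral>z. indicator {0..} z * (dirichlet_kernel t x z * dirichlet_kernel s z y) \<partial>lborel) = dirichlet_kernel (t + s) x y"
proof -
  let ?p = "\<lambda>z. dirichlet_kernel t x z * dirichlet_kernel s z y"
  let ?k = "heat_kernel d"
  note C = heat_kernel_convolution[OF d_pos assms]
  have C': "has_bochner_integral lborel (\<lambda>z. ?k t (x + z) * ?k s (z + y)) (?k (t + s) (x - y))" for y
  proof -
    have "has_bochner_integral lborel (\<lambda>z. ?k t (x - - z) * ?k s (- z - y)) (?k (t + s) (x - y))"
      using lborel_has_bochner_integral_real_affine_iff[of "- 1" "\<lambda>z. ?k t (x - z) * ?k s (z - y)" "?k (t + s) (x - y)" 0] C[of x y]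
      by simp
    moreover have "?k s (- z - y) = ?k s (z + y)" for z
    proof -
      have "- z - y = - (z + y)" by simp
      then show ?thesis by (metis heat_kernel_uminus)
    qed
    ultimately show ?thesis by simp
  qed
  have "has_bochner_integral lborel (\<lambda>z. (?k t (x - z) * ?k s (z - y) - ?k t (x - z) * ?k s (z - - y))
      - (?k t (x + z) * ?k s (z + - y) - ?k t (x + z) * ?k s (z + y)))
      ((?k (t + s) (x - y) - ?k (t + s) (x - - y)) - (?k (t + s) (x - - y) - ?k (t + s) (x - y)))"
    by (intro has_bochner_integral_diff C C')
  then have p: "has_bochner_integral lborel ?p (2 * dirichlet_kernel (t + s) x y)"
    by (simp add: algebra_simps)
  have int: "integrable lborel (\<lambda>z. indicator A z * ?p z)" if "A \<in> sets borel" for A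
    using integrable_mult_indicator[of A lborel ?p] p that by (auto simp: has_bochner_integral_iff)
  have even: "?p (- z) = ?p z" for z
  proof -
    have "- z - y = - (z + y)" "- z + y = - (z - y)" by simp_all
    then have "?k s (- z - y) = ?k s (z + y)" "?k s (- z + y) = ?k s (z - y)" by (metis heat_kernel_uminus)+
    then show ?thesis by (simp add: algebra_simps)
  qed
  have "integral\<^sup>L lborel ?p = (\<integral>z. indicator {0..} z * ?p z + indicator {..<0} z * ?p z \<partial>lborel)"
    by (intro Bochner_Integration.integral_cong) (auto simp: indicator_def)
  also have "\<dots> = (\<integral>z. indicator {0..} z * ?p z \<partial>lborel) + (\<integral>z. indicator {..<0} z * ?p z \<partial>lborel)"
    by (intro Bochner_Integration.integral_add int) auto
  also have "(\<integral>z. indicator {..<0} z * ?p z \<partial>lborel) = (\<integral>z. indicator {..<0} (- z) * ?p (- z) \<partial>lborel)"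
    by (subst lborel_integral_real_affine[where c="- 1" and t=0]) auto
  also have "\<dots> = (\<integral>z. indicator {0<..} z * ?p z \<partial>lborel)"
    unfolding even by (intro Bochner_Integration.integral_cong) (auto simp: indicator_def)
  also have "\<dots> = (\<integral>z. indicator {0..} z * ?p z \<partial>lborel)"
    by (rule integral_discrete_difference[of "{0}"]) (auto simp: indicator_def)
  finally show ?thesis using p by (simp add: has_bochner_integral_iff)
qed

lemma dirichlet_semigroup_eq:
  "dirichlet_semigroup d \<mu> t g x = exp (- \<mu> * t) * (\<integral>y. indicator {0..} y * (dirichlet_kernel t x y * g y) \<partial>lborel)"
  by (simp add: dirichlet_semigroup_def set_lebesgue_integral_def)

lemma sigma_finite_plane: "sigma_finite_measure plane"
  by (simp add: lborel_prod sigma_finite_lborel)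

text \<open>The product structure is left abstract, as two kernels \<open>\<rho>\<close>
  with mass at most one are needed: the semigroup kernel and the occupation density.\<close>
lemma dirichlet_kernel_integrable_prod:
  fixes \<rho> :: "real \<Rightarrow> 'a \<Rightarrow> real" and h :: "'a \<Rightarrow> real"
  assumes N: "sigma_finite_measure N" and t: "0 < t" and x: "0 \<le> x"
    and [measurable]: "(\<lambda>(z, p). \<rho> z p) \<in> borel_measurable (borel \<Otimes>\<^sub>M N)" "h \<in> borel_measurable N"
    and \<rho>: "\<And>z p. 0 \<le> z \<Longrightarrow> 0 \<le> \<rho> z p" "\<And>z. 0 \<le> z \<Longrightarrow> integrable N (\<rho> z)" "\<And>z. 0 \<le> z \<Longrightarrow> integral\<^sup>L N (\<rho> z) \<le> 1"
    and h: "\<And>p. \<bar>h p\<bar> \<le> B"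
  shows "integrable (lborel \<Otimes>\<^sub>M N) (\<lambda>(z, p). indicator {0..} z * (dirichlet_kernel t x z * (\<rho> z p * h p)))"
proof -
  interpret N: sigma_finite_measure N by fact
  interpret pair_sigma_finite lborel N ..
  have m [measurable]: "(\<lambda>w. \<rho> (fst w) (snd w)) \<in> borel_measurable (borel \<Otimes>\<^sub>M N)"
    using assms(4) by (simp add: case_prod_beta')
  have [measurable]: "(\<lambda>p. \<rho> z p) \<in> borel_measurable N" for z
    using measurable_compose[OF measurable_Pair1', OF _ m, of z] by simp
  have rh: "integrable N (\<lambda>p. \<rho> z p * h p)" if "0 \<le> z" for z
  proof (rule Bochner_Integration.integrable_bound)
    show "integrable N (\<lambda>p. \<rho> z p * B)" using \<rho>(2)[OF that] by simp
    show "AE p in N. norm (\<rho> z p * h p) \<le> norm (\<rho> z p * B)"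
      using \<rho>(1)[OF that] h order_trans[OF h abs_ge_self] by (auto simp: abs_mult intro!: mult_left_mono AE_I2)
  qed measurable
  let ?G = "\<lambda>(z, p). indicator {0..} z * (dirichlet_kernel t x z * (\<rho> z p * h p))"
  show ?thesis
  proof (rule Fubini_integrable)
    show "?G \<in> borel_measurable (lborel \<Otimes>\<^sub>M N)" by (simp add: case_prod_beta')
    show "AE z in lborel. integrable N (\<lambda>p. ?G (z, p))"
      using rh by (auto simp: indicator_def intro!: AE_I2)
    have le: "(\<integral>p. norm (?G (z, p)) \<partial>N) \<le> norm (indicator {0..} z * (dirichlet_kernel t x z * B))" for z
    proof (cases "0 \<le> z")
      case True
      have "0 \<le> B" using h[of undefined] by linarith
      have "(\<integral>p. norm (?G (z, p)) \<partial>N) = dirichlet_kernel t x z * (\<integral>p. \<rho> z p * \<bar>h p\<bar> \<partial>N)"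
        using True dirichlet_kernel_nonneg[OF t x True] \<rho>(1)[OF True] by (simp add: abs_mult)
      also have "(\<integral>p. \<rho> z p * \<bar>h p\<bar> \<partial>N) \<le> (\<integral>p. \<rho> z p * B \<partial>N)"
        using rh[OF True] \<rho>(1,2)[OF True] h by (intro integral_mono) (auto intro!: mult_left_mono
            dest: integrable_abs simp: abs_mult)
      also have "\<dots> \<le> 1 * B" using \<rho>(2)[OF True] mult_right_mono[OF \<rho>(3)[OF True] \<open>0 \<le> B\<close>] by simp
      finally show ?thesis using True dirichlet_kernel_nonneg[OF t x True] \<open>0 \<le> B\<close> by (simp add: mult_left_mono)
    qed simp
    show "integrable lborel (\<lambda>z. \<integral>p. norm (?G (z, p)) \<partial>N)"
    proof (rule Bochner_Integration.integrable_bound)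
      show "integrable lborel (\<lambda>z. indicator {0..} z * (dirichlet_kernel t x z * B))"
        using dirichlet_kernel_integrable[OF t x, of "\<lambda>_. B" "\<bar>B\<bar>"] by simp
      show "AE z in lborel. norm (\<integral>p. norm (?G (z, p)) \<partial>N) \<le> norm (indicator {0..} z * (dirichlet_kernel t x z * B))"
        using le by (intro AE_I2) (simp add: integral_nonneg_AE)
      have "?G \<in> borel_measurable (lborel \<Otimes>\<^sub>M N)" by (simp add: case_prod_beta')
      then show "(\<lambda>z. \<integral>p. norm (?G (z, p)) \<partial>N) \<in> borel_measurable lborel"
        by (intro N.borel_measurable_lebesgue_integral) (simp add: case_prod_beta')
    qed
  qed
qed

text \<open>The semigroup acts on a function that is itself an integral against a kernel
  \<open>\<rho>\<close>; if \<open>R\<close> is the composed kernel, then \<open>R\<close>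
  represents the result.\<close>
lemma dirichlet_kernel_fubini:
  fixes \<rho> :: "real \<Rightarrow> 'a \<Rightarrow> real" and h :: "'a \<Rightarrow> real"
  assumes N: "sigma_finite_measure N" and t: "0 < t" and x: "0 \<le> x"
    and [measurable]: "(\<lambda>(z, p). \<rho> z p) \<in> borel_measurable (borel \<Otimes>\<^sub>M N)" "h \<in> borel_measurable N"
    and \<rho>: "\<And>z p. 0 \<le> z \<Longrightarrow> 0 \<le> \<rho> z p" "\<And>z. 0 \<le> z \<Longrightarrow> integrable N (\<rho> z)" "\<And>z. 0 \<le> z \<Longrightarrow> integral\<^sup>L N (\<rho> z) \<le> 1"
    and h: "\<And>p. \<bar>h p\<bar> \<le> B"
    and R: "\<And>p. (\<integral>z. indicator {0..} z * (dirichlet_kernel t x z * \<rho> z p) \<partial>lborel) = R p"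
  shows "(\<integral>z. indicator {0..} z * (dirichlet_kernel t x z * (\<integral>p. \<rho> z p * h p \<partial>N)) \<partial>lborel) = (\<integral>p. R p * h p \<partial>N)"
proof -
  interpret N: sigma_finite_measure N by fact
  interpret pair_sigma_finite lborel N ..
  have "(\<integral>p. R p * h p \<partial>N) = (\<integral>p. (\<integral>z. indicator {0..} z * (dirichlet_kernel t x z * (\<rho> z p * h p)) \<partial>lborel) \<partial>N)"
  proof (intro Bochner_Integration.integral_cong refl)
    fix p
    have "indicator {0..} z * (dirichlet_kernel t x z * (\<rho> z p * h p)) = (indicator {0..} z * (dirichlet_kernel t x z * \<rho> z p)) * h p" for z
      by simp
    then show "R p * h p = (\<integral>z. indicator {0..} z * (dirichlet_kernel t x z * (\<rho> z p * h p)) \<partial>lborel)"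
      by (simp only: integral_mult_left_zero R)
  qed
  also have "\<dots> = (\<integral>z. (\<integral>p. indicator {0..} z * (dirichlet_kernel t x z * (\<rho> z p * h p)) \<partial>N) \<partial>lborel)"
    by (rule Fubini_integral, rule dirichlet_kernel_integrable_prod[OF assms(1-9)])
  finally show ?thesis by simp
qed

lemma dirichlet_semigroup_semigroup:
  assumes "0 < t" "0 < s" "0 \<le> x" and [measurable]: "g \<in> borel_measurable borel" and B: "\<And>y. \<bar>g y\<bar> \<le> B"
  shows "dirichlet_semigroup d \<mu> t (dirichlet_semigroup d \<mu> s g) x = dirichlet_semigroup d \<mu> (t + s) g x"
proof -
  have "(\<integral>z. indicator {0..} z * (dirichlet_kernel t x z * (\<integral>y. indicator {0..} y * dirichlet_kernel s z y * g y \<partial>lborel)) \<partial>lborel)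
     = (\<integral>y. indicator {0..} y * dirichlet_kernel (t + s) x y * g y \<partial>lborel)"
  proof (rule dirichlet_kernel_fubini[OF _ assms(1,3)])
    show "(\<integral>z. indicator {0..} z * (dirichlet_kernel t x z * (indicator {0..} y * dirichlet_kernel s z y)) \<partial>lborel) = indicator {0..} y * dirichlet_kernel (t + s) x y" for y
      using dirichlet_kernel_chapman_kolmogorov[OF assms(1,2), of x y] by (cases "0 \<le> y") auto
    show "integrable lborel (\<lambda>y. indicator {0..} y * dirichlet_kernel s z y)" if "0 \<le> z" for z
      using dirichlet_kernel_integrable[OF assms(2) that, of "\<lambda>_. 1" 1] by simp
  qed (use B dirichlet_kernel_nonneg[OF assms(2)] dirichlet_kernel_mass_le[OF assms(2)] in \<open>auto simp: sigma_finite_lborel indicator_def\<close>)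
  note I = this
  have e: "indicator {0..} z * (dirichlet_kernel t x z * dirichlet_semigroup d \<mu> s g z)
      = exp (- \<mu> * s) * (indicator {0..} z * (dirichlet_kernel t x z * (\<integral>y. indicator {0..} y * dirichlet_kernel s z y * g y \<partial>lborel)))" for z
    by (simp add: dirichlet_semigroup_eq mult.assoc)
  have "dirichlet_semigroup d \<mu> t (dirichlet_semigroup d \<mu> s g) x
      = exp (- \<mu> * t) * (exp (- \<mu> * s) * (\<integral>y. indicator {0..} y * dirichlet_kernel (t + s) x y * g y \<partial>lborel))"
    by (simp only: dirichlet_semigroup_eq[of t "dirichlet_semigroup d \<mu> s g"] e integral_mult_right_zero I)
  then show ?thesis
    by (simp add: dirichlet_semigroup_eq[of _ g] mult.assoc exp_add[symmetric] distrib_left)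
qed

text \<open>Running the process for a time \<open>t\<close> before measuring occupation
  means measuring the occupation after the time \<open>t\<close>: the discount factors
  multiply and the kernels compose by Chapman--Kolmogorov.\<close>
lemma dirichlet_semigroup_occ:
  assumes "0 < t" "0 \<le> x" and [measurable]: "h \<in> borel_measurable (borel \<Otimes>\<^sub>M borel)" and B: "\<And>p. \<bar>h p\<bar> \<le> B"
  shows "dirichlet_semigroup d \<mu> t (\<lambda>z. \<integral>p. half_occ d \<mu> z p * h p \<partial>plane) x
     = (\<integral>(s, y). indicator {0<..} s * half_occ d \<mu> x (s + t, y) * h (s, y) \<partial>plane)"
proof -
  have "(\<integral>z. indicator {0..} z * (dirichlet_kernel t x z * (\<integral>p. half_occ d \<mu> z p * h p \<partial>plane)) \<partial>lborel)
     = (\<integral>p. (exp (\<mu> * t) * (indicator {0<..} (fst p) * half_occ d \<mu> x (fst p + t, snd p))) * h p \<partial>plane)"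
  proof (rule dirichlet_kernel_fubini[OF sigma_finite_plane assms(1,2)])
    show "(\<lambda>(z, p). half_occ d \<mu> z p) \<in> borel_measurable (borel \<Otimes>\<^sub>M plane)"
    proof -
      have "(\<lambda>w. half_occ d \<mu> (fst w) (fst (snd w), snd (snd w))) \<in> borel_measurable (borel \<Otimes>\<^sub>M plane)" by measurable
      then show ?thesis by (simp add: case_prod_beta')
    qed
    show "(\<integral>z. indicator {0..} z * (dirichlet_kernel t x z * half_occ d \<mu> z p) \<partial>lborel) = exp (\<mu> * t) * (indicator {0<..} (fst p) * half_occ d \<mu> x (fst p + t, snd p))" for p
    proof (cases "0 < fst p")
      case True
      have "indicator {0..} z * (dirichlet_kernel t x z * half_occ d \<mu> z p) = (\<mu> * exp (- \<mu> * fst p) * indicator {0..} (snd p)) * (indicator {0..} z * (dirichlet_kernel t x z * dirichlet_kernel (fst p) z (snd p)))" for z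
        using half_occ_eq[of z "fst p" "snd p"] True by simp
      then have "(\<integral>z. indicator {0..} z * (dirichlet_kernel t x z * half_occ d \<mu> z p) \<partial>lborel) = (\<mu> * exp (- \<mu> * fst p) * indicator {0..} (snd p)) * dirichlet_kernel (t + fst p) x (snd p)"
        by (simp only: integral_mult_right_zero dirichlet_kernel_chapman_kolmogorov[OF assms(1) True])
      also have "\<dots> = exp (\<mu> * t) * (indicator {0<..} (fst p) * half_occ d \<mu> x (fst p + t, snd p))"
        using True assms(1) half_occ_eq[of x "fst p + t" "snd p"] by (simp add: distrib_left exp_add exp_diff exp_minus field_simps)
      finally show ?thesis .
    next
      case False
      then show ?thesis using half_occ_eq[of _ "fst p" "snd p"] by simp
    qed
    show "integrable plane (half_occ d \<mu> z)" if "0 \<le> z" for z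
      using half_occ_integrable[of "\<lambda>_. 1" 1 z] that by simp
  qed (use B half_occ_nonneg half_occ_mass_le in auto)
  then show ?thesis
    by (simp add: dirichlet_semigroup_eq case_prod_beta' exp_minus mult.assoc)
qed

lemma half_occ_shift:
  assumes "0 < t" and [measurable]: "h \<in> borel_measurable (borel \<Otimes>\<^sub>M borel)"
  shows "(\<integral>(s, y). indicator {0<..} s * half_occ d \<mu> x (s + t, y) * h (s, y) \<partial>plane)
    = (\<integral>(s, y). half_occ d \<mu> x (s, y) * (indicator {t<..} s * h (s - t, y)) \<partial>plane)"
proof -
  have "(\<integral>w. (case w of (s, y) \<Rightarrow> half_occ d \<mu> x (s, y) * (indicator {t<..} s * h (s - t, y))) \<partial>lborel)
    = (\<integral>w. (case (t, 0) + w of (s, y) \<Rightarrow> half_occ d \<mu> x (s, y) * (indicator {t<..} s * h (s - t, y))) \<partial>lborel)"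
  proof (subst lborel_distr_plus[symmetric, of "(t, 0)"], rule integral_distr)
    show "(+) (t, 0) \<in> lborel \<rightarrow>\<^sub>M (borel :: (real \<times> real) measure)"
      by (auto intro!: borel_measurable_continuous_onI continuous_intros)
    show "(\<lambda>(s, y). half_occ d \<mu> x (s, y) * (indicator {t<..} s * h (s - t, y))) \<in> borel_measurable borel"
      by (subst borel_prod[symmetric]) measurable
  qed
  also have "\<dots> = (\<integral>(s, y). indicator {0<..} s * half_occ d \<mu> x (s + t, y) * h (s, y) \<partial>lborel)"
    by (intro Bochner_Integration.integral_cong) (auto simp: indicator_def add.commute)
  finally show ?thesis by (simp add: lborel_prod)
qed

section \<open>Integration against the occupation density of the half-line\<close>

definition half_int :: "real \<Rightarrow> (real \<times> real \<Rightarrow> real) \<Rightarrow> real" where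
  "half_int x h = (\<integral>p. half_occ d \<mu> x p * h p \<partial>plane)"

lemma half_int_mono:
  assumes "0 \<le> x"
    and "h \<in> borel_measurable (borel \<Otimes>\<^sub>M borel)" "\<And>p. \<bar>h p\<bar> \<le> B"
    and "k \<in> borel_measurable (borel \<Otimes>\<^sub>M borel)" "\<And>p. \<bar>k p\<bar> \<le> C"
    and le: "\<And>s y. 0 < s \<Longrightarrow> 0 \<le> y \<Longrightarrow> h (s, y) \<le> k (s, y)"
  shows "half_int x h \<le> half_int x k"
  unfolding half_int_def
proof (rule integral_mono)
  show "half_occ d \<mu> x p * h p \<le> half_occ d \<mu> x p * k p" for p
  proof (cases p)
    case (Pair s y)
    show ?thesis
    proof (cases "0 < s \<and> 0 \<le> y")
      case True
      then show ?thesis using half_occ_nonneg[OF assms(1)] le by (auto simp: Pair intro!: mult_left_mono)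
    next
      case False
      then have "half_occ d \<mu> x p = 0" by (auto simp: Pair half_occ_eq)
      then show ?thesis by simp
    qed
  qed
qed (fact half_occ_integrable[OF assms(2,3,1)] half_occ_integrable[OF assms(4,5,1)])+

lemma half_int_cong:
  assumes "\<And>s y. 0 < s \<Longrightarrow> 0 \<le> y \<Longrightarrow> h (s, y) = k (s, y)"
  shows "half_int x h = half_int x k"
  unfolding half_int_def
proof (intro Bochner_Integration.integral_cong refl)
  fix p :: "real \<times> real"
  obtain s y where p: "p = (s, y)" by (cases p)
  show "half_occ d \<mu> x p * h p = half_occ d \<mu> x p * k p"
    using assms by (cases "0 < s \<and> 0 \<le> y") (auto simp: p half_occ_eq)
qed

lemma half_int_add:
  assumes "0 \<le> x"
    and "h \<in> borel_measurable (borel \<Otimes>\<^sub>M borel)" "\<And>p. \<bar>h p\<bar> \<le> B"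
    and "k \<in> borel_measurable (borel \<Otimes>\<^sub>M borel)" "\<And>p. \<bar>k p\<bar> \<le> C"
  shows "half_int x (\<lambda>p. h p + k p) = half_int x h + half_int x k"
  unfolding half_int_def distrib_left
  by (rule Bochner_Integration.integral_add[OF half_occ_integrable[OF assms(2,3,1)] half_occ_integrable[OF assms(4,5,1)]])

lemma half_int_const_le:
  assumes "0 \<le> x" "0 \<le> c"
  shows "half_int x (\<lambda>p. c) \<le> c"
  using mult_right_mono[OF half_occ_mass_le[OF assms(1)] assms(2)] by (simp add: half_int_def)

lemma half_int_nonneg:
  assumes "0 \<le> x" and "\<And>s y. 0 < s \<Longrightarrow> 0 \<le> y \<Longrightarrow> 0 \<le> h (s, y)"
  shows "0 \<le> half_int x h"
  unfolding half_int_def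
proof (rule integral_nonneg_AE, rule AE_I2)
  fix p :: "real \<times> real"
  obtain s y where p: "p = (s, y)" by (cases p)
  show "0 \<le> half_occ d \<mu> x p * h p"
  proof (cases "0 < s \<and> 0 \<le> y")
    case True
    then show ?thesis using half_occ_nonneg[OF assms(1)] assms(2)[of s y] by (simp add: p)
  next
    case False
    then have "half_occ d \<mu> x p = 0" by (auto simp: p half_occ_eq)
    then show ?thesis by simp
  qed
qed

lemma half_int_le_line:
  assumes x: "0 \<le> x" and m: "h \<in> borel_measurable (borel \<Otimes>\<^sub>M borel)" 
    and h: "\<And>p. 0 \<le> h p" "integrable plane (\<lambda>p. line_occ d \<mu> x p * h p)"
  shows "half_int x h \<le> (\<integral>p. line_occ d \<mu> x p * h p \<partial>plane)"
  unfolding half_int_def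
proof (rule integral_mono)
  show "half_occ d \<mu> x p * h p \<le> line_occ d \<mu> x p * h p" for p
    using half_occ_le_line_occ h by (intro mult_right_mono) auto
  show "integrable plane (\<lambda>p. half_occ d \<mu> x p * h p)"
  proof (rule Bochner_Integration.integrable_bound[OF h(2)])
    show "AE p in plane. norm (half_occ d \<mu> x p * h p) \<le> norm (line_occ d \<mu> x p * h p)"
      using half_occ_le_line_occ h(1) half_occ_nonneg[OF x] line_occ_nonneg
      by (auto simp: abs_mult intro!: mult_right_mono AE_I2)
  qed (use m in measurable)
qed (rule h)

text \<open>The mass of a time window is at most that of the exponential clock.\<close>
lemma half_int_window_le:
  assumes x: "0 \<le> x" and "0 \<le> K" "K \<le> t"
  shows "half_int x (\<lambda>(s, y). indicator {K..<t} s) \<le> exp (- \<mu> * K) - exp (- \<mu> * t)"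
proof -
  have "has_bochner_integral plane (\<lambda>p. (case p of (s, y) \<Rightarrow> line_occ d \<mu> x (s, y) * indicator {K..} s) - (case p of (s, y) \<Rightarrow> line_occ d \<mu> x (s, y) * indicator {t..} s)) (exp (- \<mu> * K) - exp (- \<mu> * t))"
    using assms by (intro has_bochner_integral_diff line_occ_tail) auto
  also have "(\<lambda>p. (case p of (s, y) \<Rightarrow> line_occ d \<mu> x (s, y) * indicator {K..} s) - (case p of (s, y) \<Rightarrow> line_occ d \<mu> x (s, y) * indicator {t..} s))
     = (\<lambda>p. line_occ d \<mu> x p * (\<lambda>(s, y). indicator {K..<t} s) p)"
    using assms by (auto simp: indicator_def fun_eq_iff)
  finally show ?thesis
    using half_int_le_line[OF x, of "\<lambda>(s, y). indicator {K..<t} s"] by (auto simp: has_bochner_integral_iff)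
qed

lemma half_int_green:
  assumes "g \<in> borel_measurable borel" "\<And>y. \<bar>g y\<bar> \<le> B" "0 \<le> x"
  shows "half_int x (\<lambda>(s, y). g y) = green g x"
  using half_occ_green[OF assms] by (simp add: half_int_def case_prod_beta')

lemma green_const_le: "0 \<le> c \<Longrightarrow> 0 \<le> x \<Longrightarrow> green (\<lambda>_. c) x \<le> c"
  using half_int_green[of "\<lambda>_. c" "\<bar>c\<bar>" x] half_int_const_le[of x c] by (simp add: case_prod_beta')

lemma dirichlet_semigroup_cong:
  assumes "\<And>y. 0 \<le> y \<Longrightarrow> g y = h y"
  shows "dirichlet_semigroup d \<mu> t g x = dirichlet_semigroup d \<mu> t h x"
proof -
  have "indicator {0..} y * (dirichlet_kernel t x y * g y) = indicator {0..} y * (dirichlet_kernel t x y * h y)" for y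
    using assms by (cases "0 \<le> y") auto
  then show ?thesis by (simp only: dirichlet_semigroup_eq)
qed

lemma dirichlet_semigroup_mono:
  assumes "0 < t" "0 \<le> x" and g: "g \<in> borel_measurable borel" "\<And>y. 0 \<le> y \<Longrightarrow> \<bar>g y\<bar> \<le> B"
    and h: "h \<in> borel_measurable borel" "\<And>y. 0 \<le> y \<Longrightarrow> \<bar>h y\<bar> \<le> C"
    and le: "\<And>y. 0 \<le> y \<Longrightarrow> g y \<le> h y"
  shows "dirichlet_semigroup d \<mu> t g x \<le> dirichlet_semigroup d \<mu> t h x"
  unfolding dirichlet_semigroup_eq
proof (rule mult_left_mono[OF integral_mono[OF dirichlet_kernel_integrable[OF assms(1,2) g] dirichlet_kernel_integrable[OF assms(1,2) h]]])
  show "indicator {0..} y * (dirichlet_kernel t x y * g y) \<le> indicator {0..} y * (dirichlet_kernel t x y * h y)" for y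
    using le[of y] dirichlet_kernel_nonneg[OF assms(1,2), of y] by (cases "0 \<le> y") (auto intro: mult_left_mono)
qed auto

lemma dirichlet_semigroup_add:
  assumes "0 < t" "0 \<le> x" and g: "g \<in> borel_measurable borel" "\<And>y. 0 \<le> y \<Longrightarrow> \<bar>g y\<bar> \<le> B"
    and h: "h \<in> borel_measurable borel" "\<And>y. 0 \<le> y \<Longrightarrow> \<bar>h y\<bar> \<le> C"
  shows "dirichlet_semigroup d \<mu> t (\<lambda>y. g y + h y) x = dirichlet_semigroup d \<mu> t g x + dirichlet_semigroup d \<mu> t h x"
  unfolding dirichlet_semigroup_eq distrib_left
  by (subst Bochner_Integration.integral_add[OF dirichlet_kernel_integrable[OF assms(1,2) g] dirichlet_kernel_integrable[OF assms(1,2) h]])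
     (auto simp: distrib_left)

lemma dirichlet_semigroup_nonneg:
  assumes "0 < t" "0 \<le> x" and "\<And>y. 0 \<le> y \<Longrightarrow> 0 \<le> g y"
  shows "0 \<le> dirichlet_semigroup d \<mu> t g x"
  unfolding dirichlet_semigroup_eq using assms dirichlet_kernel_nonneg[OF assms(1,2)]
  by (intro mult_nonneg_nonneg integral_nonneg_AE) (auto simp: indicator_def)

lemma dirichlet_semigroup_const_le:
  assumes "0 < t" "0 \<le> x" "0 \<le> c"
  shows "dirichlet_semigroup d \<mu> t (\<lambda>y. c) x \<le> exp (- \<mu> * t) * c"
proof -
  have "(\<integral>y. indicator {0..} y * (dirichlet_kernel t x y * c) \<partial>lborel) = (\<integral>y. indicator {0..} y * dirichlet_kernel t x y \<partial>lborel) * c"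
    by (simp flip: integral_mult_left_zero add: mult.assoc)
  also have "\<dots> \<le> 1 * c" by (intro mult_right_mono dirichlet_kernel_mass_le assms)
  finally show ?thesis by (simp add: dirichlet_semigroup_eq)
qed

end

section \<open>The reaction term\<close>

text \<open>The monostable nonlinearity: superlinear at \<open>0\<close>, nondecreasing,
  with one positive fixed point \<open>ustar\<close> that attracts from both sides.\<close>
locale kinetics = diffusion d \<mu> for d \<mu> :: real +
  fixes \<tau> ustar :: real and f f' :: "real \<Rightarrow> real"
  assumes tau_pos: "0 < \<tau>"
    and f_nonneg: "\<And>u. 0 \<le> u \<Longrightarrow> 0 \<le> f u"
    and f_deriv: "\<And>u. 0 \<le> u \<Longrightarrow> (f has_real_derivative f' u) (at u within {0..})"
    and f'_cont: "continuous_on {0..} f'"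
    and f'_0: "1 < f' 0"
    and f'_nonneg: "\<And>u. 0 < u \<Longrightarrow> 0 \<le> f' u"
    and f_less: "\<And>u. 0 < u \<Longrightarrow> f u < f' 0 * u"
    and ustar_pos: "0 < ustar" and f_ustar: "f ustar = ustar"
    and f_above: "\<And>u. 0 < u \<Longrightarrow> u < ustar \<Longrightarrow> u < f u"
    and f_below: "\<And>u. ustar < u \<Longrightarrow> f u < u"
begin

lemma f_cont: "continuous_on {0..} f"
  using f_deriv by (auto simp: continuous_on_eq_continuous_within intro!: DERIV_continuous)

lemma f_zero: "f 0 = 0"
proof -
  have "(f \<longlongrightarrow> f 0) (at_right 0)"
    using f_cont by (auto simp: continuous_on_def intro: tendsto_within_subset)
  moreover have "((\<lambda>u. f' 0 * u) \<longlongrightarrow> f' 0 * 0) (at_right 0)" by (intro tendsto_intros)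
  moreover have "\<forall>\<^sub>F u in at_right 0. f u \<le> f' 0 * u"
    using f_less by (auto simp: eventually_at_filter intro!: always_eventually less_imp_le)
  ultimately have "f 0 \<le> f' 0 * 0" by (intro tendsto_le[of "at_right 0"]) auto
  with f_nonneg[of 0] show ?thesis by simp
qed

lemma f_mono: "0 \<le> u \<Longrightarrow> u \<le> v \<Longrightarrow> f u \<le> f v"
proof (cases "u = 0")
  case False
  assume "0 \<le> u" "u \<le> v"
  with False have "0 < u" by simp
  show ?thesis
  proof (rule DERIV_nonneg_imp_nondecreasing[OF \<open>u \<le> v\<close>])
    fix x assume "u \<le> x" "x \<le> v"
    with \<open>0 < u\<close> have "0 < x" by simp
    then have "(f has_real_derivative f' x) (at x)"
      using f_deriv[of x] at_within_interior[of x "{0..}"] by simp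
    then show "\<exists>y. (f has_real_derivative y) (at x) \<and> 0 \<le> y" using f'_nonneg[OF \<open>0 < x\<close>] by blast
  qed
qed (auto simp: f_zero f_nonneg)

lemma f_lipschitz: obtains L where "0 < L" "\<And>u v. 0 \<le> u \<Longrightarrow> u \<le> v \<Longrightarrow> v \<le> M \<Longrightarrow> f v - f u \<le> L * (v - u)"
proof -
  have "bounded (f' ` {0..M})"
    by (intro compact_imp_bounded compact_continuous_image continuous_on_subset[OF f'_cont]) auto
  then obtain L where L: "0 < L" "\<forall>x\<in>{0..M}. \<bar>f' x\<bar> \<le> L"
    by (auto simp: bounded_pos)
  show thesis
  proof
    fix u v :: real assume uv: "0 \<le> u" "u \<le> v" "v \<le> M"
    have "norm (f v - f u) \<le> L * norm (v - u)"
    proof (rule field_differentiable_bound[of "{0..M}"])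
      show "(f has_field_derivative f' z) (at z within {0..M})" if "z \<in> {0..M}" for z
        using f_deriv[of z] that by (auto intro: DERIV_subset)
    qed (use uv L in auto)
    then show "f v - f u \<le> L * (v - u)" using uv by simp
  qed (rule L)
qed

text \<open>Any number between \<open>1\<close> and \<open>f' 0\<close> is a lower bound for
  \<open>f u / u\<close> near \<open>0\<close>; the midpoint is taken.\<close>
lemma f_slope: obtains r \<kappa> where "1 < r" "0 < \<kappa>" "\<kappa> < ustar" "\<And>u. 0 \<le> u \<Longrightarrow> u \<le> \<kappa> \<Longrightarrow> r * u \<le> f u"
proof -
  define r where "r = (1 + f' 0) / 2"
  have r: "1 < r" "r < f' 0" using f'_0 by (auto simp: r_def)
  have "((\<lambda>y. (f y - f 0) / (y - 0)) \<longlongrightarrow> f' 0) (at 0 within {0..})"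
    using f_deriv[of 0] by (simp add: has_field_derivative_iff)
  then have "\<forall>\<^sub>F y in at 0 within {0..}. r < (f y - f 0) / (y - 0)"
    using r(2) by (rule order_tendstoD)
  then obtain e where e: "0 < e" "\<And>y. 0 \<le> y \<Longrightarrow> y \<noteq> 0 \<Longrightarrow> dist y 0 < e \<Longrightarrow> r < f y / y"
    by (auto simp: eventually_at f_zero)
  show thesis
  proof
    show "1 < r" by (rule r)
    show "0 < min (e / 2) (ustar / 2)" "min (e / 2) (ustar / 2) < ustar" using e ustar_pos by auto
    fix u assume u: "0 \<le> u" "u \<le> min (e / 2) (ustar / 2)"
    show "r * u \<le> f u"
    proof (cases "u = 0")
      case False
      then have "r < f u / u" using u e(1) by (intro e(2)) auto
      then show ?thesis using False u by (simp add: field_simps)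
    qed (simp add: f_zero)
  qed
qed

lemma f_pos: assumes "0 < u" shows "0 < f u"
proof -
  have "0 < min u (ustar / 2)" "min u (ustar / 2) < ustar" using assms ustar_pos by auto
  then have "0 < f (min u (ustar / 2))" using f_above[of "min u (ustar / 2)"] by linarith
  also have "\<dots> \<le> f u" using assms ustar_pos by (intro f_mono) auto
  finally show ?thesis .
qed

lemma f_le_self: "ustar \<le> M \<Longrightarrow> f M \<le> M"
  using f_below[of M] f_ustar by (cases "M = ustar") auto

lemma f_comp_continuous:
  assumes "continuous_on UNIV g" "\<And>x. 0 \<le> g x"
  shows "continuous_on UNIV (\<lambda>x. f (g x))"
  using assms by (intro continuous_on_compose2[OF f_cont]) auto

lemma f_comp_measurable:
  assumes "g \<in> borel_measurable N" "\<And>x. 0 \<le> g x"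
  shows "(\<lambda>x. f (g x)) \<in> borel_measurable N"
proof -
  have "continuous_on UNIV (\<lambda>v. f (max 0 v))" by (intro f_comp_continuous continuous_intros) auto
  then have "(\<lambda>v. f (max 0 v)) \<in> borel_measurable borel" by (rule borel_measurable_continuous_onI)
  from measurable_compose[OF assms(1) this] show ?thesis using assms(2) by (simp add: max_def)
qed

end

section \<open>Solutions on the half-line\<close>

locale half_line_solution = kinetics d \<mu> \<tau> ustar f f' for d \<mu> \<tau> ustar :: real and f f' :: "real \<Rightarrow> real" +
  fixes \<phi> u :: "real \<Rightarrow> real \<Rightarrow> real"
  assumes \<phi>: "\<phi> \<in> C_plus \<tau>" and sol: "dirichlet_solution d \<mu> \<tau> f \<phi> u"
begin

lemma u_cont: "continuous_on ({-\<tau>..} \<times> {0..}) (\<lambda>(t, x). u t x)"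
  and u_nonneg: "\<And>t x. -\<tau> \<le> t \<Longrightarrow> 0 \<le> x \<Longrightarrow> 0 \<le> u t x"
  and u_init: "\<And>t x. -\<tau> \<le> t \<Longrightarrow> t \<le> 0 \<Longrightarrow> 0 \<le> x \<Longrightarrow> u t x = \<phi> t x"
  using sol by (auto simp: dirichlet_solution_def mild_solution_def)

lemma u_bounded: obtains M where "0 < M" "\<And>t x. -\<tau> \<le> t \<Longrightarrow> t \<le> T \<Longrightarrow> 0 \<le> x \<Longrightarrow> u t x \<le> M"
proof -
  have "bounded ((\<lambda>(t, x). u t x) ` ({-\<tau>..T} \<times> {0..}))"
    using sol by (auto simp: dirichlet_solution_def mild_solution_def)
  then obtain M where "0 < M" "\<forall>z\<in>{-\<tau>..T} \<times> {0..}. norm ((\<lambda>(t, x). u t x) z) \<le> M"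
    by (auto simp: bounded_pos)
  then have "u t x \<le> M" if "-\<tau> \<le> t" "t \<le> T" "0 \<le> x" for t x
    using bspec[of "{-\<tau>..T} \<times> {0..}" _ "(t, x)"] that by force
  with \<open>0 < M\<close> show thesis by (rule that)
qed

text \<open>The arguments are clamped to the domain of the solution, which makes this
  function continuous on the whole plane and hence Borel measurable. On the domain it is
  \<open>f \<circ> u\<close>.\<close>
definition reaction :: "real \<Rightarrow> real \<Rightarrow> real" where
  "reaction r y = f (u (max (-\<tau>) r) (max 0 y))"

text \<open>The delayed reaction felt at time \<open>t\<close>, as a function of its age
  \<open>s\<close> and its place, cut off at age \<open>K\<close>.\<close>
abbreviation recent :: "real \<Rightarrow> real \<Rightarrow> real \<times> real \<Rightarrow> real" where
  "recent K t \<equiv> (\<lambda>(s, y). indicator {0<..<K} s * reaction (t - s - \<tau>) y)"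

lemma u_clamped_cont: "continuous_on UNIV (\<lambda>p. u (max (-\<tau>) (fst p)) (max 0 (snd p)))"
  using continuous_on_compose2[OF u_cont, of UNIV "\<lambda>p. (max (-\<tau>) (fst p), max 0 (snd p))"]
  by (force intro!: continuous_intros)

lemma reaction_cont: "continuous_on UNIV (\<lambda>p. reaction (fst p) (snd p))"
  unfolding reaction_def by (intro f_comp_continuous u_clamped_cont u_nonneg) auto

lemma reaction_measurable' [measurable (raw)]:
  assumes "R \<in> borel_measurable N" "Y \<in> borel_measurable N"
  shows "(\<lambda>w. reaction (R w) (Y w)) \<in> borel_measurable N"
proof -
  have "(\<lambda>p. reaction (fst p) (snd p)) \<in> borel_measurable (borel \<Otimes>\<^sub>M borel)"
    using borel_measurable_continuous_onI[OF reaction_cont] by (simp add: borel_prod)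
  from measurable_compose[OF measurable_Pair[OF assms] this] show ?thesis by simp
qed

lemma u_slice_measurable: 
  assumes "-\<tau> \<le> t" shows "(\<lambda>y. u t (max 0 y)) \<in> borel_measurable borel"
proof -
  have "continuous_on UNIV (\<lambda>y. (\<lambda>p. u (max (-\<tau>) (fst p)) (max 0 (snd p))) (t, y))"
    by (rule continuous_on_compose2[OF u_clamped_cont]) (auto intro!: continuous_intros)
  then show ?thesis using assms by (auto simp: max_absorb2 intro: borel_measurable_continuous_onI)
qed

lemma reaction_nonneg: "0 \<le> reaction r y"
  unfolding reaction_def by (intro f_nonneg u_nonneg) auto

lemma reaction_eq: "-\<tau> \<le> r \<Longrightarrow> 0 \<le> y \<Longrightarrow> reaction r y = f (u r y)"
  by (simp add: reaction_def)

lemma reaction_bounded: obtains B where "0 \<le> B" "\<And>r y. r \<le> T \<Longrightarrow> \<bar>reaction r y\<bar> \<le> B"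
proof -
  obtain M where M: "0 < M" "\<And>t x. -\<tau> \<le> t \<Longrightarrow> t \<le> max T (-\<tau>) \<Longrightarrow> 0 \<le> x \<Longrightarrow> u t x \<le> M" using u_bounded[of "max T (-\<tau>)"] by blast
  show thesis
  proof
    show "0 \<le> f M" using M by (intro f_nonneg) auto
    show "\<bar>reaction r y\<bar> \<le> f M" if "r \<le> T" for r y
      using reaction_nonneg[of r y] that unfolding reaction_def by (auto intro!: f_mono u_nonneg M)
  qed
qed

lemma window_bounded: 
  "\<exists>B\<ge>0. \<forall>A p. A \<subseteq> {0<..} \<longrightarrow> \<bar>(\<lambda>(s, y). indicator A s * reaction (t - s - \<tau>) y) p\<bar> \<le> B"
proof -
  obtain B where B: "0 \<le> B" "\<And>r y. r \<le> t \<Longrightarrow> \<bar>reaction r y\<bar> \<le> B" using reaction_bounded[of t] by blast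
  show ?thesis
  proof (intro exI[of _ B] conjI allI impI)
    fix A :: "real set" and p :: "real \<times> real" assume A: "A \<subseteq> {0<..}"
    obtain s y where p: "p = (s, y)" by (cases p)
    show "\<bar>(\<lambda>(s, y). indicator A s * reaction (t - s - \<tau>) y) p\<bar> \<le> B"
    proof (cases "s \<in> A")
      case True
      then have "0 < s" using A by auto
      then show ?thesis using True B(2)[of "t - s - \<tau>" y] tau_pos by (simp add: p)
    qed (simp add: p B)
  qed (rule B)
qed

lemma u_eq:
  assumes "0 < t" "0 \<le> x"
  shows "u t x = dirichlet_semigroup d \<mu> t (u 0) x
    + half_int x (recent t t)"
proof -
  have "u t x = dirichlet_semigroup d \<mu> t (u 0) x + (LBINT s:{0<..<t}. dirichlet_semigroup d \<mu> (t - s) (\<lambda>y. \<mu> * f (u (s - \<tau>) y)) x)"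
    using sol assms by (auto simp: dirichlet_solution_def mild_solution_def)
  also have "(LBINT s:{0<..<t}. dirichlet_semigroup d \<mu> (t - s) (\<lambda>y. \<mu> * f (u (s - \<tau>) y)) x)
     = (LBINT s:{0<..<t}. dirichlet_semigroup d \<mu> (t - s) (\<lambda>y. \<mu> * reaction (s - \<tau>) y) x)"
  proof (rule set_lebesgue_integral_cong)
    have "dirichlet_semigroup d \<mu> (t - s) (\<lambda>y. \<mu> * f (u (s - \<tau>) y)) x = dirichlet_semigroup d \<mu> (t - s) (\<lambda>y. \<mu> * reaction (s - \<tau>) y) x"
      if "s \<in> {0<..<t}" for s
      by (rule dirichlet_semigroup_cong) (use that in \<open>simp add: reaction_eq\<close>)
    then show "\<forall>s. s \<in> {0<..<t} \<longrightarrow> dirichlet_semigroup d \<mu> (t - s) (\<lambda>y. \<mu> * f (u (s - \<tau>) y)) x = dirichlet_semigroup d \<mu> (t - s) (\<lambda>y. \<mu> * reaction (s - \<tau>) y) x"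
      by blast
  qed simp
  also have "\<dots> = half_int x (recent t t)"
  proof -
    obtain B where B: "\<And>r y. r \<le> t - \<tau> \<Longrightarrow> \<bar>reaction r y\<bar> \<le> B" using reaction_bounded[of "t - \<tau>"] by metis
    have "(\<lambda>(r, y). reaction r y) \<in> borel_measurable (borel \<Otimes>\<^sub>M borel)" by measurable
    from half_duhamel[OF assms this B] show ?thesis by (simp add: half_int_def case_prod_beta')
  qed
  finally show ?thesis .
qed

text \<open>A solution can be restarted at a time \<open>t0\<close>: by Chapman--Kolmogorov
  the contributions to \<open>u t0\<close>, propagated over a time \<open>t\<close>, are the
  contributions to \<open>u (t0 + t)\<close> of age more than \<open>t\<close>. In
  comparison arguments the inequality suffices, so that the age \<open>t\<close> itself, a
  null set, can be dropped.\<close>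
lemma u_restart:
  assumes "0 \<le> t0" "0 < t" "0 \<le> x"
  shows "dirichlet_semigroup d \<mu> t (u t0) x + half_int x (recent t (t0 + t)) \<le> u (t0 + t) x"
proof (cases "t0 = 0")
  case True
  then show ?thesis using u_eq[OF assms(2,3)] by simp
next
  case False
  then have t0: "0 < t0" using assms by simp
  let ?g = "\<lambda>y. u 0 (max 0 y)"
  let ?h = "\<lambda>(s, y). indicator {0<..<t0} s * reaction (t0 - s - \<tau>) y"
  have [measurable]: "?g \<in> borel_measurable borel" by (rule u_slice_measurable) (use tau_pos in simp)
  obtain M where M: "0 < M" "\<And>t x. -\<tau> \<le> t \<Longrightarrow> t \<le> 0 \<Longrightarrow> 0 \<le> x \<Longrightarrow> u t x \<le> M" using u_bounded[of 0] by blast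
  have gM: "\<bar>?g y\<bar> \<le> M" for y using M u_nonneg tau_pos by auto
  have gM': "\<bar>u 0 y\<bar> \<le> M" "u 0 y \<le> M" if "0 \<le> y" for y using M u_nonneg tau_pos that by auto
  obtain B where W: "0 \<le> B" "\<forall>A p. A \<subseteq> {0<..} \<longrightarrow> \<bar>(\<lambda>(s, y). indicator A s * reaction (t0 - s - \<tau>) y) p\<bar> \<le> B"
    using window_bounded[of t0] by (elim exE conjE)
  have B: "\<bar>?h p\<bar> \<le> B" for p by (rule W(2)[rule_format]) auto
  have B0: "0 \<le> B" using B[of "(0,0)"] by simp
  have h_nonneg: "0 \<le> ?h p" for p by (auto simp: reaction_nonneg split: prod.splits)
  have S: "0 \<le> dirichlet_semigroup d \<mu> t0 ?g z" "dirichlet_semigroup d \<mu> t0 ?g z \<le> M" if "0 \<le> z" for z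
  proof -
    show "0 \<le> dirichlet_semigroup d \<mu> t0 ?g z"
      using t0 that u_nonneg tau_pos by (intro dirichlet_semigroup_nonneg) auto
    have "dirichlet_semigroup d \<mu> t0 ?g z \<le> dirichlet_semigroup d \<mu> t0 (\<lambda>_. M) z"
      using t0 that gM' M(1) by (intro dirichlet_semigroup_mono[where B=M and C=M]) auto
    also have "\<dots> \<le> exp (- \<mu> * t0) * M" using t0 that M(1) by (intro dirichlet_semigroup_const_le) auto
    also have "\<dots> \<le> 1 * M" using t0 mu_pos M(1) by (intro mult_right_mono) auto
    finally show "dirichlet_semigroup d \<mu> t0 ?g z \<le> M" by simp
  qed
  have H: "0 \<le> half_int z ?h" "half_int z ?h \<le> B" if "0 \<le> z" for z
  proof -
    show "0 \<le> half_int z ?h" using that h_nonneg by (intro half_int_nonneg) auto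
    have "half_int z ?h \<le> half_int z (\<lambda>_. B)"
      using that B B0 order_trans[OF abs_ge_self B] by (intro half_int_mono[where B=B and C=B]) auto
    also have "\<dots> \<le> B" using that B0 by (intro half_int_const_le)
    finally show "half_int z ?h \<le> B" .
  qed
  have m1: "(\<lambda>z. dirichlet_semigroup d \<mu> t0 ?g z) \<in> borel_measurable borel"
    unfolding dirichlet_semigroup_eq by measurable
  have m2: "(\<lambda>z. half_int z ?h) \<in> borel_measurable borel"
    unfolding half_int_def
  proof (rule sigma_finite_measure.borel_measurable_lebesgue_integral[OF sigma_finite_plane])
    have "(\<lambda>w. half_occ d \<mu> (fst w) (fst (snd w), snd (snd w)) * (indicator {0<..<t0} (fst (snd w)) * reaction (t0 - fst (snd w) - \<tau>) (snd (snd w)))) \<in> borel_measurable (borel \<Otimes>\<^sub>M plane)"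
      by measurable
    then show "(\<lambda>(z, p). half_occ d \<mu> z p * ?h p) \<in> borel_measurable (borel \<Otimes>\<^sub>M plane)"
      by (simp add: case_prod_beta')
  qed
  have "dirichlet_semigroup d \<mu> t (u t0) x = dirichlet_semigroup d \<mu> t (\<lambda>z. dirichlet_semigroup d \<mu> t0 ?g z + half_int z ?h) x"
  proof (rule dirichlet_semigroup_cong)
    fix y :: real assume "0 \<le> y"
    then show "u t0 y = dirichlet_semigroup d \<mu> t0 ?g y + half_int y ?h"
      using u_eq[OF t0 \<open>0 \<le> y\<close>] dirichlet_semigroup_cong[of "u 0" ?g t0 y] by simp
  qed
  also have "\<dots> = dirichlet_semigroup d \<mu> t (dirichlet_semigroup d \<mu> t0 ?g) x + dirichlet_semigroup d \<mu> t (\<lambda>z. half_int z ?h) x"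
    using S H by (intro dirichlet_semigroup_add[where B=M and C=B] assms m1 m2) auto
  also have "dirichlet_semigroup d \<mu> t (dirichlet_semigroup d \<mu> t0 ?g) x = dirichlet_semigroup d \<mu> (t0 + t) (u 0) x"
    using dirichlet_semigroup_semigroup[OF assms(2) t0 assms(3), of ?g M] gM
      dirichlet_semigroup_cong[of "u 0" ?g "t0 + t" x] by (simp add: add.commute)
  also have "dirichlet_semigroup d \<mu> t (\<lambda>z. half_int z ?h) x = half_int x (\<lambda>(s, y). indicator {t<..} s * ?h (s - t, y))"
  proof -
    have hm: "?h \<in> borel_measurable (borel \<Otimes>\<^sub>M borel)" by measurable
    show ?thesis
      using dirichlet_semigroup_occ[OF assms(2,3) hm B] half_occ_shift[OF assms(2) hm, of x]
      by (simp add: half_int_def case_prod_beta')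
  qed
  also have "\<dots> = half_int x (\<lambda>(s, y). indicator {t<..<t0 + t} s * reaction (t0 + t - s - \<tau>) y)"
    by (intro half_int_cong) (auto simp: indicator_def algebra_simps)
  finally have "dirichlet_semigroup d \<mu> t (u t0) x = dirichlet_semigroup d \<mu> (t0 + t) (u 0) x
      + half_int x (\<lambda>(s, y). indicator {t<..<t0 + t} s * reaction (t0 + t - s - \<tau>) y)" .
  moreover have "half_int x (\<lambda>(s, y). indicator {t<..<t0 + t} s * reaction (t0 + t - s - \<tau>) y)
      + half_int x (recent t (t0 + t))
      \<le> half_int x (recent (t0 + t) (t0 + t))"
  proof -
    obtain B' where W: "0 \<le> B'" "\<forall>A p. A \<subseteq> {0<..} \<longrightarrow> \<bar>(\<lambda>(s, y). indicator A s * reaction (t0 + t - s - \<tau>) y) p\<bar> \<le> B'"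
      using window_bounded[of "t0 + t"] by (elim exE conjE)
    have B1: "\<bar>(\<lambda>(s, y). indicator {t<..<t0 + t} s * reaction (t0 + t - s - \<tau>) y) p\<bar> \<le> B'"
      and B2: "\<bar>(recent t (t0 + t)) p\<bar> \<le> B'"
      and B3: "\<bar>(recent (t0 + t) (t0 + t)) p\<bar> \<le> B'" for p
      using assms by (intro W(2)[rule_format]; force)+
    have "half_int x (\<lambda>p. (\<lambda>(s, y). indicator {t<..<t0 + t} s * reaction (t0 + t - s - \<tau>) y) p
        + (recent t (t0 + t)) p)
      \<le> half_int x (recent (t0 + t) (t0 + t))"
    proof (rule half_int_mono[OF assms(3), where B="B' + B'" and C=B'])
      show "\<bar>(\<lambda>(s, y). indicator {t<..<t0 + t} s * reaction (t0 + t - s - \<tau>) y) p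
        + (recent t (t0 + t)) p\<bar> \<le> B' + B'" for p
        using abs_triangle_ineq add_mono[OF B1[of p] B2[of p]] by (rule order_trans)
    qed (use B3 assms t0 reaction_nonneg in \<open>auto simp: indicator_def\<close>)
    then show ?thesis
      by (subst (asm) half_int_add[OF assms(3) _ B1 _ B2]) auto
  qed
  ultimately show ?thesis
    using u_eq[of "t0 + t" x] t0 assms by simp
qed

end

section \<open>Bounded integrands, tails and positivity\<close>

context diffusion
begin

text \<open>The integrands for which all manipulations of \<open>half_int\<close> are
  legitimate, the occupation density being a finite measure.\<close>
definition bounded_measurable :: "(real \<times> real \<Rightarrow> real) \<Rightarrow> bool" where
  "bounded_measurable h \<longleftrightarrow> h \<in> borel_measurable (borel \<Otimes>\<^sub>M borel) \<and> (\<exists>B. \<forall>p. \<bar>h p\<bar> \<le> B)"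

lemma bounded_measurableI: "h \<in> borel_measurable (borel \<Otimes>\<^sub>M borel) \<Longrightarrow> (\<And>s y. \<bar>h (s, y)\<bar> \<le> B) \<Longrightarrow> bounded_measurable h"
  by (auto simp: bounded_measurable_def)

lemma bounded_measurableD: "bounded_measurable h \<Longrightarrow> h \<in> borel_measurable (borel \<Otimes>\<^sub>M borel)"
  by (simp add: bounded_measurable_def)

lemma bounded_measurable_add: 
  assumes "bounded_measurable h" "bounded_measurable k" shows "bounded_measurable (\<lambda>p. h p + k p)"
proof -
  obtain B C where "\<And>p. \<bar>h p\<bar> \<le> B" "\<And>p. \<bar>k p\<bar> \<le> C" using assms by (auto simp: bounded_measurable_def)
  then have "\<bar>h p + k p\<bar> \<le> B + C" for p
    using order_trans[OF abs_triangle_ineq add_mono] by blast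
  then show ?thesis using assms[THEN bounded_measurableD] by (intro bounded_measurableI) auto
qed

lemma bounded_measurable_cmult: 
  assumes "bounded_measurable h" shows "bounded_measurable (\<lambda>p. c * h p)"
proof -
  obtain B where "\<And>p. \<bar>h p\<bar> \<le> B" using assms by (auto simp: bounded_measurable_def)
  then have "\<bar>c * h p\<bar> \<le> \<bar>c\<bar> * B" for p by (simp add: abs_mult mult_left_mono)
  then show ?thesis using assms[THEN bounded_measurableD] by (intro bounded_measurableI) auto
qed

lemma bounded_measurable_const: "bounded_measurable (\<lambda>p. c)"
  by (rule bounded_measurableI[of _ "\<bar>c\<bar>"]) auto

lemma bounded_measurable_space: "g \<in> borel_measurable borel \<Longrightarrow> (\<And>y. \<bar>g y\<bar> \<le> B) \<Longrightarrow> bounded_measurable (\<lambda>(s, y). g y)"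
  by (intro bounded_measurableI) auto

lemma half_integrable: "bounded_measurable h \<Longrightarrow> 0 \<le> x \<Longrightarrow> integrable plane (\<lambda>p. half_occ d \<mu> x p * h p)"
  unfolding bounded_measurable_def by (auto intro: half_occ_integrable simp del: split_paired_All)

lemma half_mono:
  assumes "0 \<le> x" "bounded_measurable h" "bounded_measurable k" "\<And>s y. 0 < s \<Longrightarrow> 0 \<le> y \<Longrightarrow> h (s, y) \<le> k (s, y)"
  shows "half_int x h \<le> half_int x k"
proof -
  obtain B C where "\<And>p. \<bar>h p\<bar> \<le> B" "\<And>p. \<bar>k p\<bar> \<le> C" using assms by (auto simp: bounded_measurable_def)
  then show ?thesis using half_int_mono[OF assms(1) bounded_measurableD[OF assms(2)] _ bounded_measurableD[OF assms(3)] _ assms(4), of B C] by blast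
qed

lemma half_add: 
  assumes "0 \<le> x" "bounded_measurable h" "bounded_measurable k" 
  shows "half_int x (\<lambda>p. h p + k p) = half_int x h + half_int x k"
  unfolding half_int_def distrib_left
  by (rule Bochner_Integration.integral_add[OF half_integrable half_integrable]) (use assms in auto)

lemma half_cmult: "half_int x (\<lambda>p. c * h p) = c * half_int x h"
  unfolding half_int_def by (simp add: mult.left_commute)

lemma half_int_tail:
  assumes x: "0 \<le> x" and "0 \<le> K"
  shows "half_int x (\<lambda>(s, y). indicator {K..} s) \<le> exp (- \<mu> * K)"
proof -
  have "has_bochner_integral plane (\<lambda>p. line_occ d \<mu> x p * (\<lambda>(s, y). indicator {K..} s) p) (exp (- \<mu> * K))"
    using line_occ_tail[OF assms(2), of x] by (simp add: case_prod_beta')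
  then show ?thesis
    using half_int_le_line[OF x, of "\<lambda>(s, y). indicator {K..} s"] by (auto simp: has_bochner_integral_iff)
qed

text \<open>Chernoff's bound: on the far region the weight \<open>exp (y - x)\<close> is at
  least \<open>exp A\<close>.\<close>
lemma half_int_far:
  assumes x: "0 \<le> x" and "0 \<le> K"
  shows "half_int x (\<lambda>(s, y). indicator {0<..<K} s * indicator {x + A..} y) \<le> exp (d * K - A)"
proof -
  let ?far = "\<lambda>p. indicator {0<..<K} (fst p) * indicator {x + A..} (snd p) :: real"
  let ?e = "\<lambda>p. exp (- A) * (line_occ d \<mu> x p * (indicator {..<K} (fst p) * exp (- 1 * (x - snd p))))"
  have e: "integrable plane ?e" "integral\<^sup>L plane ?e \<le> exp (- A) * exp (d * K)"
    using line_occ_exp_moment[OF assms(2), of "- 1" x] by (auto simp: case_prod_beta' intro!: mult_left_mono)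
  have le: "line_occ d \<mu> x p * ?far p \<le> ?e p" for p
  proof -
    have "?far p \<le> exp (- A) * (indicator {..<K} (fst p) * exp (- 1 * (x - snd p)))"
      by (auto simp: indicator_def exp_add[symmetric])
    from mult_left_mono[OF this line_occ_nonneg[of x p]] show ?thesis by (simp add: mult.left_commute)
  qed
  have i: "integrable plane (\<lambda>p. line_occ d \<mu> x p * ?far p)"
    by (rule line_occ_integrable[of _ 1]) (auto simp: indicator_def)
  have "half_int x ?far \<le> (\<integral>p. line_occ d \<mu> x p * ?far p \<partial>plane)"
    by (rule half_int_le_line[OF x _ _ i]) auto
  also have "\<dots> \<le> integral\<^sup>L plane ?e" by (rule integral_mono[OF i e(1) le])
  also note e(2)
  finally show ?thesis by (simp add: case_prod_beta' exp_diff exp_minus divide_inverse mult.commute)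
qed

text \<open>The strict form of the reflection principle, for starting points and targets
  inside the half-line.\<close>
lemma half_occ_pos:
  assumes "0 < x" "0 < s" "0 < y" shows "0 < half_occ d \<mu> x (s, y)"
proof -
  have "\<bar>x - y\<bar> < \<bar>x + y\<bar>" using assms by auto
  then have "(x - y)\<^sup>2 < (x + y)\<^sup>2" by (meson abs_le_square_iff not_le)
  then have "heat_kernel d s (x + y) < heat_kernel d s (x - y)"
    using assms d_pos unfolding heat_kernel_def by (intro divide_strict_right_mono) (auto intro!: divide_strict_right_mono)
  then show ?thesis using assms mu_pos by (simp add: half_occ_eq)
qed

text \<open>The density being positive, an integral can only vanish if the integrand
  vanishes almost everywhere, which a box of positive measure excludes.\<close>
lemma half_int_pos:
  assumes x: "0 < x" and h: "bounded_measurable h" "\<And>s y. 0 < s \<Longrightarrow> 0 \<le> y \<Longrightarrow> 0 \<le> h (s, y)"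
    and box: "0 \<le> s1" "s1 < s2" "0 \<le> y1" "y1 < y2"
    and pos: "\<And>s y. s1 < s \<Longrightarrow> s < s2 \<Longrightarrow> y1 < y \<Longrightarrow> y < y2 \<Longrightarrow> 0 < h (s, y)"
  shows "0 < half_int x h"
proof (rule ccontr)
  assume "\<not> 0 < half_int x h"
  moreover have "0 \<le> half_int x h" using x h by (intro half_int_nonneg) auto
  ultimately have 0: "(\<integral>p. half_occ d \<mu> x p * h p \<partial>plane) = 0" by (simp add: half_int_def)
  have nn: "0 \<le> half_occ d \<mu> x p * h p" for p
  proof (cases "0 < fst p \<and> 0 \<le> snd p")
    case True
    then show ?thesis using half_occ_nonneg[of x p] x h(2)[of "fst p" "snd p"] by simp
  next
    case False
    then have "half_occ d \<mu> x p = 0" using half_occ_eq[of x "fst p" "snd p"] by auto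
    then show ?thesis by simp
  qed
  have "integrable plane (\<lambda>p. half_occ d \<mu> x p * h p)" using half_integrable[OF h(1)] x by simp
  from integral_nonneg_eq_0_iff_AE[OF this] 0 nn have "AE p in plane. half_occ d \<mu> x p * h p = 0" by simp
  then have "AE p in plane. p \<notin> {s1<..<s2} \<times> {y1<..<y2}"
  proof eventually_elim
    case (elim p)
    show ?case
    proof
      assume "p \<in> {s1<..<s2} \<times> {y1<..<y2}"
      then obtain s y where p: "p = (s, y)" "s1 < s" "s < s2" "y1 < y" "y < y2" by auto
      then have "0 < half_occ d \<mu> x p * h p"
        using pos half_occ_pos[OF x] box by (intro mult_pos_pos) auto
      with elim show False by linarith
    qed
  qed
  then have "emeasure plane ({s1<..<s2} \<times> {y1<..<y2}) = 0"
    by (subst (asm) AE_iff_measurable[OF _ refl]) (auto simp: space_pair_measure)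
  moreover have "emeasure plane ({s1<..<s2} \<times> {y1<..<y2}) = emeasure lborel {s1<..<s2} * emeasure lborel {y1<..<y2}"
    by (rule lborel.emeasure_pair_measure_Times) auto
  ultimately show False using box by simp
qed

end

section \<open>A uniform bound for solutions\<close>

context half_line_solution
begin

lemma bounded_measurable_reaction_window: "bounded_measurable (recent K t)"
proof -
  have "\<exists>B\<ge>0. \<forall>A p. A \<subseteq> {0<..} \<longrightarrow> \<bar>(\<lambda>(s, y). indicator A s * reaction (t - s - \<tau>) y) p\<bar> \<le> B"
    by (rule window_bounded)
  then obtain B where "\<forall>A p. A \<subseteq> {0<..} \<longrightarrow> \<bar>(\<lambda>(s, y). indicator A s * reaction (t - s - \<tau>) y) p\<bar> \<le> B"
    by (elim exE conjE)
  then have "\<bar>(recent K t) p\<bar> \<le> B" for p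
    by (auto simp: subset_iff simp del: split_paired_All)
  then show ?thesis by (simp only: bounded_measurable_def) (intro conjI exI[of _ B] allI; measurable)
qed

text \<open>Any \<open>M \<ge> ustar\<close> above the initial history is a supersolution
  because \<open>f M \<le> M\<close>: the data and the reaction, both bounded by
  \<open>M\<close>, enter with weights \<open>exp (- \<mu> t)\<close> and \<open>1 - exp (-
  \<mu> t)\<close>. By the delay the bound propagates in time steps of length
  \<open>\<tau>\<close>.\<close>
lemma ex_ubound: "\<exists>M\<ge>ustar. \<forall>t x. -\<tau> \<le> t \<longrightarrow> 0 \<le> x \<longrightarrow> u t x \<le> M"
proof -
  obtain M0 where M0: "0 < M0" "\<And>t x. -\<tau> \<le> t \<Longrightarrow> t \<le> 0 \<Longrightarrow> 0 \<le> x \<Longrightarrow> u t x \<le> M0" using u_bounded[of 0] by blast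
  define M where "M = max M0 ustar"
  have M: "ustar \<le> M" "0 < M" "\<And>t x. -\<tau> \<le> t \<Longrightarrow> t \<le> 0 \<Longrightarrow> 0 \<le> x \<Longrightarrow> u t x \<le> M"
    using M0 by (auto simp: M_def le_max_iff_disj)
  have "u t x \<le> M" if "-\<tau> \<le> t" "t \<le> real n * \<tau>" "0 \<le> x" for n t x
    using that
  proof (induction n arbitrary: t x)
    case 0
    then show ?case using M(3) by simp
  next
    case (Suc n)
    show ?case
    proof (cases "t \<le> 0")
      case True
      then show ?thesis using M(3) Suc.prems by simp
    next
      case False
      then have t: "0 < t" by simp
      have "dirichlet_semigroup d \<mu> t (u 0) x = dirichlet_semigroup d \<mu> t (\<lambda>y. u 0 (max 0 y)) x"
        by (rule dirichlet_semigroup_cong) simp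
      also have "\<dots> \<le> dirichlet_semigroup d \<mu> t (\<lambda>_. M) x"
        using u_nonneg[of 0] M tau_pos t Suc.prems(3)
        by (intro dirichlet_semigroup_mono[where B=M and C=M] u_slice_measurable) auto
      also have "\<dots> \<le> exp (- \<mu> * t) * M" using M t Suc.prems by (intro dirichlet_semigroup_const_le) auto
      finally have 1: "dirichlet_semigroup d \<mu> t (u 0) x \<le> exp (- \<mu> * t) * M" .
      have "half_int x (recent t t)
        \<le> half_int x (\<lambda>p. M * (\<lambda>(s, y). indicator {0..<t} s) p)"
      proof (rule half_mono[OF Suc.prems(3) bounded_measurable_reaction_window])
        show "bounded_measurable (\<lambda>p. M * (\<lambda>(s, y). indicator {0..<t} s) p)"
          by (intro bounded_measurable_cmult bounded_measurableI[of _ 1]) (auto simp: indicator_def)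
        fix s y :: real assume s: "0 < s" "0 \<le> y"
        show "(recent t t) (s, y) \<le> M * (\<lambda>(s, y). indicator {0..<t} s) (s, y)"
        proof (cases "s < t")
          case True
          have r: "-\<tau> \<le> t - s - \<tau>" "t - s - \<tau> \<le> real n * \<tau>" using True s Suc.prems by (auto simp: algebra_simps)
          have "reaction (t - s - \<tau>) y = f (u (t - s - \<tau>) y)" using r s by (simp add: reaction_eq)
          also have "\<dots> \<le> f M" using Suc.IH[OF r s(2)] u_nonneg[OF r(1) s(2)] by (intro f_mono)
          also have "\<dots> \<le> M" by (rule f_le_self[OF M(1)])
          finally show ?thesis using True s by simp
        qed simp
      qed
      also have "\<dots> \<le> M * (exp (- \<mu> * 0) - exp (- \<mu> * t))"
        unfolding half_cmult using M t Suc.prems by (intro mult_left_mono half_int_window_le) auto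
      finally show ?thesis using 1 u_eq[OF t Suc.prems(3)] by (simp add: algebra_simps)
    qed
  qed
  note B = this
  have "u t x \<le> M" if "-\<tau> \<le> t" "0 \<le> x" for t x
  proof -
    obtain n where "t / \<tau> \<le> real n" using real_arch_simple by blast
    then have "t \<le> real n * \<tau>" using tau_pos by (simp add: field_simps)
    then show ?thesis using B that by blast
  qed
  with M(1) show ?thesis by blast
qed

text \<open>One bound of the solution for all times, taken above \<open>ustar\<close> so
  that it bounds the reaction as well.\<close>
definition ubound :: real where
  "ubound = (SOME M. ustar \<le> M \<and> (\<forall>t x. -\<tau> \<le> t \<longrightarrow> 0 \<le> x \<longrightarrow> u t x \<le> M))"

lemma ustar_le_ubound: "ustar \<le> ubound"
  and u_le_ubound: "-\<tau> \<le> t \<Longrightarrow> 0 \<le> x \<Longrightarrow> u t x \<le> ubound"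
  using someI_ex[of "\<lambda>M. ustar \<le> M \<and> (\<forall>t x. -\<tau> \<le> t \<longrightarrow> 0 \<le> x \<longrightarrow> u t x \<le> M)"] ex_ubound
  by (auto simp: ubound_def)

lemma ubound_pos: "0 < ubound" using ustar_le_ubound ustar_pos by linarith

lemma reaction_le: "reaction r y \<le> ubound"
proof -
  have "reaction r y \<le> f ubound" unfolding reaction_def by (intro f_mono u_le_ubound u_nonneg) auto
  also have "\<dots> \<le> ubound" by (rule f_le_self[OF ustar_le_ubound])
  finally show ?thesis .
qed

text \<open>Forgetting everything older than \<open>K\<close> only loses nonnegative
  terms.\<close>
lemma u_lower:
  assumes "0 < K" "K \<le> t" "0 \<le> x"
  shows "half_int x (recent K t) \<le> u t x"
proof -
  have "half_int x (recent K t)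
     \<le> half_int x (recent t t)"
    using assms reaction_nonneg by (intro half_mono bounded_measurable_reaction_window) (auto simp: indicator_def)
  moreover have "0 \<le> dirichlet_semigroup d \<mu> t (u 0) x"
    using assms u_nonneg tau_pos by (intro dirichlet_semigroup_nonneg) auto
  ultimately show ?thesis using u_eq[of t x] assms by simp
qed

text \<open>What is older than \<open>K\<close>, initial data included, has weight
  \<open>exp (- \<mu> K)\<close>.\<close>
lemma u_upper:
  assumes "0 < K" "K \<le> t" "0 \<le> x"
  shows "u t x \<le> ubound * exp (- \<mu> * K) + half_int x (recent K t)"
proof -
  let ?w = "\<lambda>K. (recent K t)"
  have "dirichlet_semigroup d \<mu> t (u 0) x = dirichlet_semigroup d \<mu> t (\<lambda>y. u 0 (max 0 y)) x"
    by (rule dirichlet_semigroup_cong) simp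
  also have "\<dots> \<le> dirichlet_semigroup d \<mu> t (\<lambda>_. ubound) x"
    using u_nonneg[of 0] u_le_ubound[of 0] ubound_pos tau_pos assms
    by (intro dirichlet_semigroup_mono[where B=ubound and C=ubound] u_slice_measurable) auto
  also have "\<dots> \<le> exp (- \<mu> * t) * ubound" using ubound_pos assms by (intro dirichlet_semigroup_const_le) auto
  finally have 1: "dirichlet_semigroup d \<mu> t (u 0) x \<le> exp (- \<mu> * t) * ubound" .
  have "half_int x (?w t) \<le> half_int x (\<lambda>p. ?w K p + ubound * (\<lambda>(s, y). indicator {K..<t} s) p)"
  proof (rule half_mono[OF assms(3) bounded_measurable_reaction_window])
    show "bounded_measurable (\<lambda>p. ?w K p + ubound * (\<lambda>(s, y). indicator {K..<t} s) p)"
      by (intro bounded_measurable_add bounded_measurable_reaction_window bounded_measurable_cmult bounded_measurableI[of _ 1]) (auto simp: indicator_def)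
  qed (use reaction_le assms in \<open>auto simp: indicator_def\<close>)
  also have "\<dots> = half_int x (?w K) + half_int x (\<lambda>p. ubound * (\<lambda>(s, y). indicator {K..<t} s) p)"
    by (intro half_add assms bounded_measurable_reaction_window bounded_measurable_cmult bounded_measurableI[of _ 1]) (auto simp: indicator_def)
  also have "half_int x (\<lambda>p. ubound * (\<lambda>(s, y). indicator {K..<t} s) p) \<le> ubound * (exp (- \<mu> * K) - exp (- \<mu> * t))"
    unfolding half_cmult using ubound_pos assms by (intro mult_left_mono half_int_window_le) auto
  finally show ?thesis using 1 u_eq[of t x] assms by (simp add: algebra_simps)
qed

end

section \<open>Asymptotic upper and lower bounds\<close>

lemma tendsto_zero_ex_less:
  fixes g :: "real \<Rightarrow> real"
  assumes "(g \<longlongrightarrow> 0) at_top" "0 < e"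
  shows "\<exists>K>0. g K < e"
proof -
  have "\<forall>\<^sub>F K in at_top. g K < e" using assms by (rule order_tendstoD)
  then obtain N where "\<forall>n\<ge>N. g n < e" by (auto simp: eventually_at_top_linorder)
  then have "g (max N 1) < e" by simp
  then show ?thesis by (intro exI[of _ "max N 1"]) auto
qed

context half_line_solution
begin

text \<open>Uniform on the half-line: far away the solution may be small, but it cannot be
  large.\<close>
definition upper :: "(real \<Rightarrow> real) \<Rightarrow> bool" where
  "upper w \<longleftrightarrow> (\<forall>\<eta>>0. \<forall>\<^sub>F t in at_top. \<forall>x\<ge>0. u t x \<le> w x + \<eta>)"

text \<open>Uniform only in cones of speed less than \<open>c\<close>, as a solution with
  compactly supported data is small ahead of its front. All smaller speeds are quantified so
  that a transform can lose a little speed.\<close>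
definition lower :: "real \<Rightarrow> (real \<Rightarrow> real) \<Rightarrow> bool" where
  "lower c w \<longleftrightarrow> (\<forall>c'<c. \<forall>\<eta>>0. \<forall>\<^sub>F t in at_top. \<forall>x. 0 \<le> x \<longrightarrow> x \<le> c' * t \<longrightarrow> w x - \<eta> \<le> u t x)"

lemma upperD: "upper w \<Longrightarrow> 0 < \<eta> \<Longrightarrow> \<exists>t1. \<forall>t\<ge>t1. \<forall>x\<ge>0. u t x \<le> w x + \<eta>"
  by (simp add: upper_def eventually_at_top_linorder)

lemma lowerD: "lower c w \<Longrightarrow> c' < c \<Longrightarrow> 0 < \<eta> \<Longrightarrow> \<exists>t1. \<forall>t\<ge>t1. \<forall>x. 0 \<le> x \<longrightarrow> x \<le> c' * t \<longrightarrow> w x - \<eta> \<le> u t x"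
  by (simp add: lower_def eventually_at_top_linorder)

text \<open>For large \<open>t\<close> the recent history lies in the time range in which
  the bound \<open>w\<close> is valid up to a small error, and the older history is
  negligible.\<close>
lemma upper_green:
  assumes up: "upper w" and m: "w \<in> borel_measurable borel" and w: "\<And>y. 0 \<le> w y" "\<And>y. w y \<le> M"
  shows "upper (green (\<lambda>y. f (w y)))"
  unfolding upper_def
proof (intro allI impI)
  fix \<eta> :: real assume \<eta>: "0 < \<eta>"
  obtain L where L: "0 < L" "\<And>u v. 0 \<le> u \<Longrightarrow> u \<le> v \<Longrightarrow> v \<le> M + 1 \<Longrightarrow> f v - f u \<le> L * (v - u)"
    using f_lipschitz[of "M + 1"] by blast
  define \<eta>1 where "\<eta>1 = min 1 (\<eta> / (2 * L))"
  have \<eta>1: "0 < \<eta>1" "\<eta>1 \<le> 1" using \<eta> L(1) by (auto simp: \<eta>1_def)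
  have "L * \<eta>1 \<le> L * (\<eta> / (2 * L))" using L(1) by (intro mult_left_mono) (auto simp: \<eta>1_def)
  also have "\<dots> = \<eta> / 2" using L(1) by simp
  finally have \<eta>1': "L * \<eta>1 \<le> \<eta> / 2" .
  have "((\<lambda>K. exp (- \<mu> * K)) \<longlongrightarrow> 0) at_top" using mu_pos by real_asymp
  then have "((\<lambda>K. ubound * exp (- \<mu> * K)) \<longlongrightarrow> 0) at_top" by (rule tendsto_mult_right_zero)
  from tendsto_zero_ex_less[OF this, of "\<eta> / 2"] \<eta>
  obtain K where K: "0 < K" "ubound * exp (- \<mu> * K) < \<eta> / 2" by auto
  obtain t1 where "\<forall>t\<ge>t1. \<forall>x\<ge>0. u t x \<le> w x + \<eta>1"
    using upperD[OF up \<eta>1(1)] by (elim exE)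
  note t1 = this[rule_format]
  have fwm: "(\<lambda>y. f (w y)) \<in> borel_measurable borel" by (rule f_comp_measurable[OF m w(1)])
  have fwb: "\<bar>f (w y)\<bar> \<le> f M" for y using f_nonneg[OF w(1)] f_mono[OF w(1,2)] by simp
  have main: "u t x \<le> green (\<lambda>y. f (w y)) x + \<eta>" if t: "max 0 t1 + K + \<tau> \<le> t" and x: "0 \<le> x" for t x
  proof -
    have "half_int x (recent K t)
       \<le> half_int x (\<lambda>p. (\<lambda>(s, y). f (w y)) p + L * \<eta>1)"
    proof (rule half_mono[OF x bounded_measurable_reaction_window bounded_measurable_add[OF bounded_measurable_space[OF fwm fwb] bounded_measurable_const]])
      fix s y :: real assume s: "0 < s" "0 \<le> y"
      show "(recent K t) (s, y) \<le> (\<lambda>(s, y). f (w y)) (s, y) + L * \<eta>1"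
      proof (cases "s < K")
        case True
        have r: "-\<tau> \<le> t - s - \<tau>" "t1 \<le> t - s - \<tau>" using True t tau_pos by auto
        have "reaction (t - s - \<tau>) y = f (u (t - s - \<tau>) y)" using r s by (simp add: reaction_eq)
        also have "\<dots> \<le> f (w y + \<eta>1)" using t1[OF r(2) s(2)] u_nonneg[OF r(1) s(2)] by (intro f_mono)
        also have "\<dots> \<le> f (w y) + L * \<eta>1" using L(2)[of "w y" "w y + \<eta>1"] w[of y] \<eta>1 by simp
        finally show ?thesis using True s by simp
      qed (use fwb[of y] L \<eta>1 w(1) in \<open>auto intro!: add_nonneg_nonneg f_nonneg\<close>)
    qed
    also have "\<dots> = half_int x (\<lambda>(s, y). f (w y)) + half_int x (\<lambda>p. L * \<eta>1)"
      by (rule half_add[OF x bounded_measurable_space[OF fwm fwb] bounded_measurable_const])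
    also have "\<dots> \<le> green (\<lambda>y. f (w y)) x + L * \<eta>1"
      using half_int_green[OF fwm fwb x] half_int_const_le[OF x, of "L * \<eta>1"] L \<eta>1 by simp
    finally have "half_int x (recent K t) \<le> green (\<lambda>y. f (w y)) x + L * \<eta>1" .
    moreover have "K \<le> t" using t tau_pos max.cobounded1[of 0 t1] by linarith
    ultimately show ?thesis using u_upper[OF K(1) _ x, of t] K(2) \<eta>1' by linarith
  qed
  show "\<forall>\<^sub>F t in at_top. \<forall>x\<ge>0. u t x \<le> green (\<lambda>y. f (w y)) x + \<eta>"
    by (rule eventually_mono[OF eventually_ge_at_top[of "max 0 t1 + K + \<tau>"]]) (use main in blast)
qed

lemma upper_mono:
  assumes "upper v" "\<And>x. 0 \<le> x \<Longrightarrow> v x \<le> w x"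
  shows "upper w"
  unfolding upper_def
proof (intro allI impI)
  fix \<eta> :: real assume "0 < \<eta>"
  from upperD[OF assms(1) this] obtain t1 where t1: "\<forall>t\<ge>t1. \<forall>x\<ge>0. u t x \<le> v x + \<eta>" by (elim exE)
  have "u t x \<le> w x + \<eta>" if "t1 \<le> t" "0 \<le> x" for t x
    using t1[rule_format, OF that] assms(2)[OF that(2)] by linarith
  then show "\<forall>\<^sub>F t in at_top. \<forall>x\<ge>0. u t x \<le> w x + \<eta>"
    by (intro eventually_mono[OF eventually_ge_at_top[of t1]]) simp
qed

text \<open>The infimum \<open>l \<ge> ustar\<close> of the constant upper bounds is an
  upper bound. Then \<open>f l\<close> is one too, whence \<open>l \<le> f l\<close>, and
  this leaves \<open>l = ustar\<close>.\<close>
lemma upper_ustar: "upper (\<lambda>_. ustar)"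
proof -
  define S where "S = {B. ustar \<le> B \<and> upper (\<lambda>_. B)}"
  have "\<forall>\<^sub>F t in at_top. \<forall>x\<ge>0. u t x \<le> ubound + \<eta>" if "0 < \<eta>" for \<eta>
    by (rule eventually_mono[OF eventually_ge_at_top[of "-\<tau>"]]) (use that in \<open>auto intro: add_increasing2 u_le_ubound\<close>)
  then have ne: "ubound \<in> S" by (auto simp: S_def upper_def ustar_le_ubound)
  have bdd: "bdd_below S" by (auto simp: S_def)
  define l where "l = Inf S"
  have l: "ustar \<le> l" unfolding l_def by (rule cInf_greatest) (use ne in \<open>auto simp: S_def\<close>)
  have up: "upper (\<lambda>_. l)"
    unfolding upper_def
  proof (intro allI impI)
    fix \<eta> :: real assume "0 < \<eta>"
    then obtain B where B: "B \<in> S" "B < l + \<eta> / 2"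
      using cInf_lessD[of S "l + \<eta> / 2"] ne by (auto simp: l_def)
    then have "\<forall>\<^sub>F t in at_top. \<forall>x\<ge>0. u t x \<le> B + \<eta> / 2"
      using \<open>0 < \<eta>\<close> by (auto simp: S_def upper_def)
    then show "\<forall>\<^sub>F t in at_top. \<forall>x\<ge>0. u t x \<le> l + \<eta>"
      by eventually_elim (use B in fastforce)
  qed
  have "upper (green (\<lambda>y. f l))" 
    by (rule upper_green[OF up, of l]) (use l ustar_pos in auto)
  then have "upper (\<lambda>_. f l)"
    by (rule upper_mono) (use l ustar_pos in \<open>auto intro!: green_const_le f_nonneg\<close>)
  moreover have "ustar \<le> f l" using f_mono[of ustar l] f_ustar l ustar_pos by simp
  ultimately have "l \<le> f l" using bdd unfolding l_def by (intro cInf_lower) (auto simp: S_def)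
  with f_below[of l] l have "l = ustar" by force
  with up show ?thesis by simp
qed

text \<open>The part of the Green integral that comes from old history or from a distance of
  at least \<open>A\<close> is small. For \<open>x \<le> c' t\<close> the remaining points
  at the earlier times \<open>t - s - \<tau>\<close> still lie in a cone of a slightly
  larger speed \<open>c'' < c\<close>, as soon as \<open>(c'' - c') t\<close> exceeds
  \<open>A\<close> plus the bounded amount \<open>c'' (K + \<tau>)\<close>.\<close>
lemma lower_green:
  assumes low: "lower c w" and c: "0 < c" and m: "w \<in> borel_measurable borel" and w: "\<And>y. 0 \<le> w y" "\<And>y. w y \<le> M"
  shows "lower c (green (\<lambda>y. f (w y)))"
  unfolding lower_def
proof (intro allI impI)
  fix c' \<eta> :: real assume c': "c' < c" and \<eta>: "0 < \<eta>"
  define c'' where "c'' = max ((c' + c) / 2) 0"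
  have c'': "c' < c''" "c'' < c" "0 \<le> c''" using c' c by (auto simp: c''_def less_max_iff_disj)
  obtain L where L: "0 < L" "\<And>u v. 0 \<le> u \<Longrightarrow> u \<le> v \<Longrightarrow> v \<le> M \<Longrightarrow> f v - f u \<le> L * (v - u)"
    using f_lipschitz[of M] by blast
  define \<eta>1 where "\<eta>1 = \<eta> / (4 * L)"
  have \<eta>1: "0 < \<eta>1" "L * \<eta>1 = \<eta> / 4" using \<eta> L(1) by (auto simp: \<eta>1_def)
  have fM: "0 \<le> f M" using w[of 0] by (intro f_nonneg) simp
  have "((\<lambda>K. exp (- \<mu> * K)) \<longlongrightarrow> 0) at_top" using mu_pos by real_asymp
  then have "((\<lambda>K. f M * exp (- \<mu> * K)) \<longlongrightarrow> 0) at_top" by (rule tendsto_mult_right_zero)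
  from tendsto_zero_ex_less[OF this, of "\<eta> / 4"] \<eta>
  obtain K where K: "0 < K" "f M * exp (- \<mu> * K) < \<eta> / 4" by auto
  have "((\<lambda>A. exp (d * K - A)) \<longlongrightarrow> 0) at_top" by real_asymp
  then have "((\<lambda>A. f M * exp (d * K - A)) \<longlongrightarrow> 0) at_top" by (rule tendsto_mult_right_zero)
  from tendsto_zero_ex_less[OF this, of "\<eta> / 4"] \<eta>
  obtain A where A: "f M * exp (d * K - A) < \<eta> / 4" by auto
  obtain t1 where "\<forall>t\<ge>t1. \<forall>x. 0 \<le> x \<longrightarrow> x \<le> c'' * t \<longrightarrow> w x - \<eta>1 \<le> u t x"
    using lowerD[OF low c''(2) \<eta>1(1)] by (elim exE)
  note t1 = this[rule_format]
  have fwm: "(\<lambda>y. f (w y)) \<in> borel_measurable borel" by (rule f_comp_measurable[OF m w(1)])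
  have fwb: "\<bar>f (w y)\<bar> \<le> f M" for y using f_nonneg[OF w(1)] f_mono[OF w(1,2)] by simp
  \<comment> \<open>the second entry makes points outside the cone of speed
    \<open>c''\<close> farther than \<open>A\<close> from \<open>x\<close>\<close>
  define T where "T = max (max 0 t1 + K + \<tau>) ((A + c'' * (K + \<tau>)) / (c'' - c'))"
  have main: "green (\<lambda>y. f (w y)) x - \<eta> \<le> u t x" if t: "T \<le> t" and x: "0 \<le> x" "x \<le> c' * t" for t x
  proof -
    have t': "max 0 t1 + K + \<tau> \<le> t" and t'': "A + c'' * (K + \<tau>) \<le> (c'' - c') * t"
      using t c'' by (auto simp: T_def field_simps)
    let ?R = "\<lambda>(s, y). indicator {0<..<K} s * reaction (t - s - \<tau>) y"
    let ?far = "\<lambda>(s, y). indicator {0<..<K} s * indicator {x + A..} y :: real"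
    let ?tail = "\<lambda>(s, y :: real). indicator {K..} s :: real"
    have b1: "bounded_measurable ?far" by (rule bounded_measurableI[of _ 1]) (auto simp: indicator_def)
    have b2: "bounded_measurable ?tail" by (rule bounded_measurableI[of _ 1]) (auto simp: indicator_def)
    note b = bounded_measurable_add bounded_measurable_reaction_window bounded_measurable_const bounded_measurable_cmult b1 b2
    have "green (\<lambda>y. f (w y)) x = half_int x (\<lambda>(s, y). f (w y))"
      by (rule half_int_green[OF fwm fwb x(1), symmetric])
    also have "\<dots> \<le> half_int x (\<lambda>p. (?R p + L * \<eta>1) + (f M * ?far p + f M * ?tail p))"
    proof (rule half_mono[OF x(1) bounded_measurable_space[OF fwm fwb]])
      show "bounded_measurable (\<lambda>p. (?R p + L * \<eta>1) + (f M * ?far p + f M * ?tail p))" by (intro b)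
      fix s y :: real assume s: "0 < s" "0 \<le> y"
      show "(\<lambda>(s, y). f (w y)) (s, y) \<le> (?R (s, y) + L * \<eta>1) + (f M * ?far (s, y) + f M * ?tail (s, y))"
      proof (cases "s < K")
        case True
        have r: "-\<tau> \<le> t - s - \<tau>" "t1 \<le> t - s - \<tau>" using True t' tau_pos by auto
        have R: "reaction (t - s - \<tau>) y = f (u (t - s - \<tau>) y)" using r s by (simp add: reaction_eq)
        show ?thesis
        proof (cases "y \<le> c'' * (t - s - \<tau>)")
          case near: True
          define v where "v = max 0 (w y - \<eta>1)"
          have v: "0 \<le> v" "v \<le> w y" "w y - v \<le> \<eta>1" using w[of y] \<eta>1(1) by (auto simp: v_def)
          have "f (w y) - f v \<le> L * (w y - v)" using v w by (intro L(2))
          also have "\<dots> \<le> L * \<eta>1" using v L(1) by (intro mult_left_mono) auto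
          finally have "f (w y) - L * \<eta>1 \<le> f v" by simp
          also have "\<dots> \<le> f (u (t - s - \<tau>) y)"
            using t1[OF r(2) s(2) near] u_nonneg[OF r(1) s(2)] v(1) by (intro f_mono) (auto simp: v_def)
          finally have "f (w y) \<le> f (u (t - s - \<tau>) y) + L * \<eta>1" by simp
          moreover have "0 \<le> f M * indicator {x + A..} y" using fM by simp
          ultimately show ?thesis using True s R by simp
        next
          case False
          have "c'' * (s + \<tau>) \<le> c'' * (K + \<tau>)" using True c'' by (intro mult_left_mono) auto
          then have "x + A \<le> y" using False x(2) t'' by (simp add: algebra_simps)
          then have "?far (s, y) = 1" using True s by simp
          then show ?thesis using True s abs_le_D1[OF fwb[of y]] reaction_nonneg[of "t - s - \<tau>" y] mult_pos_pos[OF L(1) \<eta>1(1)] by simp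
        qed
      next
        case False
        then show ?thesis using abs_le_D1[OF fwb[of y]] mult_pos_pos[OF L(1) \<eta>1(1)] by simp
      qed
    qed
    also have "\<dots> = (half_int x ?R + half_int x (\<lambda>p. L * \<eta>1)) + (f M * half_int x ?far + f M * half_int x ?tail)"
      using half_add[OF x(1), of "\<lambda>p. ?R p + L * \<eta>1" "\<lambda>p. f M * ?far p + f M * ?tail p", OF b(1)[OF b(2,3)] b(1)[OF b(4)[OF b1] b(4)[OF b2]]]
        half_add[OF x(1) b(2) b(3), of K t "L * \<eta>1"] half_add[OF x(1) b(4)[OF b1] b(4)[OF b2], of "f M" "f M"]
      by (simp only: half_cmult)
    also have "\<dots> \<le> (u t x + L * \<eta>1) + (f M * exp (d * K - A) + f M * exp (- \<mu> * K))"
    proof (intro add_mono mult_left_mono half_int_far half_int_tail fM x(1))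
      have "K \<le> t" using t' tau_pos max.cobounded1[of 0 t1] by linarith
      then show "half_int x ?R \<le> u t x" by (rule u_lower[OF K(1) _ x(1)])
      show "half_int x (\<lambda>p. L * \<eta>1) \<le> L * \<eta>1" using x(1) L(1) \<eta>1(1) by (intro half_int_const_le) auto
    qed (use K(1) in auto)
    finally show ?thesis using A K(2) \<eta>1(2) \<eta> by linarith
  qed
  show "\<forall>\<^sub>F t in at_top. \<forall>x. 0 \<le> x \<longrightarrow> x \<le> c' * t \<longrightarrow> green (\<lambda>y. f (w y)) x - \<eta> \<le> u t x"
    by (rule eventually_mono[OF eventually_ge_at_top[of T]]) (use main in blast)
qed

text \<open>The initial history is positive on some box by continuity, and after the time
  \<open>\<tau>\<close> this box lies in the history that the reaction has felt.\<close>
lemma u_positive: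
  assumes nt: "\<not> vanishes_on \<tau> {0..} \<phi>" and t: "\<tau> \<le> t" and x: "0 < x"
  shows "0 < u t x"
proof -
  obtain \<theta>1 y1 where th: "-\<tau> \<le> \<theta>1" "\<theta>1 \<le> 0" "0 \<le> y1" "\<phi> \<theta>1 y1 \<noteq> 0" using nt by (auto simp: vanishes_on_def)
  have pos1: "0 < u \<theta>1 y1" using u_nonneg[of \<theta>1 y1] u_init[of \<theta>1 y1] th by simp
  have "\<exists>\<delta>>0. \<forall>z\<in>{-\<tau>..} \<times> {0..}. dist z (\<theta>1, y1) < \<delta> \<longrightarrow> dist (case z of (t, x) \<Rightarrow> u t x) (case (\<theta>1, y1) of (t, x) \<Rightarrow> u t x) < u \<theta>1 y1"
    using u_cont[unfolded continuous_on_iff, rule_format, of "(\<theta>1, y1)" "u \<theta>1 y1"] pos1 th by auto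
  then obtain \<delta> where \<delta>: "0 < \<delta>" "\<forall>z\<in>{-\<tau>..} \<times> {0..}. dist z (\<theta>1, y1) < \<delta> \<longrightarrow> dist (case z of (t, x) \<Rightarrow> u t x) (u \<theta>1 y1) < u \<theta>1 y1"
    by auto
  have pos: "0 < u \<theta> y" if "-\<tau> \<le> \<theta>" "0 \<le> y" "\<bar>\<theta> - \<theta>1\<bar> < \<delta> / 2" "\<bar>y - y1\<bar> < \<delta> / 2" for \<theta> y
  proof -
    have "dist (\<theta>, y) (\<theta>1, y1) \<le> \<bar>\<theta> - \<theta>1\<bar> + \<bar>y - y1\<bar>"
      unfolding dist_prod_def using sqrt_sum_squares_le_sum_abs[of "\<theta> - \<theta>1" "y - y1"] by (simp add: dist_real_def)
    then have "dist (\<theta>, y) (\<theta>1, y1) < \<delta>" using that by linarith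
    then have "dist (u \<theta> y) (u \<theta>1 y1) < u \<theta>1 y1" using \<delta>(2)[rule_format, of "(\<theta>, y)"] that by auto
    then show ?thesis by (auto simp: dist_real_def abs_if split: if_splits)
  qed
  define \<theta>a where "\<theta>a = max (-\<tau>) (\<theta>1 - \<delta> / 2)"
  define \<theta>b where "\<theta>b = min 0 (\<theta>1 + \<delta> / 2)"
  have ab: "\<theta>a < \<theta>b" "-\<tau> \<le> \<theta>a" "\<theta>b \<le> 0" using th \<delta>(1) tau_pos by (auto simp: \<theta>a_def \<theta>b_def)
  have "0 < half_int x (recent t t)"
  proof (rule half_int_pos[OF x bounded_measurable_reaction_window, of _ _ "t - \<tau> - \<theta>b" "t - \<tau> - \<theta>a" "max 0 (y1 - \<delta> / 2)" "y1 + \<delta> / 2"])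
    fix s y assume s: "t - \<tau> - \<theta>b < s" "s < t - \<tau> - \<theta>a" "max 0 (y1 - \<delta> / 2) < y" "y < y1 + \<delta> / 2"
    have "\<theta>1 - \<delta> / 2 \<le> \<theta>a" "\<theta>b \<le> \<theta>1 + \<delta> / 2" by (auto simp: \<theta>a_def \<theta>b_def)
    then have "\<bar>t - s - \<tau> - \<theta>1\<bar> < \<delta> / 2" "\<bar>y - y1\<bar> < \<delta> / 2"
      unfolding abs_less_iff using s by auto
    then have "0 < u (t - s - \<tau>) y" using s ab by (intro pos) auto
    then have "0 < reaction (t - s - \<tau>) y" using s ab by (subst reaction_eq) (auto intro!: f_pos)
    moreover have "0 < s" "s < t" using s ab t by auto
    ultimately show "0 < (recent t t) (s, y)" by simp
  qed (use ab t th \<delta>(1) reaction_nonneg in \<open>auto simp: less_max_iff_disj indicator_def\<close>)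
  also have "\<dots> \<le> u t x" using t tau_pos x by (intro u_lower) auto
  finally show ?thesis .
qed

end

section \<open>The Green operator on the half-line\<close>

text \<open>The dominating function may depend on the point, which is what the exponentially
  growing bounds in \<open>green_kernel_bound\<close> require.\<close>
lemma continuous_on_dominated_integral:
  fixes h :: "'a :: metric_space \<Rightarrow> 'b \<Rightarrow> real"
  assumes meas: "\<And>x. x \<in> S \<Longrightarrow> h x \<in> borel_measurable M"
    and cont: "\<And>z. z \<in> space M \<Longrightarrow> continuous_on S (\<lambda>x. h x z)"
    and dom: "\<And>x0. x0 \<in> S \<Longrightarrow> \<exists>e>0. \<exists>w. integrable M w \<and> (\<forall>x\<in>S. dist x x0 < e \<longrightarrow> (\<forall>z\<in>space M. \<bar>h x z\<bar> \<le> w z))"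
  shows "continuous_on S (\<lambda>x. \<integral>z. h x z \<partial>M)"
  unfolding continuous_on_sequentially
proof (intro allI ballI impI)
  fix X x0 assume "x0 \<in> S" and X: "(\<forall>n. X n \<in> S) \<and> X \<longlonglongrightarrow> x0"
  obtain e w where e: "0 < e" "integrable M w" "\<forall>x\<in>S. dist x x0 < e \<longrightarrow> (\<forall>z\<in>space M. \<bar>h x z\<bar> \<le> w z)"
    using dom[OF \<open>x0 \<in> S\<close>] by (elim exE conjE)
  obtain N where N: "\<forall>n\<ge>N. dist (X n) x0 < e"
    using X e(1) unfolding lim_sequentially by (elim conjE) (drule spec[of _ e], auto)
  have "(\<lambda>n. \<integral>z. h (X (n + N)) z \<partial>M) \<longlonglongrightarrow> (\<integral>z. h x0 z \<partial>M)"
  proof (rule integral_dominated_convergence[where w=w])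
    show "AE z in M. (\<lambda>n. h (X (n + N)) z) \<longlonglongrightarrow> h x0 z"
    proof (rule AE_I2)
      fix z assume "z \<in> space M"
      have "(\<lambda>n. X (n + N)) \<longlonglongrightarrow> x0" using X by (intro LIMSEQ_ignore_initial_segment) simp
      with cont[OF \<open>z \<in> space M\<close>] \<open>x0 \<in> S\<close> X show "(\<lambda>n. h (X (n + N)) z) \<longlonglongrightarrow> h x0 z"
        by (intro continuous_on_tendsto_compose[of S "\<lambda>x. h x z"]) auto
    qed
    show "AE z in M. norm (h (X (n + N)) z) \<le> w z" for n
      using e(3) N X by (intro AE_I2) auto
  qed (use meas X \<open>x0 \<in> S\<close> e(2) in auto)
  then show "((\<lambda>x. \<integral>z. h x z \<partial>M) \<circ> X) \<longlonglongrightarrow> (\<integral>z. h x0 z \<partial>M)"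
    unfolding o_def by (rule LIMSEQ_offset)
qed

context diffusion
begin

lemma exp_half_integrable: "integrable lborel (\<lambda>y. indicator {0..} y * exp (- a * y))"
proof -
  interpret e: diffusion 1 a by unfold_locales (use a_pos in auto)
  have "integrable lborel (\<lambda>y. indicator {0..} y * (a * exp (- a * y)))"
    using e.exp_density_integral[of 0] by (simp add: has_bochner_integral_iff)
  then have "integrable lborel (\<lambda>y. (1 / a) * (indicator {0..} y * (a * exp (- a * y))))"
    by (rule integrable_mult_right)
  then show ?thesis using a_pos by simp
qed

lemma exp_weight_integrable:
  assumes [measurable]: "g \<in> borel_measurable borel" and B: "\<And>y. \<bar>g y\<bar> \<le> B"
  shows "integrable lborel (\<lambda>y. indicator {0..} y * (exp (- a * y) * g y))"
proof (rule Bochner_Integration.integrable_bound)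
  show "integrable lborel (\<lambda>y. indicator {0..} y * exp (- a * y) * B)"
    using exp_half_integrable by (rule integrable_mult_left)
  show "AE y in lborel. norm (indicator {0..} y * (exp (- a * y) * g y)) \<le> norm (indicator {0..} y * exp (- a * y) * B)"
    using B order_trans[OF B abs_ge_self] by (auto simp: abs_mult indicator_def)
qed measurable

text \<open>Crude in \<open>x\<close>, but with an integrable weight in \<open>y\<close>
  that is locally uniform in \<open>x\<close>.\<close>
lemma green_kernel_bound:
  assumes "0 \<le> x" "0 \<le> y"
  shows "\<bar>green_kernel x y * v\<bar> \<le> a * exp (a * x) * (exp (- a * y) * \<bar>v\<bar>)"
proof -
  let ?D = "exp (- a * \<bar>x - y\<bar>) - exp (- a * (x + y))"
  have e1: "exp (- a * \<bar>x - y\<bar>) \<le> exp (a * x) * exp (- a * y)"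
    using a_pos mult_left_mono[of "y - x" "\<bar>x - y\<bar>" a] unfolding exp_add[symmetric] by (simp add: algebra_simps)
  have e2: "exp (- a * (x + y)) \<le> exp (a * x) * exp (- a * y)"
    using a_pos assms unfolding exp_add[symmetric] by (auto simp: algebra_simps)
  have "\<bar>?D\<bar> \<le> exp (a * x) * exp (- a * y)"
    unfolding abs_le_iff using e1 e2 exp_gt_zero[of "- a * (x + y)"] exp_gt_zero[of "- a * \<bar>x - y\<bar>"] by linarith
  then have "(a / 2) * \<bar>?D\<bar> \<le> a * (exp (a * x) * exp (- a * y))"
    using a_pos by (intro mult_mono) auto
  then have "(a / 2) * \<bar>?D\<bar> * \<bar>v\<bar> \<le> a * (exp (a * x) * exp (- a * y)) * \<bar>v\<bar>"
    by (rule mult_right_mono) simp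
  moreover have "\<bar>a / 2 * ?D * v\<bar> = (a / 2) * \<bar>?D\<bar> * \<bar>v\<bar>"
    using a_pos by (simp only: abs_mult)
  ultimately show ?thesis by (simp only: mult.assoc)
qed

lemma green_kernel_integrable:
  assumes [measurable]: "g \<in> borel_measurable borel" and B: "\<And>y. \<bar>g y\<bar> \<le> B" and x: "0 \<le> x"
  shows "integrable lborel (\<lambda>y. indicator {0..} y * (green_kernel x y * g y))"
proof (rule Bochner_Integration.integrable_bound)
  show "integrable lborel (\<lambda>y. (a * exp (a * x)) * (indicator {0..} y * (exp (- a * y) * B)))"
    using exp_weight_integrable[of "\<lambda>_. B" "\<bar>B\<bar>"] by simp
  have "\<bar>green_kernel x y * g y\<bar> \<le> a * exp (a * x) * (exp (- a * y) * \<bar>B\<bar>)" if "0 \<le> y" for y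
    by (rule order_trans[OF green_kernel_bound[OF x that]]) (use B[of y] a_pos in \<open>auto intro!: mult_left_mono\<close>)
  then show "AE y in lborel. norm (indicator {0..} y * (green_kernel x y * g y))
     \<le> norm ((a * exp (a * x)) * (indicator {0..} y * (exp (- a * y) * B)))"
    using a_pos by (intro AE_I2) (auto simp: indicator_def abs_mult)
qed measurable

lemma green_eq: "green g x = (\<integral>y. indicator {0..} y * (green_kernel x y * g y) \<partial>lborel)"
  by (simp add: green_def set_lebesgue_integral_def)

lemma green_kernel_nonneg: "0 \<le> x \<Longrightarrow> 0 \<le> y \<Longrightarrow> 0 \<le> green_kernel x y"
  using a_pos by auto

lemma green_mono:
  assumes "g \<in> borel_measurable borel" "\<And>y. \<bar>g y\<bar> \<le> B" "h \<in> borel_measurable borel" "\<And>y. \<bar>h y\<bar> \<le> C" "0 \<le> x"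
    and "\<And>y. 0 \<le> y \<Longrightarrow> g y \<le> h y"
  shows "green g x \<le> green h x"
  using half_mono[OF assms(5) bounded_measurable_space[OF assms(1,2)] bounded_measurable_space[OF assms(3,4)]] assms(6)
    half_int_green[OF assms(1,2,5)] half_int_green[OF assms(3,4,5)] by simp

lemma green_nonneg: "0 \<le> x \<Longrightarrow> (\<And>y. 0 \<le> y \<Longrightarrow> 0 \<le> g y) \<Longrightarrow> 0 \<le> green g x"
  unfolding green_eq using green_kernel_nonneg[of x] by (intro integral_nonneg_AE AE_I2) (auto simp: indicator_def)

lemma green_le:
  assumes "g \<in> borel_measurable borel" "\<And>y. \<bar>g y\<bar> \<le> B" "0 \<le> x"
  shows "green g x \<le> B"
proof -
  have "0 \<le> B" using assms(2)[of 0] by simp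
  have "green g x \<le> green (\<lambda>_. B) x"
    using assms \<open>0 \<le> B\<close> by (intro green_mono[where B=B and C=B]) (auto intro: order_trans[OF abs_ge_self])
  also have "\<dots> \<le> B" using \<open>0 \<le> B\<close> assms(3) by (rule green_const_le)
  finally show ?thesis .
qed

lemma green_measurable: 
  assumes [measurable]: "g \<in> borel_measurable borel" shows "green g \<in> borel_measurable borel"
  unfolding green_eq[abs_def] by measurable

lemma green_0: "green g 0 = 0"
proof -
  have "indicator {0..} y * (a / 2 * (exp (- a * \<bar>0 - y\<bar>) - exp (- a * (0 + y))) * g y) = 0" for y :: real
    by (cases "0 \<le> y") auto
  then show ?thesis by (simp only: green_eq) simp
qed

text \<open>The Laplace transform of \<open>g\<close> at \<open>a\<close>. Up to the factor
  \<open>a\<^sup>2\<close> it is the slope of \<open>green g\<close> at the origin.\<close>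
definition moment :: "(real \<Rightarrow> real) \<Rightarrow> real" where
  "moment g = (\<integral>y. indicator {0..} y * (exp (- a * y) * g y) \<partial>lborel)"

text \<open>Variation of parameters: splitting the kernel at \<open>y = x\<close> separates
  the variables, so that the Green operator can be differentiated in
  \<open>x\<close>.\<close>
lemma green_formula:
  assumes cont: "continuous_on UNIV g" and B: "\<And>y. \<bar>g y\<bar> \<le> B" and x: "0 \<le> x"
  shows "green g x = a / 2 * (exp (- a * x) * integral {0..x} (\<lambda>y. exp (a * y) * g y)
     + exp (a * x) * (moment g - integral {0..x} (\<lambda>y. exp (- a * y) * g y)) - exp (- a * x) * moment g)"
proof -
  have m[measurable]: "g \<in> borel_measurable borel" using cont by (rule borel_measurable_continuous_onI)
  have hb: "has_bochner_integral lborel (\<lambda>y. indicator {0..x} y * (exp (c * y) * g y)) (integral {0..x} (\<lambda>y. exp (c * y) * g y))" for c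
  proof -
    have "continuous_on {0..x} (\<lambda>y. exp (c * y) * g y)" by (intro continuous_intros continuous_on_subset[OF cont]) auto
    then have "set_integrable lborel {0..x} (\<lambda>y. exp (c * y) * g y)" by (rule borel_integrable_atLeastAtMost')
    from this set_borel_integral_eq_integral(2)[OF this] show ?thesis
      by (simp add: has_bochner_integral_iff set_integrable_def set_lebesgue_integral_def)
  qed
  have mo: "has_bochner_integral lborel (\<lambda>y. indicator {0..} y * (exp (- a * y) * g y)) (moment g)"
    unfolding moment_def using exp_weight_integrable[OF m B] by (rule has_bochner_integral_integrable)
  have H: "has_bochner_integral lborel (\<lambda>y. a / 2 * (exp (- a * x) * (indicator {0..x} y * (exp (a * y) * g y))
      + exp (a * x) * (indicator {0..} y * (exp (- a * y) * g y) - indicator {0..x} y * (exp (- a * y) * g y))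
      - exp (- a * x) * (indicator {0..} y * (exp (- a * y) * g y))))
     (a / 2 * (exp (- a * x) * integral {0..x} (\<lambda>y. exp (a * y) * g y)
     + exp (a * x) * (moment g - integral {0..x} (\<lambda>y. exp (- a * y) * g y)) - exp (- a * x) * moment g))"
    by (intro has_bochner_integral_mult_right has_bochner_integral_add has_bochner_integral_diff hb mo)
  have e: "indicator {0..} y * (green_kernel x y * g y)
    = a / 2 * (exp (- a * x) * (indicator {0..x} y * (exp (a * y) * g y))
      + exp (a * x) * (indicator {0..} y * (exp (- a * y) * g y) - indicator {0..x} y * (exp (- a * y) * g y))
      - exp (- a * x) * (indicator {0..} y * (exp (- a * y) * g y)))" for y
  proof -
    have p: "exp (- a * (x + y)) = exp (- a * x) * exp (- a * y)" by (simp add: exp_add[symmetric] algebra_simps)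
    consider "y < 0" | "0 \<le> y" "y \<le> x" | "x < y" "0 \<le> y" using x by linarith
    then show ?thesis
    proof cases
      case 2
      then have "exp (- a * \<bar>x - y\<bar>) = exp (- a * x) * exp (a * y)" by (simp add: exp_add[symmetric] algebra_simps)
      then show ?thesis unfolding p using 2 by (simp add: algebra_simps)
    next
      case 3
      then have "exp (- a * \<bar>x - y\<bar>) = exp (a * x) * exp (- a * y)" by (simp add: exp_add[symmetric] algebra_simps)
      then show ?thesis unfolding p using 3 by (simp add: algebra_simps)
    qed simp
  qed
  show ?thesis unfolding green_eq e by (rule has_bochner_integral_integral_eq[OF H])
qed

text \<open>The derivative of the right-hand side of \<open>green_formula\<close> (the terms
  that contain \<open>g x\<close> cancel).\<close>
definition green' :: "(real \<Rightarrow> real) \<Rightarrow> real \<Rightarrow> real" where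
  "green' g x = a\<^sup>2 / 2 * (exp (a * x) * (moment g - integral {0..x} (\<lambda>y. exp (- a * y) * g y)) + exp (- a * x) * moment g
      - exp (- a * x) * integral {0..x} (\<lambda>y. exp (a * y) * g y))"

lemma integral_exp_deriv:
  assumes cont: "continuous_on UNIV g" and x: "0 < x"
  shows "((\<lambda>x. integral {0..x} (\<lambda>y. exp (c * y) * g y)) has_real_derivative exp (c * x) * g x) (at x)"
proof -
  have "((\<lambda>x. integral {0..x} (\<lambda>y. exp (c * y) * g y)) has_real_derivative exp (c * x) * g x) (at x within {0..x + 1})"
    using x by (intro integral_has_real_derivative continuous_intros continuous_on_subset[OF cont]) auto
  moreover have "at x within {0..x + 1} = at x" using x by (intro at_within_interior) auto
  ultimately show ?thesis by simp
qed

lemma green_deriv: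
  assumes cont: "continuous_on UNIV g" and B: "\<And>y. \<bar>g y\<bar> \<le> B" and x: "0 < x"
  shows "(green g has_real_derivative green' g x) (at x)"
proof -
  let ?F = "\<lambda>x. a / 2 * (exp (- a * x) * integral {0..x} (\<lambda>y. exp (a * y) * g y)
     + exp (a * x) * (moment g - integral {0..x} (\<lambda>y. exp (- a * y) * g y)) - exp (- a * x) * moment g)"
  have "(?F has_real_derivative green' g x) (at x)"
    by (rule derivative_eq_intros integral_exp_deriv[OF cont x] refl | 
        simp add: green'_def power2_eq_square algebra_simps exp_minus)+
  then show ?thesis
    using x by (rule has_field_derivative_transform_within[where d=x]) (auto simp: dist_real_def green_formula[OF cont B])
qed

lemma green'_deriv:
  assumes cont: "continuous_on UNIV g" and B: "\<And>y. \<bar>g y\<bar> \<le> B" and x: "0 < x"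
  shows "(green' g has_real_derivative a\<^sup>2 * (green g x - g x)) (at x)"
  unfolding green_formula[OF cont B less_imp_le[OF x]] green'_def[abs_def]
  by (rule derivative_eq_intros integral_exp_deriv[OF cont x] refl | 
      simp add: power2_eq_square algebra_simps exp_minus)+

lemma green'_tendsto_0:
  assumes cont: "continuous_on UNIV g"
  shows "(green' g \<longlongrightarrow> a\<^sup>2 * moment g) (at_right 0)"
proof -
  have "((\<lambda>x. integral {0..x} (\<lambda>y. exp (c * y) * g y)) \<longlongrightarrow> integral {0..0} (\<lambda>y. exp (c * y) * g y)) (at_right 0)" for c
  proof -
    have this_cont: "continuous_on {0..1::real} (\<lambda>x. integral {0..x} (\<lambda>y. exp (c * y) * g y))"
      by (intro indefinite_integral_continuous_1 integrable_continuous_interval continuous_intros continuous_on_subset[OF cont]) auto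
    have "((\<lambda>x. integral {0..x} (\<lambda>y. exp (c * y) * g y)) \<longlongrightarrow> integral {0..0} (\<lambda>y. exp (c * y) * g y)) (at 0 within {0..1})"
      by (rule this_cont[unfolded continuous_on_def, rule_format]) simp
    then show ?thesis by (simp add: at_within_Icc_at_right)
  qed
  note I = this
  have "(green' g \<longlongrightarrow> a\<^sup>2 / 2 * (exp (a * 0) * (moment g - integral {0..0} (\<lambda>y. exp (- a * y) * g y)) + exp (- a * 0) * moment g
      - exp (- a * 0) * integral {0..0} (\<lambda>y. exp (a * y) * g y))) (at_right 0)"
    unfolding green'_def[abs_def] by (intro tendsto_intros I)
  then show ?thesis by simp
qed

lemma green_cont:
  assumes m[measurable]: "g \<in> borel_measurable borel" and B: "\<And>y. \<bar>g y\<bar> \<le> B"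
  shows "continuous_on {0..} (green g)"
  unfolding green_eq[abs_def]
proof (rule continuous_on_dominated_integral)
  show "continuous_on {0..} (\<lambda>x. indicator {0..} y * (green_kernel x y * g y))" for y
    by (intro continuous_intros)
  fix x0 :: real assume "x0 \<in> {0..}"
  have "\<bar>indicator {0..} y * (green_kernel x y * g y)\<bar> \<le> a * exp (a * (x0 + 1)) * (indicator {0..} y * (exp (- a * y) * \<bar>B\<bar>))"
    if "0 \<le> x" "dist x x0 < 1" for x y
  proof (cases "0 \<le> y")
    case True
    have x: "x \<le> x0 + 1" using that by (auto simp: dist_real_def)
    have "a * x \<le> a * (x0 + 1)" using a_pos x by (intro mult_left_mono) auto
    then have e: "exp (a * x) \<le> exp (a * (x0 + 1))" by simp
    have "\<bar>green_kernel x y * g y\<bar> \<le> a * exp (a * x) * (exp (- a * y) * \<bar>g y\<bar>)"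
      by (rule green_kernel_bound[OF that(1) True])
    also have "\<dots> \<le> a * exp (a * (x0 + 1)) * (exp (- a * y) * \<bar>B\<bar>)"
      using e B[of y] a_pos by (intro mult_mono) auto
    finally show ?thesis using True by simp
  qed simp
  then show "\<exists>e>0. \<exists>w. integrable lborel w \<and> (\<forall>x\<in>{0..}. dist x x0 < e \<longrightarrow> (\<forall>y\<in>space lborel. \<bar>indicator {0..} y * (green_kernel x y * g y)\<bar> \<le> w y))"
    using exp_weight_integrable[of "\<lambda>_. \<bar>B\<bar>" "\<bar>B\<bar>"]
    by (intro exI[of _ 1] exI[of _ "\<lambda>y. a * exp (a * (x0 + 1)) * (indicator {0..} y * (exp (- a * y) * \<bar>B\<bar>))"] conjI) auto
qed measurable

end

section \<open>A compactly supported subsolution\<close>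

text \<open>The positive arch of \<open>cos (b y)\<close> around \<open>0\<close>, extended
  by zero; cutting the argument at the first zero gives one formula for all
  \<open>y\<close>.\<close>
definition bump :: "real \<Rightarrow> real \<Rightarrow> real" where
  "bump b y = cos (min (pi / 2) (b * \<bar>y\<bar>))"

text \<open>The bump centred at \<open>y0\<close>, as a constant history of length
  \<open>K\<close>.\<close>
abbreviation bump_window :: "real \<Rightarrow> real \<Rightarrow> real \<Rightarrow> real \<times> real \<Rightarrow> real" where
  "bump_window b K y0 \<equiv> (\<lambda>(s, y). indicator {0<..<K} s * bump b (y - y0))"

lemma bump_range: 
  assumes "0 < b" shows "0 \<le> bump b y" "bump b y \<le> 1"
proof -
  have "0 \<le> min (pi / 2) (b * \<bar>y\<bar>)" using assms by simp
  moreover have "- (pi / 2) \<le> (0 :: real)" by simp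
  ultimately have "- (pi / 2) \<le> min (pi / 2) (b * \<bar>y\<bar>)" by linarith
  then show "0 \<le> bump b y" unfolding bump_def by (intro cos_ge_zero) auto
  show "bump b y \<le> 1" by (simp add: bump_def)
qed

lemma bump_cont: "continuous_on S (\<lambda>x. bump b (g x))" if "continuous_on S g" for S :: "'a :: t2_space set"
  unfolding bump_def by (intro continuous_intros that)

lemma bump_measurable [measurable]: "bump b \<in> borel_measurable borel"
  unfolding bump_def[abs_def] by measurable

lemma bump_inside: "0 < b \<Longrightarrow> \<bar>y\<bar> \<le> pi / (2 * b) \<Longrightarrow> bump b y = cos (b * y)"
proof -
  assume "0 < b" "\<bar>y\<bar> \<le> pi / (2 * b)"
  then have "b * \<bar>y\<bar> \<le> pi / 2" by (simp add: field_simps)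
  then have "bump b y = cos (b * \<bar>y\<bar>)" by (simp add: bump_def min_absorb2)
  also have "\<dots> = cos (b * y)" by (cases "0 \<le> y") auto
  finally show ?thesis .
qed

lemma bump_outside: "0 < b \<Longrightarrow> pi / (2 * b) \<le> \<bar>y\<bar> \<Longrightarrow> bump b y = 0"
proof -
  assume "0 < b" "pi / (2 * b) \<le> \<bar>y\<bar>"
  then have "pi / 2 \<le> b * \<bar>y\<bar>" by (simp add: field_simps)
  then show ?thesis by (simp add: bump_def min_absorb1)
qed

context diffusion
begin

text \<open>Moving the boundary away from \<open>x\<close> by \<open>h\<close> increases the
  kernel: only the image term, which is subtracted, notices it.\<close>
lemma green_translate:
  assumes [measurable]: "g \<in> borel_measurable borel" and B: "\<And>y. \<bar>g y\<bar> \<le> B" and g: "\<And>y. 0 \<le> y \<Longrightarrow> 0 \<le> g y"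
    and h: "0 \<le> h" "h \<le> x"
  shows "green (\<lambda>y. g (y + h)) (x - h) \<le> green g x"
proof -
  let ?E = "\<lambda>x y. green_kernel x y"
  have x: "0 \<le> x" "0 \<le> x - h" using h by auto
  let ?L = "\<lambda>y. indicator {0..} y * (?E (x - h) y * g (y + h))"
  have iL: "integrable lborel ?L" using B x by (intro green_kernel_integrable) auto
  have "green (\<lambda>y. g (y + h)) (x - h) = (\<integral>y. ?L (- h + 1 * y) \<partial>lborel)"
    unfolding green_eq by (subst lborel_integral_real_affine[where c=1 and t="- h"]) auto
  also have "\<dots> \<le> (\<integral>y. indicator {0..} y * (?E x y * g y) \<partial>lborel)"
  proof (rule integral_mono)
    show "integrable lborel (\<lambda>y. ?L (- h + 1 * y))"
      using lborel_integrable_real_affine[OF iL, of 1 "- h"] by simp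
    show "integrable lborel (\<lambda>y. indicator {0..} y * (?E x y * g y))" using B x by (intro green_kernel_integrable) auto
    fix y
    show "?L (- h + 1 * y) \<le> indicator {0..} y * (?E x y * g y)"
    proof (cases "h \<le> y")
      case True
      have "a * (x - h + (y - h)) \<le> a * (x + y)" using a_pos h by (intro mult_left_mono) auto
      then have "?E (x - h) (y - h) \<le> ?E x y"
        using a_pos by (intro mult_left_mono) auto
      then have "?E (x - h) (y - h) * g y \<le> ?E x y * g y" using g True h by (intro mult_right_mono) auto
      then show ?thesis using True h by simp
    next
      case False
      then show ?thesis using g[of y] green_kernel_nonneg[OF x(1), of y] by (simp add: indicator_def)
    qed
  qed
  finally show ?thesis unfolding green_eq .
qed

text \<open>Moving right by \<open>x' - x\<close> is moving the function left, which
  increases it, and then moving the boundary away.\<close>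
lemma green_nondecreasing:
  assumes m[measurable]: "g \<in> borel_measurable borel" and B: "\<And>y. \<bar>g y\<bar> \<le> B" and g: "\<And>y. 0 \<le> y \<Longrightarrow> 0 \<le> g y"
    and mono: "\<And>x y. 0 \<le> x \<Longrightarrow> x \<le> y \<Longrightarrow> g x \<le> g y" and x: "0 \<le> x" "x \<le> x'"
  shows "green g x \<le> green g x'"
proof -
  have "green g x \<le> green (\<lambda>y. g (y + (x' - x))) x"
    using B x mono by (intro green_mono[where B=B and C=B]) auto
  also have "\<dots> \<le> green g x'" using green_translate[OF m B g, of "x' - x" x'] x by simp
  finally show ?thesis .
qed

lemma moment_1: "moment (\<lambda>_. 1) = 1 / a"
proof -
  interpret e: diffusion 1 a by unfold_locales (use a_pos in auto)
  have "(\<integral>y. a * (indicator {0..} y * (exp (- a * y) * 1)) \<partial>lborel) = 1"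
    using e.exp_density_integral[of 0] by (simp add: has_bochner_integral_iff mult.left_commute)
  then show ?thesis using a_pos by (simp add: moment_def field_simps)
qed

lemma green_1: assumes "0 \<le> x" shows "green (\<lambda>_. 1) x = 1 - exp (- a * x)"
proof -
  have I: "integral {0..x} (\<lambda>y. exp (c * y) * 1) = (exp (c * x) - 1) / c" if "c \<noteq> 0" for c
  proof -
    have "((\<lambda>y. exp (c * y)) has_integral exp (c * x) / c - exp (c * 0) / c) {0..x}"
      using assms that by (intro fundamental_theorem_of_calculus)
        (auto intro!: derivative_eq_intros simp: has_real_derivative_iff_has_vector_derivative[symmetric])
    then show ?thesis using that by (simp add: integral_unique diff_divide_distrib)
  qed
  have "green (\<lambda>_. 1) x = a / 2 * (exp (- a * x) * ((exp (a * x) - 1) / a)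
     + exp (a * x) * (1 / a - (exp (- a * x) - 1) / (- a)) - exp (- a * x) * (1 / a))"
    using a_pos assms by (subst green_formula[where B=1]) (auto simp only: I moment_1, auto)
  also have "\<dots> = 1 - exp (- a * x)"
    using a_pos by (simp add: field_simps exp_minus)
  finally show ?thesis .
qed

text \<open>The cosine is an eigenfunction of the Green operator of the line with eigenvalue
  \<open>a\<^sup>2 / (a\<^sup>2 + b\<^sup>2)\<close>. Replacing the negative parts outside
  the first arch by zero adds the term with \<open>cosh\<close>, which is positive.\<close>
lemma line_green_bump:
  assumes b: "0 < b" and x: "\<bar>x\<bar> \<le> pi / (2 * b)"
  shows "has_bochner_integral lborel (\<lambda>y. a / 2 * exp (- a * \<bar>x - y\<bar>) * bump b y)
    ((a\<^sup>2 * cos (b * x) + a * b * exp (- a * (pi / (2 * b))) * cosh (a * x)) / (a\<^sup>2 + b\<^sup>2))"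
proof -
  define l where "l = pi / (2 * b)"
  have l: "0 < l" "b * l = pi / 2" using b by (auto simp: l_def)
  have xl: "- l \<le> x" "x \<le> l" using x by (auto simp: l_def)
  define D where "D = a\<^sup>2 + b\<^sup>2"
  have D: "0 < D" using a_pos by (simp add: D_def add_pos_nonneg)
  have trig: "cos (b * l) = 0" "sin (b * l) = 1" "cos (b * - l) = 0" "sin (b * - l) = - 1" unfolding mult_minus_right l(2) by simp_all
  let ?F1 = "\<lambda>y. exp (- a * x) * (exp (a * y) * (a * cos (b * y) + b * sin (b * y))) / D"
  let ?F2 = "\<lambda>y. exp (a * x) * (exp (- a * y) * (b * sin (b * y) - a * cos (b * y))) / D"
  have 1: "has_bochner_integral lborel (\<lambda>y. exp (- a * x) * (exp (a * y) * cos (b * y)) * indicator {- l..x} y) (?F1 x - ?F1 (- l))"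
  proof (rule has_bochner_integral_FTC_Icc_real[OF xl(1)])
    show "(?F1 has_real_derivative exp (- a * x) * (exp (a * y) * cos (b * y))) (at y)" for y
    proof -
      have "(?F1 has_real_derivative exp (- a * x) * (exp (a * y) * a * (a * cos (b * y) + b * sin (b * y)) + exp (a * y) * (a * (- sin (b * y) * b) + b * (cos (b * y) * b))) / D) (at y)"
        using D by (auto intro!: derivative_eq_intros)
      moreover have "exp (- a * x) * (exp (a * y) * a * (a * cos (b * y) + b * sin (b * y)) + exp (a * y) * (a * (- sin (b * y) * b) + b * (cos (b * y) * b))) 
         = exp (- a * x) * (exp (a * y) * cos (b * y)) * D"
        by (simp add: D_def algebra_simps power2_eq_square)
      moreover have "v * D / D = v" for v using D by simp
      ultimately show ?thesis by (simp only:)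
    qed
  qed (intro continuous_intros)
  have 2: "has_bochner_integral lborel (\<lambda>y. exp (a * x) * (exp (- a * y) * cos (b * y)) * indicator {x..l} y) (?F2 l - ?F2 x)"
  proof (rule has_bochner_integral_FTC_Icc_real[OF xl(2)])
    show "(?F2 has_real_derivative exp (a * x) * (exp (- a * y) * cos (b * y))) (at y)" for y
    proof -
      have "(?F2 has_real_derivative exp (a * x) * (exp (- a * y) * (- a) * (b * sin (b * y) - a * cos (b * y)) + exp (- a * y) * (b * (cos (b * y) * b) - a * (- sin (b * y) * b))) / D) (at y)"
        using D by (auto intro!: derivative_eq_intros)
      moreover have "exp (a * x) * (exp (- a * y) * (- a) * (b * sin (b * y) - a * cos (b * y)) + exp (- a * y) * (b * (cos (b * y) * b) - a * (- sin (b * y) * b))) 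
         = exp (a * x) * (exp (- a * y) * cos (b * y)) * D"
        by (simp add: D_def algebra_simps power2_eq_square)
      moreover have "v * D / D = v" for v using D by simp
      ultimately show ?thesis by (simp only:)
    qed
  qed (intro continuous_intros)
  let ?f = "\<lambda>y. a / 2 * (exp (- a * x) * (exp (a * y) * cos (b * y)) * indicator {- l..x} y + exp (a * x) * (exp (- a * y) * cos (b * y)) * indicator {x..l} y)"
  have "has_bochner_integral lborel ?f (a / 2 * ((?F1 x - ?F1 (- l)) + (?F2 l - ?F2 x)))"
    by (intro has_bochner_integral_mult_right has_bochner_integral_add 1 2)
  also have "a / 2 * ((?F1 x - ?F1 (- l)) + (?F2 l - ?F2 x)) = (a\<^sup>2 * cos (b * x) + a * b * exp (- a * l) * cosh (a * x)) / D"
    unfolding trig using D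
    by (simp add: cosh_field_def field_simps power2_eq_square exp_minus exp_add[symmetric] exp_diff)
  also have "has_bochner_integral lborel ?f ((a\<^sup>2 * cos (b * x) + a * b * exp (- a * l) * cosh (a * x)) / D)
    \<longleftrightarrow> has_bochner_integral lborel (\<lambda>y. a / 2 * exp (- a * \<bar>x - y\<bar>) * bump b y) ((a\<^sup>2 * cos (b * x) + a * b * exp (- a * l) * cosh (a * x)) / D)"
  proof (rule has_bochner_integral_discrete_difference[of "{x}"])
    fix y assume "y \<notin> {x}"
    consider "l < \<bar>y\<bar>" | "\<bar>y\<bar> \<le> l" "y < x" | "\<bar>y\<bar> \<le> l" "x < y" using \<open>y \<notin> {x}\<close> by force
    then show "?f y = a / 2 * exp (- a * \<bar>x - y\<bar>) * bump b y"
    proof cases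
      case 1
      then have "y \<notin> {- l..x}" "y \<notin> {x..l}" using xl by auto
      then show ?thesis using 1 b bump_outside[of b y] by (simp add: l_def)
    next
      case 2
      then have "exp (- a * \<bar>x - y\<bar>) = exp (- a * x) * exp (a * y)" by (simp add: exp_add[symmetric] algebra_simps)
      moreover have "y \<in> {- l..x}" "y \<notin> {x..l}" using 2 by auto
      ultimately show ?thesis using 2(1) b bump_inside[of b y] by (simp add: l_def mult.assoc)
    next
      case 3
      then have "exp (- a * \<bar>x - y\<bar>) = exp (a * x) * exp (- a * y)" by (simp add: exp_add[symmetric] algebra_simps)
      moreover have "y \<in> {x..l}" "y \<notin> {- l..x}" using 3 by auto
      ultimately show ?thesis using 3(1) b bump_inside[of b y] by (simp add: l_def mult.assoc)
    qed
  qed auto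
  finally show ?thesis by (simp add: D_def l_def)
qed

text \<open>On the line the transform of the bump exceeds \<open>a\<^sup>2 / (a\<^sup>2 +
  b\<^sup>2)\<close> times the bump by a fixed positive amount on the support, by
  \<open>line_green_bump\<close>. One half of this gap pays for ages above \<open>K\<close>,
  the other half for the image term, which is exponentially small in the distance to the
  boundary.\<close>
lemma bump_subsolution:
  assumes b: "0 < b"
  obtains K X where "0 < K" "pi / (2 * b) < X"
    "\<And>x y0. X \<le> y0 \<Longrightarrow> 0 \<le> x \<Longrightarrow>
       a\<^sup>2 / (a\<^sup>2 + b\<^sup>2) * bump b (x - y0) \<le> half_int x (bump_window b K y0)"
proof -
  define l where "l = pi / (2 * b)"
  have l: "0 < l" using b by (auto simp: l_def)
  define D where "D = a\<^sup>2 + b\<^sup>2"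
  have D: "0 < D" using a_pos by (simp add: D_def add_pos_nonneg)
  \<comment> \<open>the excess in \<open>line_green_bump\<close> with \<open>cosh\<close>
    replaced by its minimum\<close>
  define gap where "gap = a * b * exp (- a * l) / D"
  have gap: "0 < gap" using a_pos b D by (simp add: gap_def)
  have "((\<lambda>K. exp (- \<mu> * K)) \<longlongrightarrow> 0) at_top" using mu_pos by real_asymp
  from tendsto_zero_ex_less[OF this, of "gap / 2"] gap obtain K where K: "0 < K" "exp (- \<mu> * K) < gap / 2" by auto
  have "((\<lambda>X. exp (- (2 * a) * X)) \<longlongrightarrow> 0) at_top" using a_pos by real_asymp
  then have "((\<lambda>X. a * l * exp (- (2 * a) * X)) \<longlongrightarrow> 0) at_top" by (rule tendsto_mult_right_zero)
  from tendsto_zero_ex_less[OF this, of "gap / 2"] gap obtain X0 where X0: "0 < X0" "a * l * exp (- (2 * a) * X0) < gap / 2" by auto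
  show thesis
  proof
    show "0 < K" by (rule K)
    show "pi / (2 * b) < X0 + l" using X0 by (simp add: l_def)
    fix x y0 :: real assume y0: "X0 + l \<le> y0" and x: "0 \<le> x"
    have nn: "0 \<le> half_int x (bump_window b K y0)"
      using x bump_range(1)[OF b] by (intro half_int_nonneg) auto
    show "a\<^sup>2 / (a\<^sup>2 + b\<^sup>2) * bump b (x - y0) \<le> half_int x (bump_window b K y0)"
    proof (cases "\<bar>x - y0\<bar> \<le> l")
      case False
      then have "bump b (x - y0) = 0" by (intro bump_outside b) (simp add: l_def)
      then show ?thesis using nn by simp
    next
      case True
      let ?p = "\<lambda>y. bump b (y - y0)"
      have pm: "?p \<in> borel_measurable borel" by measurable
      have pb: "\<bar>?p y\<bar> \<le> 1" for y using bump_range[OF b, of "y - y0"] by (simp only: abs_of_nonneg)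
      have bw: "bounded_measurable (\<lambda>(s, y). indicator {0<..<K} s * ?p y)"
        using pb bump_range(1)[OF b] by (intro bounded_measurableI[of _ 1]) (auto simp: indicator_def)
      have bt: "bounded_measurable (\<lambda>(s, y :: real). indicator {K..} s)" by (rule bounded_measurableI[of _ 1]) (auto simp: indicator_def)
      have "green ?p x = half_int x (\<lambda>(s, y). ?p y)" by (rule half_int_green[OF pm pb x, symmetric])
      also have "\<dots> \<le> half_int x (\<lambda>p. (\<lambda>(s, y). indicator {0<..<K} s * ?p y) p + (\<lambda>(s, y). indicator {K..} s) p)"
      proof (rule half_mono[OF x bounded_measurable_space[OF pm pb] bounded_measurable_add[OF bw bt]])
        fix s y :: real assume "0 < s" "0 \<le> y"
        then show "(\<lambda>(s, y). ?p y) (s, y) \<le> (\<lambda>(s, y). indicator {0<..<K} s * ?p y) (s, y) + (\<lambda>(s, y). indicator {K..} s) (s, y)"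
          using bump_range(2)[OF b, of "y - y0"] by (cases "s < K") auto
      qed
      also have "\<dots> \<le> half_int x (\<lambda>(s, y). indicator {0<..<K} s * ?p y) + exp (- \<mu> * K)"
        using half_int_tail[OF x, of K] K(1) by (simp add: half_add[OF x bw bt])
      finally have g1: "green ?p x \<le> half_int x (\<lambda>(s, y). indicator {0<..<K} s * ?p y) + gap / 2" using K(2) by linarith
      let ?J = "\<lambda>y. a / 2 * exp (- a * \<bar>(x - y0) - (y - y0)\<bar>) * bump b (y - y0)"
      define V where "V = (a\<^sup>2 * cos (b * (x - y0)) + a * b * exp (- a * l) * cosh (a * (x - y0))) / D"
      have J: "has_bochner_integral lborel ?J V"
        using lborel_has_bochner_integral_real_affine_iff[of 1 "\<lambda>y. a / 2 * exp (- a * \<bar>(x - y0) - y\<bar>) * bump b y" V "- y0"]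
          line_green_bump[OF b, of "x - y0"] True by (simp add: V_def D_def l_def)
      let ?I = "\<lambda>y. a / 2 * exp (- (2 * a) * X0) * indicator {y0 - l..y0 + l} y"
      have I: "has_bochner_integral lborel ?I (a / 2 * exp (- (2 * a) * X0) * (2 * l))"
      proof (rule has_bochner_integral_mult_right)
        show "has_bochner_integral lborel (indicator {y0 - l..y0 + l}) (2 * l)"
          using l has_bochner_integral_real_indicator[of "{y0 - l..y0 + l}" lborel] by (simp add: measure_def)
      qed
      have "V - a / 2 * exp (- (2 * a) * X0) * (2 * l) = (\<integral>y. ?J y - ?I y \<partial>lborel)"
        using has_bochner_integral_diff[OF J I] by (simp add: has_bochner_integral_iff)
      also have "\<dots> \<le> green ?p x"
        unfolding green_eq
      proof (rule integral_mono)
        show "integrable lborel (\<lambda>y. ?J y - ?I y)"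
          using has_bochner_integral_diff[OF J I] by (simp add: has_bochner_integral_iff)
        show "integrable lborel (\<lambda>y. indicator {0..} y * (green_kernel x y * ?p y))"
          by (rule green_kernel_integrable[OF pm pb x])
        fix y
        show "?J y - ?I y \<le> indicator {0..} y * (green_kernel x y * ?p y)"
        proof (cases "\<bar>y - y0\<bar> \<le> l")
          case False
          then have "?p y = 0" by (intro bump_outside b) (simp add: l_def)
          then show ?thesis using a_pos by simp
        next
          case y: True
          have y': "0 \<le> y" "y \<in> {y0 - l..y0 + l}" using y y0 X0 by auto
          have "a * (2 * X0) \<le> a * (x + y)" using True y y0 a_pos by (intro mult_left_mono) auto
          then have "exp (- a * (x + y)) * ?p y \<le> exp (- (2 * a) * X0) * 1"
            using bump_range[OF b] by (intro mult_mono) auto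
          then have "a / 2 * (exp (- a * (x + y)) * ?p y) \<le> a / 2 * exp (- (2 * a) * X0)"
            using a_pos by simp
          then show ?thesis using y' by (simp add: algebra_simps)
        qed
      qed
      finally have g2: "V - gap / 2 \<le> green ?p x" using X0(2) by (simp add: mult.commute mult.left_commute)
      have "1 \<le> cosh (a * (x - y0))" by (rule cosh_real_ge_1)
      then have "a * b * exp (- a * l) * 1 \<le> a * b * exp (- a * l) * cosh (a * (x - y0))"
        using a_pos b by (intro mult_left_mono) auto
      then have "a\<^sup>2 / D * cos (b * (x - y0)) + gap \<le> V"
        using D by (simp add: V_def gap_def add_divide_distrib[symmetric] divide_right_mono)
      moreover have "bump b (x - y0) = cos (b * (x - y0))" using True by (intro bump_inside b) (simp add: l_def)
      ultimately show ?thesis using g1 g2 by (simp add: D_def)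
    qed
  qed
qed

end

section \<open>Steady states\<close>

text \<open>Polya's argument: monotone functions that are close to a continuous monotone
  limit at the points of a finite grid are close everywhere, if the grid is fine and reaches
  the region where the limit is close to the common upper bound.\<close>
lemma monotone_uniform_approx:
  fixes v :: "nat \<Rightarrow> real \<Rightarrow> real"
  assumes mono: "\<And>n x y. 0 \<le> x \<Longrightarrow> x \<le> y \<Longrightarrow> v n x \<le> v n y" and Wmono: "\<And>x y. 0 \<le> x \<Longrightarrow> x \<le> y \<Longrightarrow> W x \<le> W y"
    and lim: "\<And>x. 0 \<le> x \<Longrightarrow> (\<lambda>n. v n x) \<longlonglongrightarrow> W x"
    and le: "\<And>n x. v n x \<le> L" "\<And>x. W x \<le> L" and top: "(W \<longlongrightarrow> L) at_top" and cont: "continuous_on {0..} W" and \<eta>: "0 < \<eta>"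
  shows "\<exists>n. \<forall>x\<ge>0. \<bar>v n x - W x\<bar> \<le> \<eta>"
proof -
  have "\<forall>\<^sub>F x in at_top. L - \<eta> / 2 < W x" using top \<eta> by (intro order_tendstoD(1)) auto
  then obtain R0 where R0: "\<forall>x\<ge>R0. L - \<eta> / 2 < W x" by (auto simp: eventually_at_top_linorder)
  define R where "R = max R0 1"
  have R: "0 < R" "L - \<eta> / 2 < W R" using R0 by (auto simp: R_def)
  have "uniformly_continuous_on {0..R + 1} W"
    by (intro compact_uniformly_continuous continuous_on_subset[OF cont]) auto
  then obtain \<delta>0 where \<delta>0: "0 < \<delta>0" "\<forall>x\<in>{0..R + 1}. \<forall>y\<in>{0..R + 1}. dist y x < \<delta>0 \<longrightarrow> dist (W y) (W x) < \<eta> / 2"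
    unfolding uniformly_continuous_on_def using \<eta> half_gt_zero by meson
  define \<delta> where "\<delta> = min 1 (\<delta>0 / 2)"
  have \<delta>: "0 < \<delta>" "\<delta> \<le> 1" "\<delta> < \<delta>0" using \<delta>0(1) by (auto simp: \<delta>_def min_def)
  define N where "N = nat \<lceil>R / \<delta>\<rceil>"
  have "R / \<delta> \<le> real N" unfolding N_def by linarith
  then have N: "R \<le> real N * \<delta>" using \<delta> by (simp add: field_simps)
  have "real N < R / \<delta> + 1" unfolding N_def using R(1) \<delta>(1) by (simp add: of_nat_ceiling) linarith
  then have N2: "real N * \<delta> \<le> R + \<delta>" using \<delta> by (simp add: field_simps)
  have "\<forall>\<^sub>F n in sequentially. \<forall>i\<in>{..N}. dist (v n (real i * \<delta>)) (W (real i * \<delta>)) < \<eta> / 2"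
    using lim \<eta> \<delta> by (intro eventually_ball_finite ballI tendstoD) auto
  then obtain n where n: "\<forall>i\<in>{..N}. dist (v n (real i * \<delta>)) (W (real i * \<delta>)) < \<eta> / 2"
    by (auto simp: eventually_sequentially)
  have "\<bar>v n x - W x\<bar> \<le> \<eta>" if x: "0 \<le> x" for x
  proof (cases "x < real N * \<delta>")
    case True
    define i where "i = nat \<lfloor>x / \<delta>\<rfloor>"
    have "real i \<le> x / \<delta>" "x / \<delta> < real i + 1" using x \<delta>(1) by (auto simp: i_def)
    then have i: "real i * \<delta> \<le> x" "x \<le> real (Suc i) * \<delta>" using \<delta>(1) by (auto simp: field_simps)
    have "real i * \<delta> < real N * \<delta>" using i(1) True by linarith
    then have iN: "i < N" using \<delta>(1) by simp
    then have "real (Suc i) * \<delta> \<le> real N * \<delta>" using \<delta>(1) by (intro mult_right_mono) auto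
    then have up: "real (Suc i) * \<delta> \<le> R + 1" using N2 \<delta> by linarith
    have diff: "real (Suc i) * \<delta> - real i * \<delta> = \<delta>" by (simp add: algebra_simps)
    have i0: "0 \<le> real i * \<delta>" using \<delta> by simp
    have "dist (real (Suc i) * \<delta>) (real i * \<delta>) < \<delta>0" using diff \<delta> by (simp only: dist_real_def)
    then have "dist (W (real (Suc i) * \<delta>)) (W (real i * \<delta>)) < \<eta> / 2"
      using \<delta>0(2) up i0 diff \<delta> by (intro \<delta>0(2)[rule_format]) auto
    then have W: "W (real (Suc i) * \<delta>) < W (real i * \<delta>) + \<eta> / 2" unfolding dist_real_def abs_less_iff by linarith
    have "dist (v n (real i * \<delta>)) (W (real i * \<delta>)) < \<eta> / 2" "dist (v n (real (Suc i) * \<delta>)) (W (real (Suc i) * \<delta>)) < \<eta> / 2"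
      by (rule n[rule_format], use iN in simp)+
    then have V: "W (real i * \<delta>) - \<eta> / 2 < v n (real i * \<delta>)" "v n (real (Suc i) * \<delta>) < W (real (Suc i) * \<delta>) + \<eta> / 2"
      unfolding dist_real_def abs_less_iff by linarith+
    show ?thesis
      using mono[OF i0 i(1), of n] mono[OF x i(2), of n] Wmono[OF i0 i(1)] Wmono[OF x i(2)] V W unfolding abs_le_iff by linarith
  next
    case False
    then have xN: "real N * \<delta> \<le> x" by simp
    have N0: "0 \<le> real N * \<delta>" using \<delta> by simp
    have "dist (v n (real N * \<delta>)) (W (real N * \<delta>)) < \<eta> / 2" using n by auto
    then have "W (real N * \<delta>) - \<eta> / 2 < v n (real N * \<delta>)" unfolding dist_real_def abs_less_iff by linarith
    moreover have "W R \<le> W (real N * \<delta>)" using N R by (intro Wmono) auto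
    ultimately show ?thesis
      using mono[OF N0 xN, of n] Wmono[OF N0 xN] le(1)[of n x] le(2)[of x] R(2) unfolding abs_le_iff by linarith
  qed
  then show ?thesis by (intro exI[of _ n]) simp
qed

context kinetics
begin

definition admissible :: "(real \<Rightarrow> real) \<Rightarrow> bool" where
  "admissible w \<longleftrightarrow> w \<in> borel_measurable borel \<and> (\<forall>x. 0 \<le> w x \<and> w x \<le> ustar)"

text \<open>A steady state solves \<open>W = green (f \<circ> W)\<close>. Clamping the
  argument makes the result nonnegative on all reals, so that functions on the half-line are
  represented by total functions that are constant on the negative axis.\<close>
definition step :: "(real \<Rightarrow> real) \<Rightarrow> real \<Rightarrow> real" where
  "step w x = green (\<lambda>y. f (w y)) (max 0 x)"

lemma adm_f:
  assumes "admissible w"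
  shows "(\<lambda>y. f (w y)) \<in> borel_measurable borel" "\<And>y. \<bar>f (w y)\<bar> \<le> ustar" "\<And>y. 0 \<le> f (w y)"
proof -
  show "(\<lambda>y. f (w y)) \<in> borel_measurable borel" using assms by (intro f_comp_measurable) (auto simp: admissible_def)
  show 0: "0 \<le> f (w y)" for y using assms by (intro f_nonneg) (auto simp: admissible_def)
  have "f (w y) \<le> f ustar" for y using assms by (intro f_mono) (auto simp: admissible_def)
  with 0 show "\<bar>f (w y)\<bar> \<le> ustar" for y by (simp add: f_ustar)
qed

lemma adm_step: assumes "admissible w" shows "admissible (step w)"
proof -
  note F = adm_f[OF assms]
  have "step w \<in> borel_measurable borel"
    unfolding step_def[abs_def] by (rule measurable_compose[OF _ green_measurable[OF F(1)]]) simp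
  then show ?thesis using green_nonneg[OF _ F(3)] green_le[OF F(1,2)] by (auto simp: admissible_def step_def)
qed

lemma adm_const: "admissible (\<lambda>_. ustar)"
  using ustar_pos by (auto simp: admissible_def)

lemma step_mono:
  assumes "admissible v" "admissible w" "\<And>x. 0 \<le> x \<Longrightarrow> v x \<le> w x"
  shows "step v x \<le> step w x"
  unfolding step_def
  by (rule green_mono[OF adm_f(1,2)[OF assms(1)] adm_f(1,2)[OF assms(2)]])
     (use assms in \<open>auto intro!: f_mono simp: admissible_def\<close>)

lemma step_nondecreasing:
  assumes "admissible w" "\<And>x y. 0 \<le> x \<Longrightarrow> x \<le> y \<Longrightarrow> w x \<le> w y" "0 \<le> x" "x \<le> y"
  shows "step w x \<le> step w y"
  unfolding step_def
  by (rule green_nondecreasing[OF adm_f(1,2)[OF assms(1)]])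
     (use assms in \<open>auto intro!: f_mono f_nonneg simp: admissible_def\<close>)

lemma step_tendsto:
  assumes w: "\<And>n. admissible (w n)" and W: "admissible W" and lim: "\<And>x. 0 \<le> x \<Longrightarrow> (\<lambda>n. w n x) \<longlonglongrightarrow> W x"
  shows "(\<lambda>n. step (w n) x) \<longlonglongrightarrow> step W x"
  unfolding step_def green_eq
proof (rule integral_dominated_convergence)
  let ?E = "\<lambda>y. green_kernel (max 0 x) y"
  note [measurable] = adm_f(1)[OF w] adm_f(1)[OF W]
  show "(\<lambda>y. indicator {0..} y * (?E y * f (W y))) \<in> borel_measurable lborel" by measurable
  show "(\<lambda>y. indicator {0..} y * (?E y * f (w n y))) \<in> borel_measurable lborel" for n by measurable
  show "integrable lborel (\<lambda>y. indicator {0..} y * (?E y * ustar))"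
    using ustar_pos by (intro green_kernel_integrable[of _ ustar]) auto
  show "AE y in lborel. norm (indicator {0..} y * (?E y * f (w n y))) \<le> indicator {0..} y * (?E y * ustar)" for n
  proof (rule AE_I2)
    fix y show "norm (indicator {0..} y * (?E y * f (w n y))) \<le> indicator {0..} y * (?E y * ustar)"
    proof (cases "0 \<le> y")
      case True
      then have E: "0 \<le> ?E y" by (intro green_kernel_nonneg) auto
      have "\<bar>?E y * f (w n y)\<bar> = ?E y * \<bar>f (w n y)\<bar>" by (simp only: abs_mult[of "?E y" "f (w n y)"] abs_of_nonneg[OF E])
      also have "\<dots> \<le> ?E y * ustar" by (rule mult_left_mono[OF adm_f(2)[OF w, of n y] E])
      finally show ?thesis using True by simp
    qed simp
  qed
  show "AE y in lborel. (\<lambda>n. indicator {0..} y * (?E y * f (w n y))) \<longlonglongrightarrow> indicator {0..} y * (?E y * f (W y))"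
  proof (rule AE_I2)
    fix y show "(\<lambda>n. indicator {0..} y * (?E y * f (w n y))) \<longlonglongrightarrow> indicator {0..} y * (?E y * f (W y))"
    proof (cases "0 \<le> y")
      case True
      have "(\<lambda>n. f (w n y)) \<longlonglongrightarrow> f (W y)"
        using lim[OF True] w W by (intro continuous_on_tendsto_compose[OF f_cont]) (auto simp: admissible_def)
      then show ?thesis by (intro tendsto_intros)
    qed simp
  qed
qed

definition steady :: "(real \<Rightarrow> real) \<Rightarrow> bool" where
  "steady W \<longleftrightarrow> admissible W \<and> step W = W"

lemma steady_cont:
  assumes "steady W"
  shows "continuous_on UNIV W" "continuous_on UNIV (\<lambda>y. f (W y))"
proof -
  have A: "admissible W" and W: "W = step W" using assms by (auto simp: steady_def)
  have "continuous_on UNIV (\<lambda>x. green (\<lambda>y. f (W y)) (max 0 x))"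
    by (rule continuous_on_compose2[OF green_cont[OF adm_f(1,2)[OF A]]]) (auto intro!: continuous_intros)
  then show "continuous_on UNIV W" by (subst W) (simp add: step_def[abs_def])
  then show "continuous_on UNIV (\<lambda>y. f (W y))" using A by (intro f_comp_continuous) (auto simp: admissible_def)
qed

lemma steady_0: "steady W \<Longrightarrow> W 0 = 0"
  by (metis steady_def step_def green_0 max.idem)

lemma steady_deriv:
  assumes "steady W" "0 < x"
  shows "(W has_real_derivative green' (\<lambda>y. f (W y)) x) (at x)"
    and "(green' (\<lambda>y. f (W y)) has_real_derivative a\<^sup>2 * (W x - f (W x))) (at x)"
proof -
  have A: "admissible W" and W: "\<And>x. W x = step W x" using assms by (auto simp: steady_def)
  note c = steady_cont(2)[OF assms(1)] adm_f(2)[OF A]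
  have e: "green (\<lambda>y. f (W y)) z = W z" if "0 \<le> z" for z using W[of z] that by (simp add: step_def)
  show "(W has_real_derivative green' (\<lambda>y. f (W y)) x) (at x)"
    using green_deriv[OF c assms(2)]
    by (rule has_field_derivative_transform_within[where d=x]) (use assms(2) in \<open>auto simp: dist_real_def e\<close>)
  show "(green' (\<lambda>y. f (W y)) has_real_derivative a\<^sup>2 * (W x - f (W x))) (at x)"
    using green'_deriv[OF c assms(2)] assms(2) by (simp add: e)
qed

text \<open>Far from the boundary the Green operator nearly preserves constants, so the
  limit \<open>l\<close> of a nondecreasing steady state satisfies \<open>f l \<le>
  l\<close>; below \<open>ustar\<close> this is only possible at \<open>0\<close>.\<close>
lemma steady_limit:
  assumes W: "steady W" and mono: "\<And>x y. 0 \<le> x \<Longrightarrow> x \<le> y \<Longrightarrow> W x \<le> W y" and nt: "0 < W z" "0 \<le> z"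
  shows "(W \<longlongrightarrow> ustar) at_top"
proof -
  have A: "admissible W" and fix_eq: "\<And>x. W x = step W x" using W by (auto simp: steady_def)
  have bnd: "0 \<le> W x" "W x \<le> ustar" for x using A by (auto simp: admissible_def)
  define l where "l = Sup (W ` {0..})"
  have bdd: "bdd_above (W ` {0..})" using bnd by (intro bdd_aboveI2) auto
  have le_l: "W x \<le> l" if "0 \<le> x" for x unfolding l_def using bdd that by (intro cSUP_upper) auto
  have l: "0 < l" "l \<le> ustar" using le_l[OF nt(2)] nt bnd by (auto simp: l_def intro!: cSUP_least)
  have lim: "(W \<longlongrightarrow> l) at_top"
  proof (rule order_tendstoI)
    fix c assume "c < l"
    then obtain x0 where "0 \<le> x0" "c < W x0" using less_cSUP_iff[OF _ bdd, of c] by (auto simp: l_def)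
    then show "\<forall>\<^sub>F x in at_top. c < W x"
      by (intro eventually_mono[OF eventually_ge_at_top[of x0]]) (use mono in \<open>force intro: less_le_trans\<close>)
  next
    fix c assume "l < c"
    then show "\<forall>\<^sub>F x in at_top. W x < c"
      by (intro eventually_mono[OF eventually_ge_at_top[of 0]]) (use le_l in \<open>force intro: le_less_trans\<close>)
  qed
  have "f (W R) \<le> l" if R: "0 \<le> R" for R
  proof (rule tendsto_upperbound)
    have "((\<lambda>x. 1 - exp (- a * (x - R))) \<longlongrightarrow> 1) at_top" using a_pos by real_asymp
    then show "((\<lambda>x. f (W R) * (1 - exp (- a * (x - R)))) \<longlongrightarrow> f (W R)) at_top"
      using tendsto_mult_left[of _ 1 at_top "f (W R)"] by simp
    have "f (W R) * (1 - exp (- a * (x - R))) \<le> l" if x: "R \<le> x" for x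
    proof -
      have "f (W R) * (1 - exp (- a * (x - R))) = f (W R) * green (\<lambda>_. 1) (x - R)" using green_1[of "x - R"] x by simp
      also have "\<dots> = green (\<lambda>_. f (W R)) (x - R)"
        unfolding green_eq by (simp flip: integral_mult_right_zero add: mult_ac)
      also have "\<dots> \<le> green (\<lambda>y. f (W (y + R))) (x - R)"
        using adm_f[OF A] x R mono bnd
        by (intro green_mono[where B=ustar and C=ustar] measurable_compose[OF _ adm_f(1)[OF A]]) (auto intro!: f_mono)
      also have "\<dots> \<le> green (\<lambda>y. f (W y)) x"
        by (rule green_translate[OF adm_f[OF A] R x])
      also have "\<dots> = W x" using fix_eq[of x] x R by (simp add: step_def)
      also have "\<dots> \<le> l" using x R by (intro le_l) auto
      finally show ?thesis .
    qed
    then show "\<forall>\<^sub>F x in at_top. f (W R) * (1 - exp (- a * (x - R))) \<le> l"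
      by (intro eventually_mono[OF eventually_ge_at_top[of R]]) auto
  qed simp
  moreover have "((\<lambda>R. f (W R)) \<longlongrightarrow> f l) at_top"
    using lim bnd l by (intro continuous_on_tendsto_compose[OF f_cont]) auto
  ultimately have "f l \<le> l"
    by (intro tendsto_upperbound[of _ "f l" at_top]) (auto intro!: eventually_mono[OF eventually_ge_at_top[of 0]])
  then have "l = ustar" using f_above[of l] l by force
  with lim show ?thesis by simp
qed

text \<open>The lower limit \<open>-1\<close> makes \<open>0\<close> an interior point,
  where the derivative is two-sided.\<close>
definition primitive :: "real \<Rightarrow> real" where
  "primitive v = integral {-1..v} (\<lambda>w. f (max 0 w))"

lemma primitive_deriv: assumes "0 \<le> v" shows "(primitive has_real_derivative f v) (at v)"
proof -
  have c: "continuous_on UNIV (\<lambda>w. f (max 0 w))" by (intro f_comp_continuous continuous_intros) auto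
  have "(primitive has_real_derivative f (max 0 v)) (at v within {-1..v + 1})"
    unfolding primitive_def[abs_def] using assms by (intro integral_has_real_derivative continuous_on_subset[OF c]) auto
  moreover have "at v within {-1..v + 1} = at v" using assms by (intro at_within_interior) auto
  ultimately show ?thesis using assms by simp
qed

text \<open>The energy \<open>d W'\<^sup>2 / 2 - \<mu> W\<^sup>2 / 2 + \<mu> F(W)\<close>,
  \<open>F\<close> a primitive of \<open>f\<close>, is constant. Its value at infinity
  depends only on \<open>ustar\<close>, since \<open>W\<close> tends to \<open>ustar\<close>
  and \<open>W'\<close> to zero along a sequence; its value at the origin depends only on
  the slope there.\<close>
lemma steady_slope:
  assumes W: "steady W" and top: "(W \<longlongrightarrow> ustar) at_top"
  shows "d / 2 * (a\<^sup>2 * moment (\<lambda>y. f (W y)))\<^sup>2 = \<mu> * (primitive ustar - primitive 0) - \<mu> / 2 * ustar\<^sup>2"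
proof -
  have A: "admissible W" using W by (auto simp: steady_def)
  have bnd: "0 \<le> W x" for x using A by (auto simp: admissible_def)
  let ?W' = "green' (\<lambda>y. f (W y))"
  define E where "E x = d / 2 * (?W' x)\<^sup>2 - \<mu> / 2 * (W x)\<^sup>2 + \<mu> * primitive (W x)" for x
  have dE: "(E has_real_derivative 0) (at x)" if "0 < x" for x
  proof -
    note D = steady_deriv[OF W that]
    have "(E has_real_derivative d / 2 * (2 * ?W' x * (a\<^sup>2 * (W x - f (W x)))) - \<mu> / 2 * (2 * W x * ?W' x) + \<mu> * (f (W x) * ?W' x)) (at x)"
      unfolding E_def[abs_def]
      by (rule derivative_eq_intros D DERIV_chain2[where f=primitive and g=W, OF primitive_deriv[OF bnd] D(1)] refl | simp)+
    moreover have "d / 2 * (2 * ?W' x * (a\<^sup>2 * (W x - f (W x)))) = ?W' x * (d * a\<^sup>2) * (W x - f (W x))" by simp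
    ultimately show ?thesis unfolding a_sq by (simp add: algebra_simps)
  qed
  have "\<exists>c. \<forall>x\<in>{0<..}. E x = c"
    by (rule has_field_derivative_zero_constant) (auto intro: has_field_derivative_at_within dE)
  then obtain c where c: "\<And>x. 0 < x \<Longrightarrow> E x = c" by auto
  have primitive_cont: "continuous_on {0..} primitive"
    by (intro continuous_at_imp_continuous_on ballI DERIV_isCont[OF primitive_deriv]) auto
  have "(W \<longlongrightarrow> W 0) (at_right 0)"
    using steady_cont(1)[OF W] by (auto simp: continuous_on_def intro: tendsto_within_subset)
  then have W0: "(W \<longlongrightarrow> 0) (at_right 0)" using steady_0[OF W] by simp
  have "(E \<longlongrightarrow> d / 2 * (a\<^sup>2 * moment (\<lambda>y. f (W y)))\<^sup>2 - \<mu> / 2 * 0\<^sup>2 + \<mu> * primitive 0) (at_right 0)"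
    unfolding E_def[abs_def]
    by (intro tendsto_intros green'_tendsto_0 steady_cont(2)[OF W] W0 continuous_on_tendsto_compose[OF primitive_cont W0])
       (auto simp: bnd)
  moreover have "(E \<longlongrightarrow> c) (at_right 0)"
    by (rule tendsto_eventually) (auto simp: eventually_at_filter c)
  ultimately have c0: "c = d / 2 * (a\<^sup>2 * moment (\<lambda>y. f (W y)))\<^sup>2 + \<mu> * primitive 0"
    using tendsto_unique[of "at_right (0::real)"] by fastforce
  \<comment> \<open>\<open>W'\<close> tends to zero along a sequence of mean values\<close>
  have "\<exists>z>real n + 1. z < real n + 1 + 1 \<and> W (real n + 1 + 1) - W (real n + 1) = (real n + 1 + 1 - (real n + 1)) * ?W' z" for n
    by (rule MVT2) (auto intro!: steady_deriv(1)[OF W])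
  then have "\<forall>n. \<exists>z>real n + 1. ?W' z = W (real n + 2) - W (real n + 1)" by (force simp: add.assoc)
  then obtain z where z: "\<And>n. real n + 1 < z n" "\<And>n. ?W' (z n) = W (real n + 2) - W (real n + 1)"
    by (auto dest!: choice)
  have top1: "filterlim (\<lambda>n. real n + c) at_top sequentially" for c
    by (rule filterlim_tendsto_add_at_top[OF tendsto_const filterlim_real_sequentially, THEN filterlim_cong[THEN iffD1, rotated -1]]) (auto simp: add.commute)
  have ztop: "filterlim z at_top sequentially"
    by (rule filterlim_at_top_mono[OF top1[of 1]]) (use z(1) in \<open>auto intro!: always_eventually less_imp_le\<close>)
  have Wz: "(\<lambda>n. W (z n)) \<longlonglongrightarrow> ustar" by (rule filterlim_compose[OF top ztop])
  have W'z: "(\<lambda>n. ?W' (z n)) \<longlonglongrightarrow> ustar - ustar"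
    unfolding z(2) by (intro tendsto_diff filterlim_compose[OF top top1])
  have "(\<lambda>n. E (z n)) \<longlonglongrightarrow> d / 2 * (ustar - ustar)\<^sup>2 - \<mu> / 2 * ustar\<^sup>2 + \<mu> * primitive ustar"
    unfolding E_def[abs_def]
    by (intro tendsto_intros W'z Wz continuous_on_tendsto_compose[OF primitive_cont Wz]) (use ustar_pos bnd in auto)
  moreover have "E (z n) = c" for n using z(1)[of n] by (intro c) linarith
  ultimately have "c = - \<mu> / 2 * ustar\<^sup>2 + \<mu> * primitive ustar"
    using LIMSEQ_unique[OF tendsto_const, of c] by fastforce
  with c0 show ?thesis by (simp add: algebra_simps)
qed

text \<open>Equal slopes at the origin mean that \<open>f \<circ> V\<close> and \<open>f
  \<circ> W\<close> have the same integral against a positive weight. Being ordered they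
  agree almost everywhere, and \<open>V\<close> and \<open>W\<close> are their images under
  the Green operator.\<close>
lemma steady_unique:
  assumes V: "steady V" "(V \<longlongrightarrow> ustar) at_top" and W: "steady W" "(W \<longlongrightarrow> ustar) at_top"
    and le: "\<And>x. 0 \<le> x \<Longrightarrow> V x \<le> W x"
  shows "V = W"
proof -
  have A: "admissible V" "admissible W" using V W by (auto simp: steady_def)
  have bnd: "0 \<le> V x" for x using A by (auto simp: admissible_def)
  let ?m = "\<lambda>w. moment (\<lambda>y. f (w y))"
  have i: "integrable lborel (\<lambda>y. indicator {0..} y * (exp (- a * y) * f (w y)))" if "admissible w" for w
    by (rule exp_weight_integrable[OF adm_f(1,2)[OF that]])
  have m0: "0 \<le> ?m w" if "admissible w" for w
    unfolding moment_def using adm_f(3)[OF that] by (intro integral_nonneg_AE) auto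
  have "d / 2 * (a\<^sup>2 * ?m V)\<^sup>2 = d / 2 * (a\<^sup>2 * ?m W)\<^sup>2"
    by (simp only: steady_slope[OF V] steady_slope[OF W])
  then have "(a\<^sup>2 * ?m V)\<^sup>2 = (a\<^sup>2 * ?m W)\<^sup>2" using d_pos by simp
  moreover have "0 \<le> a\<^sup>2 * ?m V" "0 \<le> a\<^sup>2 * ?m W" using m0[OF A(1)] m0[OF A(2)] by simp_all
  ultimately have "a\<^sup>2 * ?m V = a\<^sup>2 * ?m W" by (rule power2_eq_imp_eq)
  then have eq: "?m V = ?m W" using a_pos by simp
  let ?D = "\<lambda>y. indicator {0..} y * (exp (- a * y) * f (W y)) - indicator {0..} y * (exp (- a * y) * f (V y))"
  have "integral\<^sup>L lborel ?D = ?m W - ?m V"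
    unfolding moment_def by (rule Bochner_Integration.integral_diff[OF i[OF A(2)] i[OF A(1)]])
  then have D0: "integral\<^sup>L lborel ?D = 0" by (simp only: eq diff_self)
  have Di: "integrable lborel ?D" by (rule Bochner_Integration.integrable_diff[OF i[OF A(2)] i[OF A(1)]])
  have fle: "0 \<le> y \<Longrightarrow> f (V y) \<le> f (W y)" for y using le bnd by (intro f_mono)
  have Dn: "AE y in lborel. 0 \<le> ?D y"
  proof (rule AE_I2)
    fix y show "0 \<le> ?D y" using fle[of y] by (cases "0 \<le> y") auto
  qed
  have "AE y in lborel. ?D y = 0" using integral_nonneg_eq_0_iff_AE[OF Di Dn] D0 by (rule iffD1)
  then have ae: "AE y in lborel. 0 \<le> y \<longrightarrow> f (V y) = f (W y)"
  proof (rule AE_mp, intro AE_I2 impI)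
    fix y :: real assume "?D y = 0" "0 \<le> y"
    then show "f (V y) = f (W y)" by simp
  qed
  have "step V x = step W x" for x
    unfolding step_def green_eq
  proof (rule integral_cong_AE)
    note [measurable] = adm_f(1)[OF A(1)] adm_f(1)[OF A(2)]
    let ?E = "\<lambda>y. green_kernel (max 0 x) y"
    show "(\<lambda>y. indicator {0..} y * (?E y * f (V y))) \<in> borel_measurable lborel" by measurable
    show "(\<lambda>y. indicator {0..} y * (?E y * f (W y))) \<in> borel_measurable lborel" by measurable
    show "AE y in lborel. indicator {0..} y * (?E y * f (V y)) = indicator {0..} y * (?E y * f (W y))"
    proof (rule AE_mp[OF ae], intro AE_I2 impI)
      fix y assume "0 \<le> y \<longrightarrow> f (V y) = f (W y)"
      then show "indicator {0..} y * (?E y * f (V y)) = indicator {0..} y * (?E y * f (W y))" by (cases "0 \<le> y") simp_all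
    qed
  qed
  then have "step V = step W" by (rule ext)
  then show ?thesis using V(1) W(1) by (simp add: steady_def)
qed

text \<open>The difference \<open>U\<close> of a classical steady state and its transform
  solves \<open>U'' = a\<^sup>2 U\<close>, is bounded and vanishes at the origin, hence is
  zero. The supremum \<open>B\<close> of the steady state then satisfies \<open>B \<le> f
  B\<close>, that is \<open>B \<le> ustar\<close>.\<close>
lemma classical_imp_steady:
  assumes V: "connecting_steady_state d \<mu> f ustar V"
  shows "steady (\<lambda>x. V (max 0 x))"
proof -
  from V obtain V' V'' where cont: "continuous_on {0..} V" and nn: "\<And>x. 0 \<le> x \<Longrightarrow> 0 \<le> V x" and V0: "V 0 = 0"
    and D: "\<And>x. 0 < x \<Longrightarrow> (V has_real_derivative V' x) (at x)" "\<And>x. 0 < x \<Longrightarrow> (V' has_real_derivative V'' x) (at x)"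
       "\<And>x. 0 < x \<Longrightarrow> d * V'' x - \<mu> * V x + \<mu> * f (V x) = 0"
    and top: "(V \<longlongrightarrow> ustar) at_top"
    unfolding connecting_steady_state_def dirichlet_steady_state_def by blast
  define v where "v x = V (max 0 x)" for x
  have vc: "continuous_on UNIV v" unfolding v_def[abs_def]
    by (intro continuous_on_compose2[OF cont]) (auto intro!: continuous_intros)
  have v0: "0 \<le> v x" for x by (simp add: v_def nn)
  have "\<forall>\<^sub>F x in at_top. V x < ustar + 1" using top by (rule order_tendstoD) simp
  then obtain R where R: "\<forall>x\<ge>R. V x < ustar + 1" by (auto simp: eventually_at_top_linorder)
  have "bounded (V ` {0..max 0 R})" by (intro compact_imp_bounded compact_continuous_image continuous_on_subset[OF cont]) auto
  then obtain B0 where B0: "\<forall>x\<in>{0..max 0 R}. \<bar>V x\<bar> \<le> B0" by (auto simp: bounded_iff)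
  have vle: "v x \<le> max B0 (ustar + 1)" for x
  proof (cases "max 0 x \<le> max 0 R")
    case True
    then have "\<bar>V (max 0 x)\<bar> \<le> B0" using B0 by auto
    then show ?thesis by (simp add: v_def)
  next
    case False
    then have "R \<le> max 0 x" by linarith
    then have "V (max 0 x) < ustar + 1" using R by blast
    then show ?thesis by (simp add: v_def)
  qed
  define B where "B = Sup (range v)"
  have bdd: "bdd_above (range v)" using vle by (intro bdd_aboveI2) auto
  have vB: "v x \<le> B" for x unfolding B_def using bdd by (intro cSUP_upper) auto
  have B: "0 \<le> B" using v0[of 0] vB[of 0] by linarith
  let ?g = "\<lambda>y. f (v y)"
  have gc: "continuous_on UNIV ?g" using vc v0 by (rule f_comp_continuous)
  have gm: "?g \<in> borel_measurable borel" using gc by (rule borel_measurable_continuous_onI)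
  have gb: "\<bar>?g y\<bar> \<le> f B" for y using f_nonneg[OF v0, of y] f_mono[OF v0 vB, of y] by simp
  \<comment> \<open>the two first-order factors of \<open>U'' = a\<^sup>2 U\<close> give two
    constants of integration \<open>c1\<close>, \<open>c2\<close>\<close>
  define U where "U x = v x - green ?g x" for x
  define U' where "U' x = V' x - green' ?g x" for x
  have dU: "(U has_real_derivative U' x) (at x)" if "0 < x" for x
  proof -
    have "(v has_real_derivative V' x) (at x)"
      using D(1)[OF that] by (rule has_field_derivative_transform_within[where d=x]) (use that in \<open>auto simp: dist_real_def v_def\<close>)
    then show ?thesis unfolding U_def[abs_def] U'_def by (intro derivative_intros green_deriv[OF gc gb that])
  qed
  have dU': "(U' has_real_derivative a\<^sup>2 * U x) (at x)" if "0 < x" for x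
  proof -
    have "d * V'' x = d * (a\<^sup>2 * (V x - f (V x)))"
      using D(3)[OF that] unfolding mult.assoc[symmetric] a_sq by (simp add: algebra_simps)
    then have "V'' x = a\<^sup>2 * (V x - f (V x))" using d_pos by simp
    then have e: "V'' x - a\<^sup>2 * (green ?g x - ?g x) = a\<^sup>2 * U x" using that by (simp add: U_def v_def algebra_simps)
    have "(U' has_real_derivative V'' x - a\<^sup>2 * (green ?g x - ?g x)) (at x)"
      unfolding U'_def[abs_def] by (intro derivative_intros green'_deriv[OF gc gb that] D(2)[OF that])
    then show ?thesis unfolding e .
  qed
  have "((\<lambda>x. exp (- a * x) * (U' x + a * U x)) has_real_derivative 0) (at x)" if "0 < x" for x
  proof -
    have "((\<lambda>x. exp (- a * x) * (U' x + a * U x)) has_real_derivative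
        exp (- a * x) * (- a) * (U' x + a * U x) + (a\<^sup>2 * U x + a * U' x) * exp (- a * x)) (at x)"
      by (intro DERIV_mult DERIV_add DERIV_cmult dU[OF that] dU'[OF that]) (auto intro!: derivative_eq_intros)
    then show ?thesis by (simp add: algebra_simps power2_eq_square)
  qed
  then have "\<exists>c. \<forall>x\<in>{0<..}. exp (- a * x) * (U' x + a * U x) = c"
    by (intro has_field_derivative_zero_constant) (auto intro: has_field_derivative_at_within)
  then obtain c1 where c1: "\<And>x. 0 < x \<Longrightarrow> exp (- a * x) * (U' x + a * U x) = c1" by auto
  have "((\<lambda>x. exp (a * x) * (U' x - a * U x)) has_real_derivative 0) (at x)" if "0 < x" for x
  proof -
    have "((\<lambda>x. exp (a * x) * (U' x - a * U x)) has_real_derivative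
        exp (a * x) * a * (U' x - a * U x) + (a\<^sup>2 * U x - a * U' x) * exp (a * x)) (at x)"
      by (intro DERIV_mult DERIV_diff DERIV_cmult dU[OF that] dU'[OF that]) (auto intro!: derivative_eq_intros)
    then show ?thesis by (simp add: algebra_simps power2_eq_square)
  qed
  then have "\<exists>c. \<forall>x\<in>{0<..}. exp (a * x) * (U' x - a * U x) = c"
    by (intro has_field_derivative_zero_constant) (auto intro: has_field_derivative_at_within)
  then obtain c2 where c2: "\<And>x. 0 < x \<Longrightarrow> exp (a * x) * (U' x - a * U x) = c2" by auto
  have sol: "2 * a * U x = c1 * exp (a * x) - c2 * exp (- a * x)" if "0 < x" for x
  proof -
    have "exp (a * x) * exp (- a * x) = 1" by (simp add: exp_add[symmetric])
    moreover have "exp (- a * x) * exp (a * x) = 1" by (simp add: exp_add[symmetric])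
    ultimately have e: "exp (a * x) * (exp (- a * x) * q) = q" "exp (- a * x) * (exp (a * x) * q) = q" for q
      by (simp_all only: mult.assoc[symmetric] mult_1_left)
    have "U' x + a * U x = exp (a * x) * c1" "U' x - a * U x = exp (- a * x) * c2"
      by (simp_all only: c1[OF that, symmetric] c2[OF that, symmetric] e)
    then show ?thesis by (simp add: mult.commute)
  qed
  have Ub: "\<bar>U x\<bar> \<le> B + f B" if "0 \<le> x" for x
    using v0[of x] vB[of x] green_nonneg[of x ?g] green_le[OF gm gb that] that f_nonneg[OF v0] B f_nonneg[OF B]
    unfolding U_def abs_le_iff by auto
  have "c1 = 0"
  proof (rule ccontr)
    assume "c1 \<noteq> 0"
    then have c1p: "0 < \<bar>c1\<bar>" by simp
    \<comment> \<open>at the point where \<open>a x = Q + 1\<close>, boundedness of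
      \<open>U\<close> would give \<open>exp (Q + 1) \<le> Q\<close>\<close>
    define Q where "Q = (2 * a * (B + f B) + \<bar>c2\<bar>) / \<bar>c1\<bar>"
    have Q0: "0 \<le> Q" using B f_nonneg[OF B] a_pos by (auto simp: Q_def intro!: divide_nonneg_nonneg add_nonneg_nonneg mult_nonneg_nonneg)
    define x where "x = (Q + 1) / a"
    have x: "0 < x" using Q0 a_pos by (simp add: x_def)
    have ax: "a * x = Q + 1" using a_pos by (simp add: x_def)
    have "\<bar>c1\<bar> * exp (a * x) = \<bar>2 * a * U x + c2 * exp (- a * x)\<bar>" using sol[OF x] by (simp add: abs_mult)
    also have "\<dots> \<le> \<bar>2 * a * U x\<bar> + \<bar>c2 * exp (- a * x)\<bar>" by (rule abs_triangle_ineq)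
    also have "\<dots> = 2 * a * \<bar>U x\<bar> + \<bar>c2\<bar> * exp (- a * x)" using a_pos by (simp add: abs_mult)
    also have "\<dots> \<le> 2 * a * (B + f B) + \<bar>c2\<bar> * 1"
      using Ub[of x] x a_pos by (intro add_mono mult_left_mono) auto
    also have "\<dots> = \<bar>c1\<bar> * Q" using c1p by (simp add: Q_def)
    finally have "exp (a * x) \<le> Q" using c1p by simp
    moreover have "1 + a * x \<le> exp (a * x)" by (rule exp_ge_add_one_self)
    ultimately show False using ax by linarith
  qed
  have Ucont: "continuous_on {0..} U" unfolding U_def[abs_def]
    by (intro continuous_intros green_cont[OF gm gb] continuous_on_subset[OF vc]) auto
  have U0: "U 0 = 0" by (simp add: U_def v_def V0 green_0)
  have "(U \<longlongrightarrow> U 0) (at 0 within {0..})" using Ucont by (auto simp: continuous_on_def)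
  then have "(U \<longlongrightarrow> 0) (at_right 0)" using U0 by (auto intro: tendsto_within_subset)
  then have lim1: "((\<lambda>x. 2 * a * U x) \<longlongrightarrow> 2 * a * 0) (at_right 0)" by (intro tendsto_intros)
  have lim2: "((\<lambda>x. - c2 * exp (- a * x)) \<longlongrightarrow> - c2 * exp (- a * 0)) (at_right 0)" by (intro tendsto_intros)
  have "((\<lambda>x. 2 * a * U x) \<longlongrightarrow> - c2 * exp (- a * 0)) (at_right 0)"
    using lim2 by (rule Lim_transform_eventually) (use sol \<open>c1 = 0\<close> in \<open>simp add: eventually_at_filter\<close>)
  from tendsto_unique[OF _ lim1 this] have "c2 = 0" by simp
  have Uz: "U x = 0" if "0 \<le> x" for x
    using sol[of x] \<open>c1 = 0\<close> \<open>c2 = 0\<close> a_pos U0 that by (cases "x = 0") auto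
  have veq: "v x = green ?g (max 0 x)" for x
    using Uz[of "max 0 x"] by (simp add: U_def v_def)
  have "v x \<le> f B" for x using green_le[OF gm gb, of "max 0 x"] by (simp only: veq[symmetric])
  then have "B \<le> f B" unfolding B_def by (intro cSUP_least) auto
  then have "B \<le> ustar" using f_below[of B] by force
  then have "v x \<le> ustar" for x using vB[of x] by linarith
  then have "admissible v" using v0 borel_measurable_continuous_onI[OF vc] by (simp add: admissible_def)
  moreover have "step v = v" by (rule ext) (simp only: step_def veq[symmetric])
  ultimately show ?thesis by (simp add: steady_def v_def[abs_def])
qed

lemma steady_imp_connecting:
  assumes W: "steady W" and top: "(W \<longlongrightarrow> ustar) at_top"
  shows "connecting_steady_state d \<mu> f ustar W"
proof -
  have A: "admissible W" using W by (simp add: steady_def)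
  have "\<forall>\<^sub>F x in at_top. 0 < W x" using order_tendstoD(1)[OF top ustar_pos] .
  then obtain N where "\<forall>x\<ge>N. 0 < W x" by (auto simp: eventually_at_top_linorder)
  then have nt: "\<exists>x>0. W x \<noteq> 0" by (intro exI[of _ "max N 1"]) (auto simp: less_le)
  have "d * (a\<^sup>2 * (W x - f (W x))) - \<mu> * W x + \<mu> * f (W x) = 0" for x
    unfolding mult.assoc[symmetric] a_sq by (simp add: algebra_simps)
  then have "\<exists>W' W''. \<forall>x>0. (W has_real_derivative W' x) (at x) \<and> (W' has_real_derivative W'' x) (at x) \<and> d * W'' x - \<mu> * W x + \<mu> * f (W x) = 0"
    by (intro exI[of _ "green' (\<lambda>y. f (W y))"] exI[of _ "\<lambda>x. a\<^sup>2 * (W x - f (W x))"] allI impI conjI steady_deriv[OF W]) auto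
  note ode = this
  have "continuous_on {0..} W" by (rule continuous_on_subset[OF steady_cont(1)[OF W]]) simp
  then show ?thesis
    unfolding connecting_steady_state_def dirichlet_steady_state_def
    using A by (intro conjI ode steady_0[OF W] nt top) (auto simp: admissible_def)
qed

lemma iterates:
  assumes "admissible w" "\<And>x y. 0 \<le> x \<Longrightarrow> x \<le> y \<Longrightarrow> w x \<le> w y"
  shows "admissible ((step ^^ n) w)" "0 \<le> x \<Longrightarrow> x \<le> y \<Longrightarrow> (step ^^ n) w x \<le> (step ^^ n) w y"
proof -
  have "admissible ((step ^^ n) w) \<and> (\<forall>x y. 0 \<le> x \<longrightarrow> x \<le> y \<longrightarrow> (step ^^ n) w x \<le> (step ^^ n) w y)"
  proof (induction n)
    case (Suc n)
    then show ?case using adm_step step_nondecreasing by simp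
  qed (use assms in auto)
  then show "admissible ((step ^^ n) w)" "0 \<le> x \<Longrightarrow> x \<le> y \<Longrightarrow> (step ^^ n) w x \<le> (step ^^ n) w y" by auto
qed

lemma iterates_limit_steady:
  assumes w: "\<And>n. admissible ((step ^^ n) w)" and lim: "\<And>x. (\<lambda>n. (step ^^ n) w x) \<longlonglongrightarrow> W x"
  shows "steady W"
proof -
  have [measurable]: "(step ^^ n) w \<in> borel_measurable borel" for n using w by (auto simp: admissible_def)
  have b: "0 \<le> (step ^^ n) w x" "(step ^^ n) w x \<le> ustar" for n x using w by (auto simp: admissible_def)
  have "W \<in> borel_measurable borel" by (rule borel_measurable_LIMSEQ_real[OF lim]) measurable
  moreover have "0 \<le> W x \<and> W x \<le> ustar" for x
    using LIMSEQ_le_const[OF lim, of 0 x] LIMSEQ_le_const2[OF lim, of x ustar] b by auto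
  ultimately have A: "admissible W" by (simp add: admissible_def)
  have "step W x = W x" for x
  proof (rule LIMSEQ_unique)
    show "(\<lambda>n. step ((step ^^ n) w) x) \<longlonglongrightarrow> step W x" by (rule step_tendsto[OF w A lim])
    show "(\<lambda>n. step ((step ^^ n) w) x) \<longlonglongrightarrow> W x" using LIMSEQ_Suc[OF lim, of x] by simp
  qed
  with A show ?thesis by (auto simp: steady_def)
qed

lemma iterates_converge:
  assumes w: "admissible w" and mono: "\<And>x y. 0 \<le> x \<Longrightarrow> x \<le> y \<Longrightarrow> w x \<le> w y" and mon: "monoseq (\<lambda>n. (step ^^ n) w x)"
  shows "(\<lambda>n. (step ^^ n) w x) \<longlonglongrightarrow> lim (\<lambda>n. (step ^^ n) w x)"
proof -
  have "Bseq (\<lambda>n. (step ^^ n) w x)"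
    using iterates(1)[OF w mono] by (intro BseqI'[of _ ustar]) (auto simp: admissible_def)
  then show ?thesis using Bseq_monoseq_convergent[OF _ mon] by (simp add: convergent_LIMSEQ_iff)
qed

text \<open>The iterates of a subsolution increase. Since subsolutions are only assumed on
  the half-line, the iteration is started from \<open>step w\<close>, for which the
  monotonicity in \<open>n\<close> holds at all real arguments.\<close>
lemma increasing_iterates:
  assumes w: "admissible w" and mono: "\<And>x y. 0 \<le> x \<Longrightarrow> x \<le> y \<Longrightarrow> w x \<le> w y" and sub: "\<And>x. 0 \<le> x \<Longrightarrow> w x \<le> step w x"
    and nt: "0 < w z" "0 \<le> z"
  obtains W where "steady W" "(W \<longlongrightarrow> ustar) at_top" "\<And>x. 0 \<le> x \<Longrightarrow> (\<lambda>n. (step ^^ n) w x) \<longlonglongrightarrow> W x"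
    "\<And>x y. 0 \<le> x \<Longrightarrow> x \<le> y \<Longrightarrow> W x \<le> W y"
proof -
  note it = iterates[OF w mono]
  have suc: "(step ^^ n) w x \<le> (step ^^ Suc n) w x" if "0 \<le> x" for n x
    using that
  proof (induction n arbitrary: x)
    case 0
    then show ?case using sub by simp
  next
    case (Suc n)
    have "step ((step ^^ n) w) x \<le> step ((step ^^ Suc n) w) x" by (rule step_mono[OF it(1) it(1) Suc.IH])
    then show ?case by simp
  qed
  define w1 where "w1 = step w"
  define W where "W x = lim (\<lambda>n. (step ^^ n) w1 x)" for x
  have w1: "admissible w1" "\<And>x y. 0 \<le> x \<Longrightarrow> x \<le> y \<Longrightarrow> w1 x \<le> w1 y"
    using it(1)[of 1] it(2)[of _ _ 1] by (auto simp: w1_def)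
  have it1: "(step ^^ n) w1 = (step ^^ Suc n) w" for n by (simp add: w1_def funpow_swap1)
  have inc: "(step ^^ n) w1 x \<le> (step ^^ Suc n) w1 x" for n x
  proof -
    have e: "(step ^^ Suc m) w x = (step ^^ Suc m) w (max 0 x)" for m by (simp add: step_def)
    have "0 \<le> max 0 x" by simp
    from suc[OF this, of "Suc n"] show ?thesis unfolding it1 e[of n] e[of "Suc n"] .
  qed
  have "monoseq (\<lambda>n. (step ^^ n) w1 x)" for x by (rule mono_SucI1, rule allI, rule inc)
  note lim = iterates_converge[OF w1 this, folded W_def]
  have st: "steady W" by (rule iterates_limit_steady[OF iterates(1)[OF w1] lim])
  have limw: "(\<lambda>n. (step ^^ n) w x) \<longlonglongrightarrow> W x" for x
    using lim[of x] unfolding it1 by (rule LIMSEQ_imp_Suc)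
  have Wm: "W x \<le> W y" if "0 \<le> x" "x \<le> y" for x y
    by (rule LIMSEQ_le[OF limw limw]) (use it(2) that in auto)
  have "w z \<le> (step ^^ n) w z" for n
  proof (induction n)
    case (Suc n)
    show ?case by (rule order_trans[OF Suc suc[OF nt(2)]])
  qed simp
  then have "w z \<le> W z" by (intro LIMSEQ_le_const[OF limw]) auto
  then have "0 < W z" using nt(1) by linarith
  have top: "(W \<longlongrightarrow> ustar) at_top"
  proof (rule steady_limit[OF st])
    show "0 < W z" by fact
  qed (use Wm nt in simp_all)
  show thesis
  proof (rule that[of W])
    show "W x \<le> W y" if "0 \<le> x" "x \<le> y" for x y by (rule Wm[OF that])
  qed (rule st top limw)+
qed

text \<open>The iterates of the supersolution \<open>ustar\<close> decrease and stay above
  every steady state, so their limit is the maximal one; the given steady state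
  \<open>V\<close> from below forces the limit at infinity.\<close>
lemma decreasing_iterates:
  assumes V: "steady V" "(V \<longlongrightarrow> ustar) at_top"
  obtains W where "steady W" "(W \<longlongrightarrow> ustar) at_top" "\<And>x. (\<lambda>n. (step ^^ n) (\<lambda>_. ustar) x) \<longlonglongrightarrow> W x"
    "\<And>x y. 0 \<le> x \<Longrightarrow> x \<le> y \<Longrightarrow> W x \<le> W y" "\<And>V x. steady V \<Longrightarrow> V x \<le> W x"
proof -
  let ?w = "\<lambda>_::real. ustar"
  have it: "admissible ((step ^^ n) ?w)" "0 \<le> x \<Longrightarrow> x \<le> y \<Longrightarrow> (step ^^ n) ?w x \<le> (step ^^ n) ?w y" for n x y
    using iterates[OF adm_const] by auto
  have dec: "(step ^^ Suc n) ?w x \<le> (step ^^ n) ?w x" for n x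
  proof (induction n arbitrary: x)
    case 0
    then show ?case using adm_step[OF adm_const] by (simp add: admissible_def)
  next
    case (Suc n)
    have "step ((step ^^ Suc n) ?w) x \<le> step ((step ^^ n) ?w) x" by (rule step_mono[OF it(1) it(1) Suc.IH])
    then show ?case by simp
  qed
  define W where "W x = lim (\<lambda>n. (step ^^ n) ?w x)" for x
  have "monoseq (\<lambda>n. (step ^^ n) ?w x)" for x by (rule mono_SucI2, rule allI, rule dec)
  note lim = iterates_converge[OF adm_const order_refl this, folded W_def]
  have st: "steady W" by (rule iterates_limit_steady[OF it(1) lim])
  have Wm: "W x \<le> W y" if "0 \<le> x" "x \<le> y" for x y
    by (rule LIMSEQ_le[OF lim lim]) (use it(2) that in auto)
  have max: "V x \<le> W x" if "steady V" for V x
  proof -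
    have "V y \<le> (step ^^ n) ?w y" for n y
    proof (induction n arbitrary: y)
      case 0
      then show ?case using that by (simp add: steady_def admissible_def)
    next
      case (Suc n)
      have "step V y \<le> step ((step ^^ n) ?w) y"
        using that it(1) Suc by (intro step_mono) (auto simp: steady_def)
      then show ?case using that by (simp add: steady_def)
    qed
    then show ?thesis by (intro LIMSEQ_le_const[OF lim]) auto
  qed
  have top: "(W \<longlongrightarrow> ustar) at_top"
  proof (rule tendsto_sandwich)
    show "(V \<longlongrightarrow> ustar) at_top" by (rule V)
    show "((\<lambda>_. ustar) \<longlongrightarrow> ustar) at_top" by simp
    show "\<forall>\<^sub>F x in at_top. V x \<le> W x" using max[OF V(1)] by simp
    show "\<forall>\<^sub>F x in at_top. W x \<le> ustar" using st by (simp add: steady_def admissible_def)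
  qed
  show thesis
  proof (rule that[of W])
    show "W x \<le> W y" if "0 \<le> x" "x \<le> y" for x y by (rule Wm[OF that])
    show "V x \<le> W x" if "steady V" for V x by (rule max[OF that])
  qed (rule st top lim)+
qed

end

section \<open>Existence of solutions on the line\<close>

context diffusion
begin

text \<open>The heat semigroup in the variable of a standard Gaussian; unlike the form with
  the heat kernel it makes sense, and is continuous, at \<open>s = 0\<close>. The time
  argument \<open>r\<close> of \<open>G\<close> is carried along for joint
  continuity.\<close>
definition gauss :: "(real \<Rightarrow> real \<Rightarrow> real) \<Rightarrow> real \<Rightarrow> real \<Rightarrow> real \<Rightarrow> real" where
  "gauss G r s x = (\<integral>z. std_normal_density z * G r (x - sqrt (2 * d * s) * z) \<partial>lborel)"

lemma line_semigroup_gauss: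
  assumes "0 < t"
  shows "line_semigroup d \<mu> t (G r) x = exp (- \<mu> * t) * gauss G r t x"
proof -
  define q where "q = sqrt (2 * d * t)"
  have q: "0 < q" "q\<^sup>2 = 2 * d * t" using assms d_pos by (auto simp: q_def)
  have h: "q * heat_kernel d t (q * z) = std_normal_density z" for z
  proof -
    have e: "(q * z)\<^sup>2 / (4 * d * t) = z\<^sup>2 / 2"
      using assms d_pos by (simp add: power_mult_distrib q)
    have "sqrt (4 * pi * d * t) = sqrt (2 * pi) * q"
      by (simp add: q_def real_sqrt_mult[symmetric] mult.assoc mult.left_commute)
    then show ?thesis using q(1) unfolding heat_kernel_def e std_normal_density_def by simp
  qed
  have "(\<integral>y. heat_kernel d t (x - y) * G r y \<partial>lborel) = \<bar>- q\<bar> *\<^sub>R (\<integral>z. heat_kernel d t (x - (x + - q * z)) * G r (x + - q * z) \<partial>lborel)"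
    using q by (subst lborel_integral_real_affine[where c="- q" and t=x]) auto
  also have "\<dots> = (\<integral>z. q * (heat_kernel d t (q * z) * G r (x - q * z)) \<partial>lborel)"
    using q(1) by simp
  also have "\<dots> = gauss G r t x"
    unfolding gauss_def q_def[symmetric] by (simp only: mult.assoc[symmetric] h)
  finally show ?thesis by (simp add: line_semigroup_def)
qed

lemma std_normal_integrable: "integrable lborel (\<lambda>z. std_normal_density z * B)"
  by (intro integrable_mult_left integrable_normal_density) simp

lemma gauss_bound:
  assumes "continuous_on UNIV (G r)" "\<And>y. \<bar>G r y\<bar> \<le> B"
  shows "\<bar>gauss G r s x\<bar> \<le> B"
proof -
  have "\<bar>gauss G r s x\<bar> \<le> (\<integral>z. std_normal_density z * B \<partial>lborel)"
    unfolding gauss_def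
  proof (rule order_trans[OF integral_abs_bound])
    have [measurable]: "G r \<in> borel_measurable borel" using assms(1) by (rule borel_measurable_continuous_onI)
    have le: "\<bar>std_normal_density z * G r (x - sqrt (2 * d * s) * z)\<bar> \<le> std_normal_density z * B" for z
      using assms(2) by (simp add: abs_mult mult_left_mono)
    show "(\<integral>z. \<bar>std_normal_density z * G r (x - sqrt (2 * d * s) * z)\<bar> \<partial>lborel) \<le> (\<integral>z. std_normal_density z * B \<partial>lborel)"
    proof (rule integral_mono[OF _ std_normal_integrable le])
      show "integrable lborel (\<lambda>z. \<bar>std_normal_density z * G r (x - sqrt (2 * d * s) * z)\<bar>)"
        by (rule Bochner_Integration.integrable_bound[OF std_normal_integrable[of B]])
           (use le order_trans[OF le abs_ge_self] in \<open>auto simp: abs_mult intro!: AE_I2\<close>)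
    qed
  qed
  then show ?thesis by simp
qed

lemma gauss_nonneg: "(\<And>y. 0 \<le> G r y) \<Longrightarrow> 0 \<le> gauss G r s x"
  unfolding gauss_def by (intro integral_nonneg_AE AE_I2) simp

lemma gauss_0: "gauss G r 0 x = G r x"
  unfolding gauss_def by simp

lemma gauss_cont:
  assumes G: "continuous_on UNIV (\<lambda>p. G (fst p) (snd p))" and B: "\<And>T. \<exists>B. \<forall>r\<le>T. \<forall>y. \<bar>G r y\<bar> \<le> B"
  shows "continuous_on UNIV (\<lambda>(r, s, x). gauss G r s x)"
proof -
  have "continuous_on UNIV (\<lambda>p :: real \<times> real \<times> real. \<integral>z. std_normal_density z * G (fst p) (snd (snd p) - sqrt (2 * d * fst (snd p)) * z) \<partial>lborel)"
  proof (rule continuous_on_dominated_integral)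
    show c: "continuous_on UNIV (\<lambda>p :: real \<times> real \<times> real. std_normal_density z * G (fst p) (snd (snd p) - sqrt (2 * d * fst (snd p)) * z))" for z
      by (intro continuous_intros continuous_on_compose2[OF G, of UNIV "\<lambda>p. (fst p, snd (snd p) - sqrt (2 * d * fst (snd p)) * z)", simplified])
    fix p0 :: "real \<times> real \<times> real"
    have "continuous_on UNIV (\<lambda>z. G (fst p0) (snd (snd p0) - sqrt (2 * d * fst (snd p0)) * z))"
      by (intro continuous_on_compose2[OF G, of UNIV "\<lambda>z. (fst p0, snd (snd p0) - sqrt (2 * d * fst (snd p0)) * z)", simplified] continuous_intros)
    then have [measurable]: "(\<lambda>z. G (fst p0) (snd (snd p0) - sqrt (2 * d * fst (snd p0)) * z)) \<in> borel_measurable borel"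
      by (rule borel_measurable_continuous_onI)
    show "(\<lambda>z. std_normal_density z * G (fst p0) (snd (snd p0) - sqrt (2 * d * fst (snd p0)) * z)) \<in> borel_measurable lborel" by measurable
    obtain B where B: "\<forall>r\<le>fst p0 + 1. \<forall>y. \<bar>G r y\<bar> \<le> B" using B[of "fst p0 + 1"] by (elim exE)
    have "\<bar>std_normal_density z * G (fst p) (snd (snd p) - sqrt (2 * d * fst (snd p)) * z)\<bar> \<le> std_normal_density z * B"
      if "dist p p0 < 1" for p z
    proof -
      have "dist (fst p) (fst p0) < 1" using dist_fst_le[of p p0] that by linarith
      then have "fst p \<le> fst p0 + 1" by (simp add: dist_real_def)
      then show ?thesis using B by (simp add: abs_mult mult_left_mono)
    qed
    then show "\<exists>e>0. \<exists>w. integrable lborel w \<and> (\<forall>p\<in>UNIV. dist p p0 < e \<longrightarrow> (\<forall>z\<in>space lborel.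
        \<bar>std_normal_density z * G (fst p) (snd (snd p) - sqrt (2 * d * fst (snd p)) * z)\<bar> \<le> w z))"
      by (intro exI[of _ 1] exI[of _ "\<lambda>z. std_normal_density z * B"] conjI std_normal_integrable) auto
  qed
  then show ?thesis by (simp add: gauss_def case_prod_beta')
qed

end

context kinetics
begin

text \<open>The functions on the plane on which the integral equation on the line can be
  iterated.\<close>
definition nice :: "(real \<Rightarrow> real \<Rightarrow> real) \<Rightarrow> bool" where
  "nice v \<longleftrightarrow> continuous_on UNIV (\<lambda>p. v (fst p) (snd p)) \<and> (\<forall>t x. 0 \<le> v t x) \<and> (\<forall>T. \<exists>B. \<forall>t\<le>T. \<forall>x. \<bar>v t x\<bar> \<le> B)"

lemma niceI: "continuous_on UNIV (\<lambda>p. v (fst p) (snd p)) \<Longrightarrow> (\<And>t x. 0 \<le> v t x) \<Longrightarrow> (\<And>T. \<exists>B. \<forall>t\<le>T. \<forall>x. \<bar>v t x\<bar> \<le> B) \<Longrightarrow> nice v"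
  by (simp add: nice_def)

lemma niceD: "nice v \<Longrightarrow> continuous_on UNIV (\<lambda>p. v (fst p) (snd p))" "nice v \<Longrightarrow> 0 \<le> v t x"
  by (simp_all add: nice_def)

lemma nice_bound: "nice v \<Longrightarrow> \<exists>B. \<forall>t\<le>T. \<forall>x. \<bar>v t x\<bar> \<le> B"
  unfolding nice_def by blast

lemma nice_f: assumes v: "nice v" shows "nice (\<lambda>r y. f (v r y))"
proof (rule niceI)
  show "continuous_on UNIV (\<lambda>p. f (v (fst p) (snd p)))"
    by (intro f_comp_continuous niceD v)
  show "0 \<le> f (v t x)" for t x by (intro f_nonneg niceD v)
  show "\<exists>B. \<forall>t\<le>T. \<forall>x. \<bar>f (v t x)\<bar> \<le> B" for T
  proof -
    from nice_bound[OF v, of T] obtain B where B: "\<forall>t\<le>T. \<forall>x. \<bar>v t x\<bar> \<le> B" by (elim exE)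
    have "\<bar>f (v t x)\<bar> \<le> f B" if "t \<le> T" for t x
      using niceD(2)[OF v, of t x] B[rule_format, OF that, of x] f_nonneg[of "v t x"] f_mono[of "v t x" B] by simp
    then show ?thesis by (intro exI[of _ "f B"]) simp
  qed
qed

text \<open>The Duhamel integrand at age \<open>t \<sigma>\<close>, with the factor
  \<open>t\<close> of the substitution.\<close>
abbreviation duhamel_integrand :: "(real \<Rightarrow> real \<Rightarrow> real) \<Rightarrow> real \<Rightarrow> real \<Rightarrow> real \<Rightarrow> real" where
  "duhamel_integrand v t x \<sigma> \<equiv> t * \<mu> * exp (- \<mu> * (t * \<sigma>)) * gauss (\<lambda>r y. f (v r y)) (t - t * \<sigma> - \<tau>) (t * \<sigma>) x"

text \<open>The Duhamel term with the age of the reaction rescaled by \<open>t\<close>: the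
  domain of integration no longer depends on \<open>t\<close>, so that continuity in
  \<open>t\<close> follows from dominated convergence.\<close>
definition duhamel :: "(real \<Rightarrow> real \<Rightarrow> real) \<Rightarrow> real \<Rightarrow> real \<Rightarrow> real" where
  "duhamel v t x = (\<integral>\<sigma>. indicator {0<..<1} \<sigma> * duhamel_integrand v t x \<sigma> \<partial>lborel)"

lemma gauss_f_cont: "nice v \<Longrightarrow> continuous_on UNIV (\<lambda>(r, s, x). gauss (\<lambda>r y. f (v r y)) r s x)"
  by (rule gauss_cont[OF niceD(1) nice_bound]; rule nice_f)

lemma nice_slice: assumes v: "nice v" shows "continuous_on UNIV (v r)"
proof -
  have "continuous_on UNIV (\<lambda>y :: real. (r, y))" by (intro continuous_intros)
  from continuous_on_compose2[OF niceD(1)[OF v] this] show ?thesis by simp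
qed

lemma duhamel_integrand_bound:
  assumes v: "nice v" and T: "0 \<le> T"
  shows "\<exists>B\<ge>0. \<forall>t \<sigma> x. 0 \<le> t \<longrightarrow> t \<le> T \<longrightarrow>
     \<bar>indicator {0<..<1} \<sigma> * duhamel_integrand v t x \<sigma>\<bar> \<le> indicator {0<..<1} \<sigma> * B"
proof -
  from nice_bound[OF nice_f[OF v], of T] obtain B where B: "\<forall>r\<le>T. \<forall>y. \<bar>f (v r y)\<bar> \<le> B" by (elim exE)
  have B0: "0 \<le> B" using B[rule_format, of 0 0] T by linarith
  show ?thesis
  proof (intro exI[of _ "T * \<mu> * 1 * B"] conjI allI impI)
    show "0 \<le> T * \<mu> * 1 * B" using T mu_pos B0 by simp
    fix t \<sigma> x :: real assume t: "0 \<le> t" "t \<le> T"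
    show "\<bar>indicator {0<..<1} \<sigma> * duhamel_integrand v t x \<sigma>\<bar> \<le> indicator {0<..<1} \<sigma> * (T * \<mu> * 1 * B)"
    proof (cases "\<sigma> \<in> {0<..<1}")
      case True
      have ts: "0 \<le> t * \<sigma>" using t True by simp
      then have r: "t - t * \<sigma> - \<tau> \<le> T" using t tau_pos by linarith
      have "\<bar>gauss (\<lambda>r y. f (v r y)) (t - t * \<sigma> - \<tau>) (t * \<sigma>) x\<bar> \<le> B"
        using B r nice_slice[OF nice_f[OF v]] by (intro gauss_bound) auto
      then have "t * \<mu> * exp (- \<mu> * (t * \<sigma>)) * \<bar>gauss (\<lambda>r y. f (v r y)) (t - t * \<sigma> - \<tau>) (t * \<sigma>) x\<bar> \<le> T * \<mu> * 1 * B"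
        using t mu_pos ts by (intro mult_mono) auto
      then show ?thesis using True t mu_pos by (simp add: abs_mult)
    qed simp
  qed
qed

lemma duhamel_cont:
  assumes v: "nice v"
  shows "continuous_on ({0..} \<times> UNIV) (\<lambda>p. duhamel v (fst p) (snd p))"
  unfolding duhamel_def
proof (rule continuous_on_dominated_integral)
  let ?g = "gauss (\<lambda>r y. f (v r y))"
  have g: "continuous_on S (\<lambda>w. ?g (R w) (T w) (X w))"
    if "continuous_on S R" "continuous_on S T" "continuous_on S X" for S :: "'b :: topological_space set" and R T X
    using continuous_on_compose2[OF gauss_f_cont[OF v] continuous_on_Pair[OF that(1) continuous_on_Pair[OF that(2,3)]]] by simp
  show "continuous_on ({0..} \<times> UNIV) (\<lambda>p :: real \<times> real. indicator {0<..<1} \<sigma> * duhamel_integrand v (fst p) (snd p) \<sigma>)" for \<sigma>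
    by (intro continuous_intros g)
  fix p0 :: "real \<times> real" assume p0: "p0 \<in> {0..} \<times> UNIV"
  have "continuous_on UNIV (\<lambda>\<sigma>. duhamel_integrand v (fst p0) (snd p0) \<sigma>)"
    by (intro continuous_intros g)
  then have [measurable]: "(\<lambda>\<sigma>. duhamel_integrand v (fst p0) (snd p0) \<sigma>) \<in> borel_measurable borel"
    by (rule borel_measurable_continuous_onI)
  show "(\<lambda>\<sigma>. indicator {0<..<1} \<sigma> * duhamel_integrand v (fst p0) (snd p0) \<sigma>) \<in> borel_measurable lborel"
    by measurable
  have "0 \<le> fst p0 + 1" using p0 by auto
  from duhamel_integrand_bound[OF v this] obtain B where B: "0 \<le> B" "\<forall>t \<sigma> x. 0 \<le> t \<longrightarrow> t \<le> fst p0 + 1 \<longrightarrow>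
     \<bar>indicator {0<..<1} \<sigma> * (t * \<mu> * exp (- \<mu> * (t * \<sigma>)) * ?g (t - t * \<sigma> - \<tau>) (t * \<sigma>) x)\<bar> \<le> indicator {0<..<1} \<sigma> * B" by (elim exE conjE)
  have I: "integrable lborel (\<lambda>\<sigma> :: real. indicator {0<..<1} \<sigma> * B :: real)" 
    by (intro integrable_mult_left integrable_real_indicator) auto
  have "\<bar>indicator {0<..<1} \<sigma> * duhamel_integrand v (fst p) (snd p) \<sigma>\<bar> \<le> indicator {0<..<1} \<sigma> * B"
    if p: "p \<in> {0..} \<times> UNIV" "dist p p0 < 1" for p \<sigma>
  proof (rule B(2)[rule_format])
    show "0 \<le> fst p" using p by auto
    have "dist (fst p) (fst p0) < 1" using dist_fst_le[of p p0] p by linarith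
    then show "fst p \<le> fst p0 + 1" by (simp add: dist_real_def)
  qed
  then show "\<exists>e>0. \<exists>w. integrable lborel w \<and> (\<forall>p\<in>{0..} \<times> UNIV. dist p p0 < e \<longrightarrow> (\<forall>\<sigma>\<in>space lborel.
     \<bar>indicator {0<..<1} \<sigma> * duhamel_integrand v (fst p) (snd p) \<sigma>\<bar> \<le> w \<sigma>))"
    by (intro exI[of _ 1] exI[of _ "\<lambda>\<sigma>. indicator {0<..<1} \<sigma> * B"] conjI I ballI impI) simp_all
qed

lemma duhamel_bound:
  assumes v: "nice v" and T: "0 \<le> T"
  shows "\<exists>B\<ge>0. \<forall>t\<in>{0..T}. \<forall>x. \<bar>duhamel v t x\<bar> \<le> B"
proof -
  from duhamel_integrand_bound[OF assms] obtain B where B: "0 \<le> B" "\<forall>t \<sigma> x. 0 \<le> t \<longrightarrow> t \<le> T \<longrightarrow>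
     \<bar>indicator {0<..<1} \<sigma> * duhamel_integrand v t x \<sigma>\<bar> \<le> indicator {0<..<1} \<sigma> * B" by (elim exE conjE)
  have I: "integrable lborel (\<lambda>\<sigma> :: real. indicator {0<..<1} \<sigma> * B :: real)" 
    by (intro integrable_mult_left integrable_real_indicator) auto
  have "\<bar>duhamel v t x\<bar> \<le> B" if "0 \<le> t" "t \<le> T" for t x
  proof -
    have le: "norm (indicator {0<..<1} \<sigma> * duhamel_integrand v t x \<sigma>) \<le> indicator {0<..<1} \<sigma> * B" for \<sigma>
      unfolding real_norm_def by (rule B(2)[rule_format, OF that])
    have "norm (duhamel v t x) \<le> (\<integral>\<sigma>. indicator {0<..<1 :: real} \<sigma> * B \<partial>lborel)"
      unfolding duhamel_def
      by (rule order_trans[OF integral_norm_bound integral_mono'[OF I le]]) (use B(1) in simp)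
    then show ?thesis by simp
  qed
  then show ?thesis using B(1) by auto
qed

lemma duhamel_nonneg: "nice v \<Longrightarrow> 0 \<le> t \<Longrightarrow> 0 \<le> duhamel v t x"
  unfolding duhamel_def using mu_pos
  by (intro integral_nonneg_AE AE_I2 mult_nonneg_nonneg gauss_nonneg f_nonneg) (auto simp: nice_def)

text \<open>By the delay, the value at \<open>t\<close> only depends on values at times up
  to \<open>t - \<tau>\<close>.\<close>
lemma duhamel_cong:
  assumes "0 \<le> t" "\<And>r y. r \<le> t - \<tau> \<Longrightarrow> v r y = w r y"
  shows "duhamel v t x = duhamel w t x"
  unfolding duhamel_def
proof (intro Bochner_Integration.integral_cong refl)
  fix \<sigma> :: real
  show "indicator {0<..<1} \<sigma> * duhamel_integrand v t x \<sigma>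
     = indicator {0<..<1} \<sigma> * duhamel_integrand w t x \<sigma>"
  proof (cases "\<sigma> \<in> {0<..<1}")
    case True
    then have "0 \<le> t * \<sigma>" using assms(1) by simp
    then have "v (t - t * \<sigma> - \<tau>) y = w (t - t * \<sigma> - \<tau>) y" for y by (intro assms(2)) simp
    then show ?thesis by (simp add: gauss_def)
  qed simp
qed

lemma duhamel_eq:
  assumes "0 < t"
  shows "(LBINT r:{0<..<t}. line_semigroup d \<mu> (t - r) (\<lambda>y. \<mu> * f (v (r - \<tau>) y)) x) = duhamel v t x"
proof -
  have "(LBINT r:{0<..<t}. line_semigroup d \<mu> (t - r) (\<lambda>y. \<mu> * f (v (r - \<tau>) y)) x)
     = \<bar>- t\<bar> *\<^sub>R (\<integral>\<sigma>. indicator {0<..<t} (t + - t * \<sigma>) *\<^sub>R line_semigroup d \<mu> (t - (t + - t * \<sigma>)) (\<lambda>y. \<mu> * f (v (t + - t * \<sigma> - \<tau>) y)) x \<partial>lborel)"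
    unfolding set_lebesgue_integral_def using assms
    by (subst lborel_integral_real_affine[where c="- t" and t=t]) auto
  also have "\<dots> = (\<integral>\<sigma>. t * (indicator {0<..<t} (t + - t * \<sigma>) *\<^sub>R line_semigroup d \<mu> (t - (t + - t * \<sigma>)) (\<lambda>y. \<mu> * f (v (t + - t * \<sigma> - \<tau>) y)) x) \<partial>lborel)"
    using assms by simp
  also have "\<dots> = duhamel v t x"
    unfolding duhamel_def
  proof (intro Bochner_Integration.integral_cong refl)
    fix \<sigma> :: real
    have i: "t + - t * \<sigma> \<in> {0<..<t} \<longleftrightarrow> \<sigma> \<in> {0<..<1}"
      using assms zero_less_mult_iff[of t "1 - \<sigma>"] zero_less_mult_iff[of t \<sigma>] by (auto simp: algebra_simps)
    show "t * (indicator {0<..<t} (t + - t * \<sigma>) *\<^sub>R line_semigroup d \<mu> (t - (t + - t * \<sigma>)) (\<lambda>y. \<mu> * f (v (t + - t * \<sigma> - \<tau>) y)) x)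
       = indicator {0<..<1} \<sigma> * duhamel_integrand v t x \<sigma>"
    proof (cases "\<sigma> \<in> {0<..<1}")
      case True
      have ts: "0 < t * \<sigma>" using True assms by simp
      have "line_semigroup d \<mu> (t * \<sigma>) (\<lambda>y. \<mu> * f (v (t - t * \<sigma> - \<tau>) y)) x = \<mu> * line_semigroup d \<mu> (t * \<sigma>) (\<lambda>y. f (v (t - t * \<sigma> - \<tau>) y)) x"
        by (simp add: line_semigroup_def mult.left_commute)
      also have "\<dots> = \<mu> * (exp (- \<mu> * (t * \<sigma>)) * gauss (\<lambda>r y. f (v r y)) (t - t * \<sigma> - \<tau>) (t * \<sigma>) x)"
        using line_semigroup_gauss[OF ts, of "\<lambda>r y. f (v r y)" "t - t * \<sigma> - \<tau>" x] by simp
      finally show ?thesis using True i by (simp add: indicator_def)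
    next
      case False
      then show ?thesis using i by (simp add: indicator_def)
    qed
  qed
  finally show ?thesis .
qed

text \<open>The right-hand side of the integral equation for \<open>t > 0\<close> and the
  history \<open>\<psi>\<close> for \<open>t \<le> 0\<close>, in one formula that is visibly
  continuous: the first two terms cancel for \<open>t \<ge> 0\<close>, the last terms reduce
  to \<open>\<psi> 0 x\<close> for \<open>t \<le> 0\<close>.\<close>
definition picard :: "(real \<Rightarrow> real \<Rightarrow> real) \<Rightarrow> (real \<Rightarrow> real \<Rightarrow> real) \<Rightarrow> real \<Rightarrow> real \<Rightarrow> real" where
  "picard \<psi> v t x = \<psi> (min t 0) x - \<psi> 0 x + exp (- \<mu> * max 0 t) * gauss (\<lambda>r. \<psi> 0) 0 (max 0 t) x + duhamel v (max 0 t) x"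

lemma picard_neg: "t \<le> 0 \<Longrightarrow> picard \<psi> v t x = \<psi> t x"
  by (simp add: picard_def gauss_0 duhamel_def min_absorb1 max_absorb1)

lemma picard_nice:
  assumes \<psi>: "nice \<psi>" and v: "nice v"
  shows "nice (picard \<psi> v)"
proof -
  have \<psi>c: "continuous_on UNIV (\<lambda>p. \<psi> (fst p) (snd p))" using \<psi> by (simp add: nice_def)
  have "continuous_on UNIV (\<lambda>p :: real \<times> real. (min (fst p) 0, snd p))" by (intro continuous_intros)
  from continuous_on_compose2[OF \<psi>c this]
  have 0: "continuous_on UNIV (\<lambda>p :: real \<times> real. \<psi> (min (fst p) 0) (snd p))" by simp
  have "continuous_on UNIV (\<lambda>p :: real \<times> real. (0 :: real, snd p))" by (intro continuous_intros)
  from continuous_on_compose2[OF \<psi>c this]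
  have 1: "continuous_on UNIV (\<lambda>p :: real \<times> real. \<psi> 0 (snd p))" by simp
  from nice_bound[OF \<psi>, of 0] obtain B0 where B0: "\<forall>t\<le>0. \<forall>x. \<bar>\<psi> t x\<bar> \<le> B0" by (elim exE)
  have \<psi>0: "continuous_on UNIV (\<psi> 0)" by (rule nice_slice[OF \<psi>])
  have "continuous_on UNIV (\<lambda>(r, s, x). gauss (\<lambda>r. \<psi> 0) r s x)"
  proof (rule gauss_cont)
    show "continuous_on UNIV (\<lambda>p :: real \<times> real. \<psi> 0 (snd p))"
      by (rule 1)
    show "\<exists>B. \<forall>r\<le>T. \<forall>y. \<bar>\<psi> 0 y\<bar> \<le> B" for T
      using B0[rule_format, OF order_refl] by (intro exI[of _ B0]) simp
  qed
  note G = this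
  have "continuous_on UNIV (\<lambda>p :: real \<times> real. (0 :: real, max 0 (fst p), snd p))" by (intro continuous_intros)
  from continuous_on_compose2[OF G this]
  have 2: "continuous_on UNIV (\<lambda>p. gauss (\<lambda>r. \<psi> 0) 0 (max 0 (fst p)) (snd p))" by simp
  have "continuous_on UNIV (\<lambda>p :: real \<times> real. (max 0 (fst p), snd p))" by (intro continuous_intros)
  note c = this
  have "range (\<lambda>p :: real \<times> real. (max 0 (fst p), snd p)) \<subseteq> {0..} \<times> UNIV" by auto
  from continuous_on_compose2[OF duhamel_cont[OF v] c this]
  have 3: "continuous_on UNIV (\<lambda>p. duhamel v (max 0 (fst p)) (snd p))" by (simp only: fst_conv snd_conv)
  have "continuous_on UNIV (\<lambda>p. picard \<psi> v (fst p) (snd p))"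
    unfolding picard_def by (intro continuous_on_add continuous_on_diff continuous_on_mult 0 1 2 3) (intro continuous_intros)
  moreover have "0 \<le> picard \<psi> v t x" for t x
  proof (cases "t \<le> 0")
    case True
    then show ?thesis using niceD(2)[OF \<psi>] by (simp only: picard_neg)
  next
    case False
    then have t: "min t 0 = 0" "max 0 t = t" "0 \<le> t" by auto
    have "0 \<le> gauss (\<lambda>r. \<psi> 0) 0 t x" by (rule gauss_nonneg, rule niceD(2)[OF \<psi>])
    then show ?thesis using duhamel_nonneg[OF v t(3), of x] unfolding picard_def t by simp
  qed
  moreover have "\<exists>B. \<forall>t\<le>T. \<forall>x. \<bar>picard \<psi> v t x\<bar> \<le> B" for T
  proof -
    have "0 \<le> max 0 T" by simp
    from duhamel_bound[OF v this] obtain B1 where B1: "0 \<le> B1" "\<forall>t\<in>{0..max 0 T}. \<forall>x. \<bar>duhamel v t x\<bar> \<le> B1"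
      by (elim exE conjE)
    have "\<bar>picard \<psi> v t x\<bar> \<le> (B0 + B0 + 1 * B0) + B1" if "t \<le> T" for t x
    proof -
      have "\<bar>gauss (\<lambda>r. \<psi> 0) 0 (max 0 t) x\<bar> \<le> B0"
        by (rule gauss_bound[of "\<lambda>r. \<psi> 0", OF \<psi>0]) (rule B0[rule_format, OF order_refl])
      then have g: "\<bar>exp (- \<mu> * max 0 t) * gauss (\<lambda>r. \<psi> 0) 0 (max 0 t) x\<bar> \<le> 1 * B0"
        unfolding abs_mult using mu_pos by (intro mult_mono) auto
      have "max 0 t \<in> {0..max 0 T}" using that by auto
      then have "\<bar>duhamel v (max 0 t) x\<bar> \<le> B1" using B1(2) by blast
      moreover have "\<bar>\<psi> (min t 0) x\<bar> \<le> B0" "\<bar>\<psi> 0 x\<bar> \<le> B0" by (rule B0[rule_format], simp)+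
      moreover have "\<bar>A - B + E + D\<bar> \<le> q + q + e + b"
        if "\<bar>A\<bar> \<le> q" "\<bar>B\<bar> \<le> q" "\<bar>E\<bar> \<le> e" "\<bar>D\<bar> \<le> b" for A B E D q e b :: real
        using that by linarith
      ultimately show ?thesis using g unfolding picard_def by blast
    qed
    then show ?thesis by (intro exI[of _ "(B0 + B0 + 1 * B0) + B1"] allI impI)
  qed
  ultimately show ?thesis by (rule niceI)
qed

text \<open>The method of steps: by the delay, the \<open>n\<close>-th iterate of the
  integral equation is final up to the time \<open>n \<tau>\<close>, so that the solution is
  read off at each time from an iterate of sufficiently high index.\<close>
theorem line_solution_exists:
  assumes \<phi>: "\<phi> \<in> bc_nonneg \<tau> UNIV"
  shows "\<exists>u. line_solution d \<mu> \<tau> f \<phi> u"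
proof -
  define \<psi> where "\<psi> t = \<phi> (max (- \<tau>) (min t 0))" for t
  have \<phi>c: "continuous_on ({-\<tau>..0} \<times> UNIV) (\<lambda>(\<theta>, x). \<phi> \<theta> x)"
    and \<phi>b: "bounded ((\<lambda>(\<theta>, x). \<phi> \<theta> x) ` ({-\<tau>..0} \<times> UNIV))"
    and \<phi>n: "\<And>\<theta> x. \<theta> \<in> {-\<tau>..0} \<Longrightarrow> 0 \<le> \<phi> \<theta> x"
    using \<phi> by (auto simp: bc_nonneg_def)
  have cl: "max (- \<tau>) (min t 0) \<in> {-\<tau>..0}" for t using tau_pos by auto
  have \<psi>: "nice \<psi>"
  proof (rule niceI)
    show "continuous_on UNIV (\<lambda>p. \<psi> (fst p) (snd p))"
    proof -
      have "continuous_on UNIV (\<lambda>p :: real \<times> real. (max (- \<tau>) (min (fst p) 0), snd p))" by (intro continuous_intros)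
      note c = this
      have "range (\<lambda>p :: real \<times> real. (max (- \<tau>) (min (fst p) 0), snd p)) \<subseteq> {-\<tau>..0} \<times> UNIV" using cl by auto
      from continuous_on_compose2[OF \<phi>c c this] show ?thesis unfolding \<psi>_def by (simp only: case_prod_conv)
    qed
    show "0 \<le> \<psi> t x" for t x unfolding \<psi>_def by (rule \<phi>n[OF cl])
    obtain B where B: "\<forall>z\<in>{-\<tau>..0} \<times> UNIV. norm ((\<lambda>(\<theta>, x). \<phi> \<theta> x) z) \<le> B"
      using \<phi>b by (auto simp: bounded_iff)
    have "\<bar>\<psi> t x\<bar> \<le> B" for t x using B[rule_format, of "(max (- \<tau>) (min t 0), x)"] cl[of t] by (simp add: \<psi>_def)
    then show "\<exists>B. \<forall>t\<le>T. \<forall>x. \<bar>\<psi> t x\<bar> \<le> B" for T by (intro exI[of _ B]) simp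
  qed
  define v where "v n = (picard \<psi> ^^ n) \<psi>" for n
  have v0: "v 0 = \<psi>" and vS: "v (Suc n) = picard \<psi> (v n)" for n by (auto simp: v_def)
  have v: "nice (v n)" for n
  proof (induction n)
    case (Suc n)
    show ?case unfolding vS by (rule picard_nice[OF \<psi> Suc])
  qed (simp only: v0 \<psi>)
  have agree: "v (Suc n) t x = v n t x" if "t \<le> real n * \<tau>" for n t x
    using that
  proof (induction n arbitrary: t x)
    case 0
    then show ?case by (simp add: v0 vS picard_neg)
  next
    case (Suc n)
    have "duhamel (v (Suc n)) (max 0 t) x = duhamel (v n) (max 0 t) x"
    proof (cases "0 \<le> t")
      case True
      have "duhamel (v (Suc n)) t x = duhamel (v n) t x"
        using Suc.prems by (intro duhamel_cong True Suc.IH) (auto simp: algebra_simps)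
      then show ?thesis using True by (simp add: max_absorb2)
    next
      case False
      then show ?thesis by (simp add: duhamel_def max_absorb1)
    qed
    then have "picard \<psi> (v (Suc n)) t x = picard \<psi> (v n) t x" by (simp only: picard_def)
    then show ?case by (simp only: vS[of "Suc n"] vS[of n])
  qed
  have agree': "v m t x = v n t x" if "n \<le> m" "t \<le> real n * \<tau>" for n m t x
    using that(1)
  proof (induction m rule: dec_induct)
    case (step m)
    have "real n * \<tau> \<le> real m * \<tau>" using step(1) tau_pos by (intro mult_right_mono) auto
    then show ?case using agree[of t m x] that(2) step(3) by linarith
  qed simp
  define u where "u t x = v (nat \<lceil>t / \<tau>\<rceil>) t x" for t x
  have N: "t \<le> real (nat \<lceil>t / \<tau>\<rceil>) * \<tau>" for t
  proof -
    have "t / \<tau> \<le> real (nat \<lceil>t / \<tau>\<rceil>)" by linarith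
    then show ?thesis using tau_pos by (simp add: field_simps)
  qed
  have u: "u t x = v n t x" if "t \<le> real n * \<tau>" for n t x
  proof -
    have "t / \<tau> \<le> real n" using that tau_pos by (simp add: field_simps)
    then have "nat \<lceil>t / \<tau>\<rceil> \<le> n" by linarith
    from agree'[OF this N] show ?thesis by (simp add: u_def)
  qed
  have exn: "\<exists>n. t < real n * \<tau>" for t
  proof -
    obtain n where "t / \<tau> < real n" using reals_Archimedean2 by blast
    then show ?thesis using tau_pos by (intro exI[of _ n]) (simp add: field_simps)
  qed
  have un: "nice u"
  proof -
    have "continuous_on (\<Union>n\<in>UNIV. {..<real n * \<tau>} \<times> UNIV) (\<lambda>p. u (fst p) (snd p))"
    proof (rule continuous_on_open_UN)
      fix n :: nat
      show "open ({..<real n * \<tau>} \<times> (UNIV :: real set))" by (intro open_Times) auto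
      have "continuous_on ({..<real n * \<tau>} \<times> UNIV) (\<lambda>p. v n (fst p) (snd p))"
        by (rule continuous_on_subset[OF niceD(1)[OF v]]) simp
      then show "continuous_on ({..<real n * \<tau>} \<times> UNIV) (\<lambda>p. u (fst p) (snd p))"
        by (rule continuous_on_eq) (auto intro!: u[symmetric])
    qed
    moreover have "(\<Union>n\<in>UNIV. {..<real n * \<tau>} \<times> (UNIV :: real set)) = UNIV" using exn by auto
    ultimately have "continuous_on UNIV (\<lambda>p. u (fst p) (snd p))" by simp
    moreover have "0 \<le> u t x" for t x unfolding u_def by (rule niceD(2)[OF v])
    moreover have "\<exists>B. \<forall>t\<le>T. \<forall>x. \<bar>u t x\<bar> \<le> B" for T
    proof -
      obtain n where n: "T < real n * \<tau>" using exn by blast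
      from nice_bound[OF v[of n], of T] obtain B where B: "\<forall>t\<le>T. \<forall>x. \<bar>v n t x\<bar> \<le> B" by (elim exE)
      have "\<bar>u t x\<bar> \<le> B" if "t \<le> T" for t x using u[of t n x] n B[rule_format, OF that] that by simp
      then show ?thesis by (intro exI[of _ B]) simp
    qed
    ultimately show ?thesis by (rule niceI)
  qed
  have u0: "u t x = \<psi> t x" if "t \<le> 0" for t x using u[of t 0 x] that by (simp add: v0)
  have eq: "u t x = line_semigroup d \<mu> t (u 0) x + (LBINT s:{0<..<t}. line_semigroup d \<mu> (t - s) (\<lambda>y. \<mu> * f (u (s - \<tau>) y)) x)"
    if t: "0 < t" for t x
  proof -
    obtain n where n: "t < real n * \<tau>" using exn by blast
    have "u t x = v (Suc n) t x" using n tau_pos by (intro u) (simp add: algebra_simps)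
    also have "\<dots> = exp (- \<mu> * t) * gauss (\<lambda>r. \<psi> 0) 0 t x + duhamel (v n) t x"
      using t by (simp add: vS picard_def min_absorb2 max_absorb2)
    also have "duhamel (v n) t x = duhamel u t x"
      proof (rule duhamel_cong)
      fix r y :: real assume "r \<le> t - \<tau>"
      then have "r \<le> real n * \<tau>" using n tau_pos by linarith
      then show "v n r y = u r y" by (rule u[symmetric])
    qed (use t in simp)
    also have "exp (- \<mu> * t) * gauss (\<lambda>r. \<psi> 0) 0 t x = line_semigroup d \<mu> t (u 0) x"
    proof -
      have "u 0 = \<psi> 0" by (rule ext) (simp add: u0)
      then show ?thesis using line_semigroup_gauss[OF t, of "\<lambda>r. \<psi> 0" 0 x] by simp
    qed
    finally show ?thesis by (simp add: duhamel_eq[OF t])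
  qed
  have "mild_solution (line_semigroup d \<mu>) UNIV \<mu> \<tau> f \<phi> u"
    unfolding mild_solution_def
  proof (intro conjI allI ballI impI)
    have "continuous_on UNIV (\<lambda>(t, x). u t x)" using un by (simp add: nice_def case_prod_beta')
    then show "continuous_on ({-\<tau>..} \<times> UNIV) (\<lambda>(t, x). u t x)" by (rule continuous_on_subset) simp
    show "0 \<le> u t x" for t x using un by (simp add: nice_def)
    show "bounded ((\<lambda>(t, x). u t x) ` ({-\<tau>..T} \<times> UNIV))" for T
    proof -
      from nice_bound[OF un, of T] obtain B where "\<forall>t\<le>T. \<forall>x. \<bar>u t x\<bar> \<le> B" by (elim exE)
      then have "\<forall>z\<in>(\<lambda>(t, x). u t x) ` ({-\<tau>..T} \<times> UNIV). norm z \<le> B" by auto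
      then show ?thesis unfolding bounded_iff by (rule exI[of _ B])
    qed
    show "u \<theta> x = \<phi> \<theta> x" if "\<theta> \<in> {-\<tau>..0}" for \<theta> x
      using that u0[of \<theta> x] by (simp add: \<psi>_def min_absorb1 max_absorb2)
  qed (simp only: eq)
  then show ?thesis unfolding line_solution_def by blast
qed

end

section \<open>Comparison of the line with the half-line\<close>

context diffusion
begin

lemma line_semigroup_translate:
  "line_semigroup d \<mu> t g (x - h) = line_semigroup d \<mu> t (\<lambda>y. g (y - h)) x"
proof -
  have "(\<integral>y. heat_kernel d t (x - h - y) * g y \<partial>lborel) = \<bar>1\<bar> *\<^sub>R (\<integral>y. heat_kernel d t (x - h - (- h + 1 * y)) * g (- h + 1 * y) \<partial>lborel)"
    by (rule lborel_integral_real_affine) simp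
  also have "\<dots> = (\<integral>y. heat_kernel d t (x - y) * g (y - h) \<partial>lborel)" by simp
  finally show ?thesis by (simp add: line_semigroup_def)
qed

text \<open>The difference of the two semigroups consists of the mass on the negative axis
  and of the reflected mass, which are both outside the distance \<open>x\<close> of the
  starting point; Chernoff's bound with exponents \<open>1\<close> and
  \<open>-1\<close>.\<close>
lemma line_semigroup_le_dirichlet:
  assumes t: "0 < t" and x: "0 \<le> x" and [measurable]: "g \<in> borel_measurable borel" and g: "\<And>y. 0 \<le> g y" "\<And>y. g y \<le> B"
  shows "line_semigroup d \<mu> t g x \<le> dirichlet_semigroup d \<mu> t g x + 2 * B * exp (d * t - x)"
proof -
  have B0: "0 \<le> B" using g[of 0] by linarith
  let ?k = "heat_kernel d t"
  note k0 = heat_kernel_nonneg[OF d_pos t]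
  let ?P = "\<lambda>y. B * exp (- x) * (?k (x - y) * exp (1 * (x - y)))"
  let ?Q = "\<lambda>y. B * exp (- x) * (?k (- x - y) * exp (- 1 * (- x - y)))"
  let ?D = "\<lambda>y. indicator {0..} y * (dirichlet_kernel t x y * g y)"
  have P: "has_bochner_integral lborel ?P (B * exp (- x) * exp (d * t))"
    by (intro has_bochner_integral_mult_right heat_kernel_exp_moment d_pos t) simp
  have Q: "has_bochner_integral lborel ?Q (B * exp (- x) * exp (d * t))"
    by (intro has_bochner_integral_mult_right heat_kernel_exp_moment d_pos t) simp
  have gb: "\<bar>g y\<bar> \<le> B" for y using g[of y] by simp
  have D: "has_bochner_integral lborel ?D (integral\<^sup>L lborel ?D)"
    by (rule has_bochner_integral_integrable[OF dirichlet_kernel_integrable[OF t x assms(3) gb]])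
  have I: "integrable lborel (\<lambda>y. ?k (x - y) * g y)"
  proof (rule Bochner_Integration.integrable_bound)
    show "integrable lborel (\<lambda>y. ?k (x - y) * B)"
      using heat_kernel_mass[OF d_pos t] by (auto simp: has_bochner_integral_iff)
    show "AE y in lborel. norm (?k (x - y) * g y) \<le> norm (?k (x - y) * B)"
      using k0 g B0 by (intro AE_I2) (simp add: abs_mult mult_left_mono)
  qed measurable
  have "(\<integral>y. ?k (x - y) * g y \<partial>lborel) \<le> (\<integral>y. ?D y + (?P y + ?Q y) \<partial>lborel)"
  proof (rule integral_mono[OF I])
    show "integrable lborel (\<lambda>y. ?D y + (?P y + ?Q y))"
      using has_bochner_integral_add[OF D has_bochner_integral_add[OF P Q]] by (simp only: has_bochner_integral_iff)
    fix y
    have p: "0 \<le> ?P y" "0 \<le> ?Q y" using B0 k0 by simp_all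
    show "?k (x - y) * g y \<le> ?D y + (?P y + ?Q y)"
    proof (cases "0 \<le> y")
      case True
      have "1 * 1 \<le> exp (- x) * exp (- 1 * (- x - y))" using True by (simp add: exp_add[symmetric])
      then have "?k (x + y) * g y * 1 \<le> ?k (x + y) * B * (exp (- x) * exp (- 1 * (- x - y)))"
        using k0 g B0 by (intro mult_mono) auto
      moreover have "?k (- x - y) = ?k (x + y)" using heat_kernel_uminus[of d t "x + y"] by (simp add: algebra_simps)
      ultimately have "?k (x + y) * g y \<le> ?Q y" by (simp add: mult_ac)
      then show ?thesis using p True by (simp add: left_diff_distrib)
    next
      case False
      have "1 * 1 \<le> exp (- x) * exp (1 * (x - y))" using False by (simp add: exp_add[symmetric])
      then have "?k (x - y) * g y * 1 \<le> ?k (x - y) * B * (exp (- x) * exp (1 * (x - y)))"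
        using k0 g B0 by (intro mult_mono) auto
      then have "?k (x - y) * g y \<le> ?P y" by (simp add: mult_ac)
      then show ?thesis using p False by simp
    qed
  qed
  also have "\<dots> = integral\<^sup>L lborel ?D + (B * exp (- x) * exp (d * t) + B * exp (- x) * exp (d * t))"
    using has_bochner_integral_add[OF D has_bochner_integral_add[OF P Q]] by (rule has_bochner_integral_integral_eq)
  also have "\<dots> = integral\<^sup>L lborel ?D + 2 * B * exp (d * t - x)"
    by (simp add: exp_diff exp_minus field_simps)
  finally have "exp (- \<mu> * t) * (\<integral>y. ?k (x - y) * g y \<partial>lborel) \<le> exp (- \<mu> * t) * (integral\<^sup>L lborel ?D + 2 * B * exp (d * t - x))"
    by (rule mult_left_mono) simp
  also have "\<dots> \<le> exp (- \<mu> * t) * integral\<^sup>L lborel ?D + 1 * (2 * B * exp (d * t - x))"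
    unfolding distrib_left using B0 t mu_pos by (intro add_left_mono mult_right_mono) auto
  finally show ?thesis by (simp add: line_semigroup_def dirichlet_semigroup_eq)
qed

text \<open>The analogue of \<open>line_semigroup_le_dirichlet\<close> for the occupation
  densities over a bounded time.\<close>
lemma line_occ_le_half:
  assumes x: "0 \<le> x" and T: "0 \<le> T" and h: "bounded_measurable h" "\<And>p. 0 \<le> h p" "\<And>s y. h (s, y) \<le> indicator {..<T} s * B"
  shows "(\<integral>p. line_occ d \<mu> x p * h p \<partial>plane) \<le> half_int x h + 2 * B * exp (d * T - x)"
proof -
  have B0: "0 \<le> B" using h(2)[of "(T - 1, 0)"] h(3)[of "T - 1" 0] by simp
  let ?P = "\<lambda>p. B * exp (- x) * (line_occ d \<mu> x p * (indicator {..<T} (fst p) * exp (1 * (x - snd p))))"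
  let ?Q = "\<lambda>p. B * exp (- x) * (line_occ d \<mu> (- x) p * (indicator {..<T} (fst p) * exp (- 1 * (- x - snd p))))"
  have P: "integrable plane ?P" "integral\<^sup>L plane ?P \<le> B * exp (- x) * exp (d * T)"
    using line_occ_exp_moment[OF T, of 1 x] B0 by (auto simp: case_prod_beta' intro!: mult_left_mono)
  have Q: "integrable plane ?Q" "integral\<^sup>L plane ?Q \<le> B * exp (- x) * exp (d * T)"
    using line_occ_exp_moment[OF T, of "- 1" "- x"] B0 by (auto simp: case_prod_beta' intro!: mult_left_mono)
  have H: "integrable plane (\<lambda>p. half_occ d \<mu> x p * h p)" by (rule half_integrable[OF h(1) x])
  obtain C where C: "\<forall>p. \<bar>h p\<bar> \<le> C" using h(1) unfolding bounded_measurable_def by (elim conjE exE)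
  have I: "integrable plane (\<lambda>p. line_occ d \<mu> x p * h p)" by (rule line_occ_integrable[OF bounded_measurableD[OF h(1)] C[rule_format]])
  have "(\<integral>p. line_occ d \<mu> x p * h p \<partial>plane) \<le> (\<integral>p. half_occ d \<mu> x p * h p + (?P p + ?Q p) \<partial>plane)"
  proof (rule integral_mono[OF I])
    show "integrable plane (\<lambda>p. half_occ d \<mu> x p * h p + (?P p + ?Q p))" by (intro Bochner_Integration.integrable_add H P Q)
    fix p :: "real \<times> real"
    obtain s y where p: "p = (s, y)" by (cases p)
    have nn: "0 \<le> ?P p" "0 \<le> ?Q p" using B0 line_occ_nonneg by simp_all
    show "line_occ d \<mu> x p * h p \<le> half_occ d \<mu> x p * h p + (?P p + ?Q p)"
    proof (cases "0 \<le> y")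
      case True
      have e: "line_occ d \<mu> x (s, - y) = line_occ d \<mu> (- x) (s, y)"
        using heat_kernel_uminus[of d s "x + y"] by (simp add: line_occ_def algebra_simps)
      have "1 * 1 \<le> exp (- x) * exp (- 1 * (- x - y))" using True by (simp add: exp_add[symmetric])
      then have "indicator {..<T} s * B * 1 \<le> indicator {..<T} s * B * (exp (- x) * exp (- 1 * (- x - y)))"
        using B0 by (intro mult_left_mono) auto
      then have "line_occ d \<mu> (- x) (s, y) * h (s, y) \<le> line_occ d \<mu> (- x) (s, y) * (indicator {..<T} s * B * (exp (- x) * exp (- 1 * (- x - y))))"
        using h(3)[of s y] line_occ_nonneg by (intro mult_left_mono) auto
      then have "line_occ d \<mu> (- x) (s, y) * h (s, y) \<le> ?Q p" by (simp add: p mult_ac)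
      moreover have "half_occ d \<mu> x p * h p = line_occ d \<mu> x p * h p - line_occ d \<mu> (- x) (s, y) * h (s, y)"
        using True by (simp add: p half_occ_def e left_diff_distrib)
      ultimately show ?thesis using nn by linarith
    next
      case False
      have "1 * 1 \<le> exp (- x) * exp (1 * (x - y))" using False by (simp add: exp_add[symmetric])
      then have "indicator {..<T} s * B * 1 \<le> indicator {..<T} s * B * (exp (- x) * exp (1 * (x - y)))"
        using B0 by (intro mult_left_mono) auto
      then have "line_occ d \<mu> x (s, y) * h (s, y) \<le> line_occ d \<mu> x (s, y) * (indicator {..<T} s * B * (exp (- x) * exp (1 * (x - y))))"
        using h(3)[of s y] line_occ_nonneg by (intro mult_left_mono) auto
      then have "line_occ d \<mu> x p * h p \<le> ?P p" by (simp add: p mult_ac)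
      moreover have "half_occ d \<mu> x p = 0" using False by (simp add: p half_occ_def)
      ultimately show ?thesis using nn by simp
    qed
  qed
  also have "\<dots> = half_int x h + (integral\<^sup>L plane ?P + integral\<^sup>L plane ?Q)"
    unfolding half_int_def by (simp only: Bochner_Integration.integral_add[OF H Bochner_Integration.integrable_add[OF P(1) Q(1)]] Bochner_Integration.integral_add[OF P(1) Q(1)])
  also have "\<dots> \<le> half_int x h + (B * exp (- x) * exp (d * T) + B * exp (- x) * exp (d * T))" using P Q by (intro add_mono) auto
  also have "\<dots> = half_int x h + 2 * B * exp (d * T - x)" by (simp add: exp_diff exp_minus field_simps)
  finally show ?thesis .
qed

text \<open>An error that decays like \<open>exp (- y)\<close> is propagated to one that
  decays like \<open>exp (- x)\<close>. This makes the comparison of line and half-line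
  stable under iteration.\<close>
lemma half_int_exp_decay:
  assumes x: "0 \<le> x" and T: "0 \<le> T"
  shows "half_int x (\<lambda>(s, y). indicator {0<..<T} s * exp (- \<bar>y\<bar>)) \<le> exp (d * T - x)"
proof -
  let ?h = "\<lambda>p :: real \<times> real. indicator {0<..<T} (fst p) * exp (- \<bar>snd p\<bar>)"
  let ?P = "\<lambda>p. exp (- x) * (line_occ d \<mu> x p * (indicator {..<T} (fst p) * exp (1 * (x - snd p))))"
  have P: "integrable plane ?P" "integral\<^sup>L plane ?P \<le> exp (- x) * exp (d * T)"
    using line_occ_exp_moment[OF T, of 1 x] by (auto simp: case_prod_beta' intro!: mult_left_mono)
  have i: "integrable plane (\<lambda>p. line_occ d \<mu> x p * ?h p)"
    by (rule line_occ_integrable[of _ 1]) (auto simp: indicator_def)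
  have "half_int x ?h \<le> (\<integral>p. line_occ d \<mu> x p * ?h p \<partial>plane)"
    by (rule half_int_le_line[OF x _ _ i]) auto
  also have "\<dots> \<le> integral\<^sup>L plane ?P"
  proof (rule integral_mono[OF i P(1)])
    fix p :: "real \<times> real"
    have "?h p \<le> exp (- x) * (indicator {..<T} (fst p) * exp (1 * (x - snd p)))"
      by (auto simp: indicator_def exp_add[symmetric])
    from mult_left_mono[OF this line_occ_nonneg[of x p]] show "line_occ d \<mu> x p * ?h p \<le> ?P p" by (simp only: mult.left_commute)
  qed
  also note P(2)
  finally show ?thesis by (simp add: case_prod_beta' exp_diff exp_minus divide_inverse mult.commute)
qed

end

section \<open>Growth and spreading of small bumps\<close>

context half_line_solution
begin

text \<open>Below \<open>\<kappa>\<close> the reaction multiplies by at least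
  \<open>r\<close>, and the linear evolution of the bump over the window leaves at least the
  fraction \<open>C\<close> of it.\<close>
lemma bump_growth_step:
  assumes b: "0 < b" and k: "0 < k" "k \<le> \<kappa>" and r: "0 < r" "\<And>v. 0 \<le> v \<Longrightarrow> v \<le> \<kappa> \<Longrightarrow> r * v \<le> f v"
    and K: "0 < K" "K \<le> t"
    and sub: "\<And>x. 0 \<le> x \<Longrightarrow> C * bump b (x - y0) \<le> half_int x (bump_window b K y0)"
    and low: "\<And>q x. t - K - \<tau> \<le> q \<Longrightarrow> q \<le> t - \<tau> \<Longrightarrow> 0 \<le> x \<Longrightarrow> k * bump b (x - y0) \<le> u q x" and x: "0 \<le> x"
  shows "(r * C) * k * bump b (x - y0) \<le> u t x"
proof -
  note br = bump_range[OF b]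
  have bm: "bounded_measurable (bump_window b K y0)"
    using br by (intro bounded_measurableI[of _ 1]) (auto simp: indicator_def)
  have "(r * k) * (C * bump b (x - y0)) \<le> (r * k) * half_int x (bump_window b K y0)"
    using r k sub[OF x] by (intro mult_left_mono) auto
  also have "\<dots> = half_int x (\<lambda>p. (r * k) * (bump_window b K y0) p)"
    by (simp only: half_cmult)
  also have "\<dots> \<le> half_int x (recent K t)"
  proof (rule half_mono[OF x bounded_measurable_cmult[OF bm] bounded_measurable_reaction_window])
    fix s y :: real assume s: "0 < s" "0 \<le> y"
    show "(r * k) * (bump_window b K y0) (s, y) \<le> (recent K t) (s, y)"
    proof (cases "s < K")
      case True
      have q: "t - K - \<tau> \<le> t - s - \<tau>" "t - s - \<tau> \<le> t - \<tau>" "- \<tau> \<le> t - s - \<tau>" using True s K by auto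
      have "0 \<le> k * bump b (y - y0)" using br k by simp
      moreover have "k * bump b (y - y0) \<le> \<kappa> * 1" using br k by (intro mult_mono) auto
      ultimately have "r * (k * bump b (y - y0)) \<le> f (k * bump b (y - y0))" by (intro r(2)) auto
      also have "\<dots> \<le> f (u (t - s - \<tau>) y)" using low[OF q(1,2) s(2)] \<open>0 \<le> k * bump b (y - y0)\<close> by (intro f_mono)
      finally show ?thesis using True s q(3) by (simp add: reaction_eq mult.assoc)
    qed simp
  qed
  also have "\<dots> \<le> u t x" by (rule u_lower[OF K x])
  finally show ?thesis by (simp add: mult_ac)
qed

text \<open>On the compact support of the bump and on a time interval of length \<open>K +
  \<tau>\<close> the solution has a positive minimum, which gives a first multiple of the
  bump below it. As \<open>r C > 1\<close>, this multiple persists for all later times, and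
  in each further time \<open>K + \<tau>\<close> it grows by the factor \<open>r C\<close>,
  until it reaches \<open>\<kappa>\<close>.\<close>
lemma bump_growth:
  assumes nt: "\<not> vanishes_on \<tau> {0..} \<phi>"
    and b: "0 < b" and \<kappa>: "0 < \<kappa>" and r: "0 < r" "\<And>v. 0 \<le> v \<Longrightarrow> v \<le> \<kappa> \<Longrightarrow> r * v \<le> f v" and rC: "1 < r * C"
    and K: "0 < K"
    and sub: "\<And>x. 0 \<le> x \<Longrightarrow> C * bump b (x - y0) \<le> half_int x (bump_window b K y0)"
    and y0: "pi / (2 * b) < y0"
  shows "\<exists>t0\<ge>0. \<forall>t\<ge>t0. \<forall>x\<ge>0. \<kappa> * bump b (x - y0) \<le> u t x"
proof -
  note br = bump_range[OF b]
  define l where "l = pi / (2 * b)"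
  have l: "0 < l" "l < y0" using b y0 by (auto simp: l_def)
  \<comment> \<open>the multiple \<open>k\<close> of the bump is below the solution from
    time \<open>t0\<close> on\<close>
  define Good where "Good k t0 \<longleftrightarrow> (\<forall>t\<ge>t0. \<forall>x\<ge>0. k * bump b (x - y0) \<le> u t x)" for k t0
  have persist: "Good k t0" if k: "0 < k" "k \<le> \<kappa>" and t0: "0 \<le> t0"
    and init: "\<forall>t. t0 \<le> t \<longrightarrow> t \<le> t0 + K + \<tau> \<longrightarrow> (\<forall>x\<ge>0. k * bump b (x - y0) \<le> u t x)" for k t0
  proof -
    have "\<forall>t. t0 \<le> t \<longrightarrow> t \<le> t0 + K + \<tau> + real n * \<tau> \<longrightarrow> (\<forall>x\<ge>0. k * bump b (x - y0) \<le> u t x)" for n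
    proof (induction n)
      case 0
      then show ?case using init by simp
    next
      case (Suc n)
      show ?case
      proof (intro allI impI)
        fix t x :: real assume t: "t0 \<le> t" "t \<le> t0 + K + \<tau> + real (Suc n) * \<tau>" and x: "0 \<le> x"
        show "k * bump b (x - y0) \<le> u t x"
        proof (cases "t \<le> t0 + K + \<tau>")
          case True
          then show ?thesis using init t x by blast
        next
          case False
          have "1 * (k * bump b (x - y0)) \<le> (r * C) * (k * bump b (x - y0))"
            using rC k br by (intro mult_right_mono) auto
          also have "\<dots> = (r * C) * k * bump b (x - y0)" by simp
          also have "\<dots> \<le> u t x"
          proof (rule bump_growth_step[OF b k r K _ sub _ x])
            show "K \<le> t" using False t0 tau_pos by linarith
            fix q x' :: real assume q: "t - K - \<tau> \<le> q" "q \<le> t - \<tau>" and x': "0 \<le> x'"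
            have "t0 \<le> q" using q False by linarith
            moreover have "q \<le> t0 + K + \<tau> + real n * \<tau>" using q t by (simp add: algebra_simps)
            ultimately show "k * bump b (x' - y0) \<le> u q x'" using Suc x' by blast
          qed
          finally show ?thesis by simp
        qed
      qed
    qed
    note all = this
    show ?thesis unfolding Good_def
    proof (intro allI impI)
      fix t x :: real assume t: "t0 \<le> t" and x: "0 \<le> x"
      obtain n where "t / \<tau> \<le> real n" using real_arch_simple by blast
      then have "t \<le> real n * \<tau>" using tau_pos by (simp add: field_simps)
      then have "t \<le> t0 + K + \<tau> + real n * \<tau>" using t0 K tau_pos by linarith
      then show "k * bump b (x - y0) \<le> u t x" using all t x by blast
    qed
  qed
  have grow: "Good (r * C * k) (t0 + K + \<tau>)" if k: "0 < k" "k \<le> \<kappa>" and t0: "0 \<le> t0" and G: "Good k t0" for k t0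
    unfolding Good_def
  proof (intro allI impI)
    fix t x :: real assume t: "t0 + K + \<tau> \<le> t" and x: "0 \<le> x"
    show "r * C * k * bump b (x - y0) \<le> u t x"
    proof (rule bump_growth_step[OF b k r K _ sub _ x])
      show "K \<le> t" using t t0 tau_pos by linarith
      show "k * bump b (x' - y0) \<le> u q x'" if "t - K - \<tau> \<le> q" "0 \<le> x'" for q x'
        using G t that unfolding Good_def by simp
    qed
  qed
  define S where "S = {\<tau>..\<tau> + K + \<tau>} \<times> {y0 - l..y0 + l}"
  have Sc: "compact S" unfolding S_def by (intro compact_Times compact_Icc)
  have Sne: "S \<noteq> {}" using l K tau_pos by (auto simp: S_def)
  have "continuous_on S (\<lambda>(t, x). u t x)"
    by (rule continuous_on_subset[OF u_cont]) (use l tau_pos in \<open>auto simp: S_def\<close>)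
  from continuous_attains_inf[OF Sc Sne this] obtain z where z: "z \<in> S" "\<forall>w\<in>S. (case z of (t, x) \<Rightarrow> u t x) \<le> (case w of (t, x) \<Rightarrow> u t x)" by blast
  define m where "m = (case z of (t, x) \<Rightarrow> u t x)"
  have m: "0 < m" using z(1) l by (auto simp: m_def S_def intro!: u_positive[OF nt])
  have mle: "m \<le> u t x" if "\<tau> \<le> t" "t \<le> \<tau> + K + \<tau>" "\<bar>x - y0\<bar> \<le> l" for t x
  proof -
    have "y0 - l \<le> x" "x \<le> y0 + l" using that(3) by linarith+
    then have "(t, x) \<in> S" using that by (simp add: S_def)
    from z(2)[rule_format, OF this] show ?thesis by (simp add: m_def)
  qed
  define k0 where "k0 = min m \<kappa>"
  have k0: "0 < k0" "k0 \<le> \<kappa>" "k0 \<le> m" using m \<kappa> by (auto simp: k0_def)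
  have G0: "Good k0 \<tau>"
  proof (rule persist[OF k0(1,2)])
    show "\<forall>t. \<tau> \<le> t \<longrightarrow> t \<le> \<tau> + K + \<tau> \<longrightarrow> (\<forall>x\<ge>0. k0 * bump b (x - y0) \<le> u t x)"
    proof (intro allI impI)
      fix t x :: real assume t: "\<tau> \<le> t" "t \<le> \<tau> + K + \<tau>" and x: "0 \<le> x"
      show "k0 * bump b (x - y0) \<le> u t x"
      proof (cases "\<bar>x - y0\<bar> \<le> l")
        case True
        have "k0 * bump b (x - y0) \<le> m * 1" using k0 br by (intro mult_mono) auto
        then show ?thesis using mle[OF t True] by simp
      next
        case False
        then have "bump b (x - y0) = 0" by (intro bump_outside b) (simp add: l_def)
        then show ?thesis using u_nonneg[of t x] t x tau_pos by simp
      qed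
    qed
  qed (use tau_pos in simp)
  have weaken: "Good k' t" if "Good k t" "k' \<le> k" for k k' t
    unfolding Good_def
  proof (intro allI impI)
    fix s x :: real assume s: "t \<le> s" "0 \<le> x"
    have "k' * bump b (x - y0) \<le> k * bump b (x - y0)" using that(2) br by (intro mult_right_mono) auto
    also have "\<dots> \<le> u s x" using that(1) s unfolding Good_def by blast
    finally show "k' * bump b (x - y0) \<le> u s x" .
  qed
  have iter: "\<exists>t0\<ge>0. Good (min ((r * C) ^ n * k0) \<kappa>) t0" for n
  proof (induction n)
    case 0
    have "Good (min ((r * C) ^ 0 * k0) \<kappa>) \<tau>" by (rule weaken[OF G0]) simp
    then show ?case using tau_pos by (intro exI[of _ \<tau>]) simp
  next
    case (Suc n)
    then obtain t0 where t0: "0 \<le> t0" "Good (min ((r * C) ^ n * k0) \<kappa>) t0" by (elim exE conjE)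
    let ?k = "min ((r * C) ^ n * k0) \<kappa>"
    have k: "0 < ?k" "?k \<le> \<kappa>" using rC k0 \<kappa> by auto
    have "Good (r * C * ?k) (t0 + K + \<tau>)" by (rule grow[OF k t0])
    moreover have "min ((r * C) ^ Suc n * k0) \<kappa> \<le> r * C * ?k"
    proof (cases "(r * C) ^ n * k0 \<le> \<kappa>")
      case True
      then have k: "?k = (r * C) ^ n * k0" by (rule min_absorb1)
      show ?thesis unfolding k by (rule order_trans[OF min.cobounded1]) simp
    next
      case False
      then have "?k = \<kappa>" by simp
      moreover have "1 * \<kappa> \<le> r * C * \<kappa>" using rC \<kappa> by (intro mult_right_mono) auto
      ultimately show ?thesis by simp
    qed
    ultimately have "Good (min ((r * C) ^ Suc n * k0) \<kappa>) (t0 + K + \<tau>)" by (rule weaken)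
    then show ?case using t0(1) K tau_pos by (intro exI[of _ "t0 + K + \<tau>"]) simp
  qed
  obtain n where "\<kappa> / k0 < (r * C) ^ n" using real_arch_pow[OF rC] by blast
  then have "min ((r * C) ^ n * k0) \<kappa> = \<kappa>" using k0(1) by (simp add: field_simps min_def)
  with iter[of n] show ?thesis unfolding Good_def by simp
qed

text \<open>Induction over time steps of length \<open>\<tau>\<close>. In each step the
  delayed reactions differ by the Lipschitz constant times the previous error, and replacing
  the line by the half-line costs a multiple of \<open>exp (- x)\<close>. It is essential
  for the iteration in \<open>bump_spreading\<close> that \<open>C\<close> is chosen before
  the position \<open>y0\<close> and the starting time \<open>t0\<close>.\<close>
lemma line_half_comparison:
  assumes v: "line_solution d \<mu> \<tau> f (\<lambda>\<theta> x. \<kappa> * bump b x) v" and b: "0 < b" and \<kappa>: "0 < \<kappa>"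
  shows "\<exists>C\<ge>0. \<forall>y0 t0. 0 \<le> t0 \<longrightarrow> (\<forall>\<theta> x. -\<tau> \<le> \<theta> \<longrightarrow> \<theta> \<le> 0 \<longrightarrow> 0 \<le> x \<longrightarrow> \<kappa> * bump b (x - y0) \<le> u (t0 + \<theta>) x) \<longrightarrow>
     (\<forall>t x. -\<tau> \<le> t \<longrightarrow> t \<le> real n * \<tau> \<longrightarrow> 0 \<le> x \<longrightarrow> v t (x - y0) - u (t0 + t) x \<le> C * exp (- x))"
proof (induction n)
  note br = bump_range[OF b]
  have vi: "v \<theta> x = \<kappa> * bump b x" if "-\<tau> \<le> \<theta>" "\<theta> \<le> 0" for \<theta> x
    using v that by (simp add: line_solution_def mild_solution_def)
  case 0
  show ?case
  proof (rule exI[of _ 0], intro conjI allI impI)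
    fix y0 t0 t x :: real
    assume h: "\<forall>\<theta> x. -\<tau> \<le> \<theta> \<longrightarrow> \<theta> \<le> 0 \<longrightarrow> 0 \<le> x \<longrightarrow> \<kappa> * bump b (x - y0) \<le> u (t0 + \<theta>) x"
      and t: "- \<tau> \<le> t" "t \<le> real 0 * \<tau>" and x: "0 \<le> x"
    show "v t (x - y0) - u (t0 + t) x \<le> 0 * exp (- x)"
      using h[rule_format, of t x] vi[of t "x - y0"] t x by simp
  qed simp
next
  note br = bump_range[OF b]
  case (Suc n)
  then obtain C where C: "0 \<le> C" and IH: "\<forall>y0 t0. 0 \<le> t0 \<longrightarrow> (\<forall>\<theta> x. -\<tau> \<le> \<theta> \<longrightarrow> \<theta> \<le> 0 \<longrightarrow> 0 \<le> x \<longrightarrow> \<kappa> * bump b (x - y0) \<le> u (t0 + \<theta>) x) \<longrightarrow>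
     (\<forall>t x. -\<tau> \<le> t \<longrightarrow> t \<le> real n * \<tau> \<longrightarrow> 0 \<le> x \<longrightarrow> v t (x - y0) - u (t0 + t) x \<le> C * exp (- x))"
    by (elim exE conjE)
  define T where "T = real (Suc n) * \<tau>"
  have T: "0 \<le> T" using tau_pos by (simp add: T_def)
  have vc: "continuous_on ({-\<tau>..} \<times> UNIV) (\<lambda>(t, x). v t x)"
    and vn: "\<And>t x. -\<tau> \<le> t \<Longrightarrow> 0 \<le> v t x"
    and vb: "bounded ((\<lambda>(t, x). v t x) ` ({-\<tau>..T} \<times> UNIV))"
    and vi: "\<And>\<theta> x. -\<tau> \<le> \<theta> \<Longrightarrow> \<theta> \<le> 0 \<Longrightarrow> v \<theta> x = \<kappa> * bump b x"
    and veq: "\<And>t x. 0 < t \<Longrightarrow> v t x = line_semigroup d \<mu> t (v 0) x + (LBINT s:{0<..<t}. line_semigroup d \<mu> (t - s) (\<lambda>y. \<mu> * f (v (s - \<tau>) y)) x)"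
    using v by (simp_all add: line_solution_def mild_solution_def)
  obtain M where M: "\<forall>z\<in>(\<lambda>(t, x). v t x) ` ({-\<tau>..T} \<times> UNIV). norm z \<le> M" using vb unfolding bounded_iff by (elim exE)
  have vM: "v t x \<le> M" if "-\<tau> \<le> t" "t \<le> T" for t x
  proof -
    have "v t x \<in> (\<lambda>(t, x). v t x) ` ({-\<tau>..T} \<times> UNIV)" using that by force
    from M[rule_format, OF this] show ?thesis by simp
  qed
  have M0: "0 \<le> M" using vn[of 0 0] vM[of 0 0] tau_pos T by simp
  obtain L where L: "0 < L" "\<And>p q. 0 \<le> p \<Longrightarrow> p \<le> q \<Longrightarrow> q \<le> M \<Longrightarrow> f q - f p \<le> L * (q - p)"
    using f_lipschitz[of M] by blast
  have fM: "0 \<le> f M" by (rule f_nonneg[OF M0])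
  \<comment> \<open>the three terms come from the initial data, from the change of
    occupation density, and from the previous error\<close>
  define C' where "C' = (2 * \<kappa> + 2 * f M + L * C) * exp (d * T)"
  have main: "v t (x - y0) - u (t0 + t) x \<le> C' * exp (- x)"
    if t0: "0 \<le> t0" and h: "\<forall>\<theta> x. -\<tau> \<le> \<theta> \<longrightarrow> \<theta> \<le> 0 \<longrightarrow> 0 \<le> x \<longrightarrow> \<kappa> * bump b (x - y0) \<le> u (t0 + \<theta>) x"
      and t: "0 < t" "t \<le> T" and x: "0 \<le> x" for y0 t0 t x
  proof -
    define w where "w r y = v (max (-\<tau>) r) (y - y0)" for r y
    define F where "F r y = f (w r y)" for r y
    have w0: "0 \<le> w r y" for r y unfolding w_def by (rule vn) simp
    have wle: "w r y \<le> M" if "r \<le> T" for r y unfolding w_def by (rule vM) (use that T tau_pos in auto)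
    have pc: "continuous_on UNIV (\<lambda>p :: real \<times> real. (max (-\<tau>) (fst p), snd p - y0))" by (intro continuous_intros)
    have pr: "range (\<lambda>p :: real \<times> real. (max (-\<tau>) (fst p), snd p - y0)) \<subseteq> {-\<tau>..} \<times> UNIV" by auto
    from continuous_on_compose2[OF vc pc pr] have wc: "continuous_on UNIV (\<lambda>p. w (fst p) (snd p))"
      by (simp only: w_def case_prod_conv)
    have "continuous_on UNIV (\<lambda>p. F (fst p) (snd p))" unfolding F_def by (rule f_comp_continuous[OF wc w0])
    then have "(\<lambda>p. F (fst p) (snd p)) \<in> borel_measurable borel" by (rule borel_measurable_continuous_onI)
    then have Fm: "(\<lambda>(r, y). F r y) \<in> borel_measurable (borel \<Otimes>\<^sub>M borel)" by (simp add: borel_prod case_prod_beta')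
    have F0: "0 \<le> F r y" for r y unfolding F_def by (rule f_nonneg[OF w0])
    have FM: "F r y \<le> f M" if "r \<le> T" for r y unfolding F_def by (rule f_mono[OF w0 wle[OF that]])
    have FB: "\<bar>F r y\<bar> \<le> f M" if "r \<le> t - \<tau>" for r y using F0[of r y] FM[of r y] that t tau_pos by simp
    let ?g = "\<lambda>y. \<kappa> * bump b (y - y0)"
    let ?hv = "\<lambda>(s, y). indicator {0<..<t} s * F (t - s - \<tau>) y"
    let ?hu = "\<lambda>(s, y). indicator {0<..<t} s * reaction (t0 + t - s - \<tau>) y"
    have gm: "?g \<in> borel_measurable borel" by measurable
    have g0: "0 \<le> ?g y" "?g y \<le> \<kappa>" for y using br[of "y - y0"] \<kappa> mult_left_mono[of "bump b (y - y0)" 1 \<kappa>] by auto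
    have hvm: "bounded_measurable ?hv"
    proof (rule bounded_measurableI)
      have m: "(\<lambda>z. F (fst z) (snd z)) \<in> borel_measurable (borel \<Otimes>\<^sub>M borel)" using Fm by (simp add: case_prod_beta')
      have [measurable]: "(\<lambda>z. F (t - fst z - \<tau>) (snd z)) \<in> borel_measurable (borel \<Otimes>\<^sub>M borel)"
        using measurable_compose[of "\<lambda>z. (t - fst z - \<tau>, snd z)" "borel \<Otimes>\<^sub>M borel" "borel \<Otimes>\<^sub>M borel", OF _ m] by simp
      show "?hv \<in> borel_measurable (borel \<Otimes>\<^sub>M borel)" by (simp add: case_prod_beta')
      show "\<bar>?hv (s, y)\<bar> \<le> f M" for s y using FB[of "t - s - \<tau>" y] fM by (simp add: indicator_def)
    qed
    have "v t (x - y0) = line_semigroup d \<mu> t ?g x + (LBINT s:{0<..<t}. line_semigroup d \<mu> (t - s) (\<lambda>y. \<mu> * F (s - \<tau>) y) x)"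
    proof -
      have "line_semigroup d \<mu> (t - s) (\<lambda>y. \<mu> * f (v (s - \<tau>) y)) (x - y0) = line_semigroup d \<mu> (t - s) (\<lambda>y. \<mu> * F (s - \<tau>) y) x" if "0 < s" for s
        using that by (simp add: line_semigroup_translate F_def w_def)
      then have "(LBINT s:{0<..<t}. line_semigroup d \<mu> (t - s) (\<lambda>y. \<mu> * f (v (s - \<tau>) y)) (x - y0))
        = (LBINT s:{0<..<t}. line_semigroup d \<mu> (t - s) (\<lambda>y. \<mu> * F (s - \<tau>) y) x)"
        by (intro set_lebesgue_integral_cong) auto
      moreover have "line_semigroup d \<mu> t (v 0) (x - y0) = line_semigroup d \<mu> t ?g x"
        using tau_pos by (simp add: line_semigroup_translate vi)
      ultimately show ?thesis by (simp only: veq[OF t(1)])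
    qed
    also have "(LBINT s:{0<..<t}. line_semigroup d \<mu> (t - s) (\<lambda>y. \<mu> * F (s - \<tau>) y) x) = (\<integral>p. line_occ d \<mu> x p * ?hv p \<partial>plane)"
      using line_duhamel[where \<tau>=\<tau> and x=x, OF t(1) Fm FB] by (simp add: case_prod_beta')
    also have "line_semigroup d \<mu> t ?g x \<le> dirichlet_semigroup d \<mu> t ?g x + 2 * \<kappa> * exp (d * t - x)"
      by (rule line_semigroup_le_dirichlet[OF t(1) x gm g0])
    also have "(\<integral>p. line_occ d \<mu> x p * ?hv p \<partial>plane) \<le> half_int x ?hv + 2 * f M * exp (d * T - x)"
    proof (rule line_occ_le_half[OF x T hvm])
      show "0 \<le> ?hv p" for p using F0 by (cases p) (simp add: indicator_def)
      show "?hv (s, y) \<le> indicator {..<T} s * f M" for s y using FM[of "t - s - \<tau>" y] t fM tau_pos by (simp add: indicator_def)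
    qed
    also have "half_int x ?hv \<le> half_int x ?hu + L * C * exp (d * T - x)"
    proof -
      let ?e = "\<lambda>(s, y). indicator {0<..<T} s * exp (- \<bar>y\<bar>) :: real"
      have em: "bounded_measurable ?e" by (rule bounded_measurableI[of _ 1]) (auto simp: indicator_def)
      have "half_int x ?hv \<le> half_int x (\<lambda>p. ?hu p + (L * C) * ?e p)"
      proof (rule half_mono[OF x hvm bounded_measurable_add[OF bounded_measurable_reaction_window bounded_measurable_cmult[OF em]]])
        fix s y :: real assume s: "0 < s" "0 \<le> y"
        show "?hv (s, y) \<le> ?hu (s, y) + (L * C) * ?e (s, y)"
        proof (cases "s < t")
          case True
          define r where "r = t - s - \<tau>"
          have r: "-\<tau> \<le> r" "r \<le> real n * \<tau>" "r \<le> T" using True s t tau_pos by (auto simp: r_def T_def algebra_simps)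
          have "v r (y - y0) - u (t0 + r) y \<le> C * exp (- y)" by (rule IH[rule_format, OF t0 h[rule_format] r(1,2) s(2)])
          then have d1: "w r y \<le> u (t0 + r) y + C * exp (- y)" using r by (simp add: w_def max_absorb2)
          have tr: "- \<tau> \<le> t0 + r" using r t0 by simp
          have u0: "0 \<le> u (t0 + r) y" by (rule u_nonneg[OF tr s(2)])
          have "f (w r y) \<le> f (u (t0 + r) y) + (L * C) * exp (- y)"
          proof (cases "w r y \<le> u (t0 + r) y")
            case True
            then have "f (w r y) \<le> f (u (t0 + r) y)" by (rule f_mono[OF w0])
            then show ?thesis using L C by (simp add: add_increasing2)
          next
            case False
            then have "f (w r y) - f (u (t0 + r) y) \<le> L * (w r y - u (t0 + r) y)"
              using wle[OF r(3)] u0 by (intro L(2)) auto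
            also have "\<dots> \<le> L * (C * exp (- y))" using d1 L by (intro mult_left_mono) auto
            finally show ?thesis by simp
          qed
          moreover have "reaction (t0 + t - s - \<tau>) y = f (u (t0 + r) y)"
            using tr s by (subst reaction_eq) (auto simp: r_def algebra_simps)
          ultimately show ?thesis using True s t by (simp add: F_def r_def)
        next
          case False
          then show ?thesis using s L C by simp
        qed
      qed
      also have "\<dots> = half_int x ?hu + (L * C) * half_int x ?e"
        by (simp only: half_add[OF x bounded_measurable_reaction_window bounded_measurable_cmult[OF em]] half_cmult)
      also have "\<dots> \<le> half_int x ?hu + (L * C) * exp (d * T - x)"
        using half_int_exp_decay[OF x T] L C by (intro add_left_mono mult_left_mono) auto
      finally show ?thesis .
    qed
    also have "dirichlet_semigroup d \<mu> t ?g x \<le> dirichlet_semigroup d \<mu> t (u t0) x"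
    proof -
      have "dirichlet_semigroup d \<mu> t ?g x \<le> dirichlet_semigroup d \<mu> t (\<lambda>y. u t0 (max 0 y)) x"
      proof (rule dirichlet_semigroup_mono[OF t(1) x gm])
        show "\<bar>?g y\<bar> \<le> \<kappa>" for y using g0[of y] by simp
        show "(\<lambda>y. u t0 (max 0 y)) \<in> borel_measurable borel" using t0 tau_pos by (intro u_slice_measurable) simp
        show "\<bar>u t0 (max 0 y)\<bar> \<le> ubound" for y using u_nonneg[of t0 "max 0 y"] u_le_ubound[of t0 "max 0 y"] t0 tau_pos by simp
        show "?g y \<le> u t0 (max 0 y)" if "0 \<le> y" for y using h[rule_format, of 0 y] that tau_pos by (simp add: max_absorb2)
      qed
      also have "\<dots> = dirichlet_semigroup d \<mu> t (u t0) x" by (rule dirichlet_semigroup_cong) (simp add: max_absorb2)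
      finally show ?thesis .
    qed
    also have "2 * \<kappa> * exp (d * t - x) \<le> 2 * \<kappa> * exp (d * T - x)"
      using t d_pos \<kappa> by (intro mult_left_mono) auto
    finally have "v t (x - y0) \<le> (dirichlet_semigroup d \<mu> t (u t0) x + half_int x ?hu) + (2 * \<kappa> + 2 * f M + L * C) * exp (d * T - x)"
      by (simp add: algebra_simps)
    also have "dirichlet_semigroup d \<mu> t (u t0) x + half_int x ?hu \<le> u (t0 + t) x" by (rule u_restart[OF t0 t(1) x])
    finally show ?thesis by (simp add: C'_def exp_diff exp_minus field_simps)
  qed
  have "0 \<le> C'" using \<kappa> fM L C by (simp add: C'_def)
  then show ?case
  proof (intro exI[of _ "C'"] conjI allI impI)
    fix y0 t0 t x :: real
    assume t0: "0 \<le> t0" and h: "\<forall>\<theta> x. -\<tau> \<le> \<theta> \<longrightarrow> \<theta> \<le> 0 \<longrightarrow> 0 \<le> x \<longrightarrow> \<kappa> * bump b (x - y0) \<le> u (t0 + \<theta>) x"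
      and t: "- \<tau> \<le> t" "t \<le> real (Suc n) * \<tau>" and x: "0 \<le> x"
    show "v t (x - y0) - u (t0 + t) x \<le> C' * exp (- x)"
    proof (cases "0 < t")
      case True
      then show ?thesis using main[OF t0 h True _ x] t by (simp add: T_def)
    next
      case False
      then have "v t (x - y0) - u (t0 + t) x \<le> 0" using h[rule_format, of t x] vi[of t "x - y0"] t x by simp
      also have "0 \<le> C' * exp (- x)" using \<open>0 \<le> C'\<close> by simp
      finally show ?thesis .
    qed
  qed
qed

text \<open>Weinberger's argument: from the information that a single bump spreads over a
  distance slightly more than \<open>c2 T0\<close> within the time \<open>T0\<close> it
  follows, by comparison with translated copies, that the set of dominated bumps grows at
  speed \<open>c2\<close> forever. The extra time \<open>\<tau>\<close> in each round lets
  the solution stay above the new bumps during a whole delay interval, which is the initial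
  history of the next round.\<close>
lemma bump_spreading:
  assumes sp: "is_spreading_speed d \<mu> \<tau> f ustar cstar" and c2: "0 < c2" "c2 < cstar"
    and b: "0 < b" and \<kappa>: "0 < \<kappa>" "\<kappa> < ustar"
    and grow: "\<And>y0. X \<le> y0 \<Longrightarrow> \<exists>t0\<ge>0. \<forall>t\<ge>t0. \<forall>x\<ge>0. \<kappa> * bump b (x - y0) \<le> u t x"
  shows "\<exists>x0\<ge>X. \<forall>c<c2. \<exists>t1. \<forall>t\<ge>t1. \<forall>y x. x0 \<le> y \<longrightarrow> y \<le> c * t \<longrightarrow> 0 \<le> x \<longrightarrow> \<kappa> * bump b (x - y) \<le> u t x"
proof -
  note br = bump_range[OF b]
  define l where "l = pi / (2 * b)"
  have l: "0 < l" using b by (simp add: l_def)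
  define c3 where "c3 = (c2 + cstar) / 2"
  have c3: "c2 < c3" "c3 < cstar" "0 < c3" using c2 by (auto simp: c3_def)
  have mem: "(\<lambda>\<theta> x. \<kappa> * bump b x) \<in> bc_nonneg \<tau> UNIV"
    unfolding bc_nonneg_def
  proof (intro CollectI conjI ballI)
    show "continuous_on ({-\<tau>..0} \<times> UNIV) (\<lambda>(\<theta>, x). \<kappa> * bump b x)"
      unfolding case_prod_beta' by (intro continuous_intros bump_cont)
    have "\<forall>z\<in>(\<lambda>(\<theta>, x). \<kappa> * bump b x) ` ({-\<tau>..0} \<times> UNIV). norm z \<le> \<kappa> * 1"
    proof
      fix z assume "z \<in> (\<lambda>(\<theta>, x). \<kappa> * bump b x) ` ({-\<tau>..0} \<times> UNIV)"
      then obtain x where z: "z = \<kappa> * bump b x" by auto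
      have "\<kappa> * bump b x \<le> \<kappa> * 1" using br \<kappa> by (intro mult_left_mono) auto
      then show "norm z \<le> \<kappa> * 1" using br[of x] \<kappa> z by simp
    qed
    then show "bounded ((\<lambda>(\<theta>, x). \<kappa> * bump b x) ` ({-\<tau>..0} \<times> UNIV))" unfolding bounded_iff by (rule exI)
  qed (use br \<kappa> in simp)
  obtain v where v: "line_solution d \<mu> \<tau> f (\<lambda>\<theta> x. \<kappa> * bump b x) v" using line_solution_exists[OF mem] by (elim exE)
  have "\<not> vanishes_on \<tau> UNIV (\<lambda>\<theta> x. \<kappa> * bump b x)"
    using \<kappa> tau_pos by (auto simp: vanishes_on_def bump_def intro!: bexI[of _ 0] exI[of _ 0])
  moreover have "0 < cstar - c3" "cstar - c3 \<le> cstar" using c3 by auto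
  ultimately have lim: "((\<lambda>t. SUP x\<in>{x. \<bar>x\<bar> \<le> t * (cstar - (cstar - c3))}. \<bar>v t x - ustar\<bar>) \<longlongrightarrow> 0) at_top"
    using sp v mem unfolding is_spreading_speed_def by blast
  have "\<forall>\<^sub>F t in at_top. (SUP x\<in>{x. \<bar>x\<bar> \<le> t * (cstar - (cstar - c3))}. \<bar>v t x - ustar\<bar>) < (ustar - \<kappa>) / 2"
    by (rule order_tendstoD(2)[OF lim]) (use \<kappa> in simp)
  then obtain T1 where T1: "\<forall>t\<ge>T1. (SUP x\<in>{x. \<bar>x\<bar> \<le> t * (cstar - (cstar - c3))}. \<bar>v t x - ustar\<bar>) < (ustar - \<kappa>) / 2"
    unfolding eventually_at_top_linorder by (elim exE)
  have vbig: "(ustar + \<kappa>) / 2 < v t x" if t: "max T1 0 \<le> t" "\<bar>x\<bar> \<le> t * c3" for t x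
  proof -
    have "bounded ((\<lambda>(t, x). v t x) ` ({-\<tau>..t} \<times> UNIV))" using v by (simp add: line_solution_def mild_solution_def)
    then obtain B where B: "\<forall>z\<in>(\<lambda>(t, x). v t x) ` ({-\<tau>..t} \<times> UNIV). norm z \<le> B" unfolding bounded_iff by (elim exE)
    have vB: "\<bar>v t y\<bar> \<le> B" for y
    proof -
      have "v t y \<in> (\<lambda>(t, x). v t x) ` ({-\<tau>..t} \<times> UNIV)" using t tau_pos by force
      from B[rule_format, OF this] show ?thesis by simp
    qed
    have "\<bar>v t y - ustar\<bar> \<le> B + ustar" for y
      using abs_triangle_ineq4[of "v t y" ustar] vB[of y] ustar_pos by simp
    then have bdd: "bdd_above ((\<lambda>x. \<bar>v t x - ustar\<bar>) ` {x. \<bar>x\<bar> \<le> t * (cstar - (cstar - c3))})"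
      by (intro bdd_aboveI2)
    have "\<bar>v t x - ustar\<bar> \<le> (SUP x\<in>{x. \<bar>x\<bar> \<le> t * (cstar - (cstar - c3))}. \<bar>v t x - ustar\<bar>)"
      by (rule cSUP_upper[OF _ bdd]) (use t in simp)
    also have "\<dots> < (ustar - \<kappa>) / 2" using T1 t by simp
    finally show ?thesis unfolding abs_less_iff by (simp add: field_simps)
  qed
  \<comment> \<open>large enough that the speed \<open>c3\<close> covers, within the time
    \<open>T0\<close>, the distance \<open>c2 (T0 + \<tau>)\<close> and the half-width
    \<open>l\<close> of a bump\<close>
  define T0 where "T0 = max (max T1 0) ((\<tau> * c2 + l) / (c3 - c2))"
  have T0: "max T1 0 \<le> T0" "0 \<le> T0" by (auto simp: T0_def)
  have "(\<tau> * c2 + l) / (c3 - c2) \<le> T0" by (simp add: T0_def)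
  then have T0c: "(T0 + \<tau>) * c2 + l \<le> T0 * c3" using c3 by (simp add: field_simps)
  obtain n0 where "T0 / \<tau> \<le> real n0" using real_arch_simple by blast
  then have n0: "T0 \<le> real n0 * \<tau>" using tau_pos by (simp add: field_simps)
  obtain C where C: "0 \<le> C" and comp: "\<forall>y0 t0. 0 \<le> t0 \<longrightarrow> (\<forall>\<theta> x. -\<tau> \<le> \<theta> \<longrightarrow> \<theta> \<le> 0 \<longrightarrow> 0 \<le> x \<longrightarrow> \<kappa> * bump b (x - y0) \<le> u (t0 + \<theta>) x) \<longrightarrow>
     (\<forall>t x. -\<tau> \<le> t \<longrightarrow> t \<le> real n0 * \<tau> \<longrightarrow> 0 \<le> x \<longrightarrow> v t (x - y0) - u (t0 + t) x \<le> C * exp (- x))"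
    using line_half_comparison[OF v b \<kappa>(1), of n0] by (elim exE conjE)
  have "((\<lambda>x :: real. exp (- x)) \<longlongrightarrow> 0) at_top" by real_asymp
  then have "((\<lambda>x :: real. C * exp (- x)) \<longlongrightarrow> 0) at_top" by (rule tendsto_mult_right_zero)
  from tendsto_zero_ex_less[OF this, of "(ustar - \<kappa>) / 2"] \<kappa> obtain R where R: "0 < R" "C * exp (- R) < (ustar - \<kappa>) / 2" by auto
  \<comment> \<open>bumps centred beyond \<open>x0\<close> live where the boundary error is
    less than half of \<open>ustar - \<kappa>\<close>\<close>
  define x0 where "x0 = max X (R + l)"
  have x0: "X \<le> x0" "R + l \<le> x0" by (auto simp: x0_def)
  from grow[OF x0(1)] obtain t0 where t0: "0 \<le> t0" "\<forall>t\<ge>t0. \<forall>x\<ge>0. \<kappa> * bump b (x - x0) \<le> u t x" by (elim exE conjE)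
  define S where "S = T0 + \<tau>"
  have S: "0 < S" using T0 tau_pos by (simp add: S_def)
  have iter: "\<forall>t y x. t0 + real n * S \<le> t \<longrightarrow> x0 \<le> y \<longrightarrow> y \<le> x0 + real n * (S * c2) \<longrightarrow> 0 \<le> x \<longrightarrow> \<kappa> * bump b (x - y) \<le> u t x" for n
  proof (induction n)
    case 0
    show ?case
    proof (intro allI impI)
      fix t y x :: real assume "t0 + real 0 * S \<le> t" "x0 \<le> y" "y \<le> x0 + real 0 * (S * c2)" "0 \<le> x"
      then have "y = x0" "t0 \<le> t" by auto
      then show "\<kappa> * bump b (x - y) \<le> u t x" using t0(2) \<open>0 \<le> x\<close> by simp
    qed
  next
    case (Suc n)
    show ?case
    proof (intro allI impI)
      fix t y x :: real assume t: "t0 + real (Suc n) * S \<le> t" and y: "x0 \<le> y" "y \<le> x0 + real (Suc n) * (S * c2)" and x: "0 \<le> x"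
      \<comment> \<open>the centre of the old bump that produces the new one at
        \<open>y\<close>\<close>
      define y' where "y' = max x0 (y - S * c2)"
      have Sc: "0 \<le> S * c2" using S c2 by simp
      have nS: "0 \<le> real n * (S * c2)" using Sc by simp
      have y': "x0 \<le> y'" "y' \<le> x0 + real n * (S * c2)" "y' \<le> y" "y - S * c2 \<le> y'"
        using y Sc nS by (auto simp: y'_def algebra_simps)
      have t'': "0 \<le> t - T0" "t0 + real n * S \<le> t - T0 - \<tau>"
        using t t0(1) mult_nonneg_nonneg[of "real n" S] S tau_pos by (auto simp: S_def algebra_simps)
      show "\<kappa> * bump b (x - y) \<le> u t x"
      proof (cases "\<bar>x - y\<bar> \<le> l")
        case False
        then have "bump b (x - y) = 0" by (intro bump_outside b) (simp add: l_def)
        then show ?thesis using u_nonneg[of t x] t'' T0 x tau_pos by simp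
      next
        case True
        have hist: "\<kappa> * bump b (x' - y') \<le> u ((t - T0) + \<theta>) x'" if "-\<tau> \<le> \<theta>" "\<theta> \<le> 0" "0 \<le> x'" for \<theta> x'
          using Suc[rule_format, of "(t - T0) + \<theta>" y' x'] that t'' y' by simp
        have T0': "- \<tau> \<le> T0" using T0 tau_pos by simp
        have "v T0 (x - y') - u ((t - T0) + T0) x \<le> C * exp (- x)"
          by (rule comp[rule_format, OF t''(1) hist T0' n0 x])
        moreover have "(ustar + \<kappa>) / 2 < v T0 (x - y')"
        proof (rule vbig[OF T0(1)])
          have "\<bar>x - y'\<bar> \<le> l + S * c2" using True y' by linarith
          also have "\<dots> \<le> T0 * c3" using T0c by (simp add: S_def)
          finally show "\<bar>x - y'\<bar> \<le> T0 * c3" .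
        qed
        moreover have "C * exp (- x) \<le> C * exp (- R)"
        proof -
          have "R \<le> x" using True y(1) x0(2) by linarith
          then show ?thesis using C by (intro mult_left_mono) auto
        qed
        ultimately have "\<kappa> \<le> u t x" using R(2) by (simp add: field_simps)
        moreover have "\<kappa> * bump b (x - y) \<le> \<kappa> * 1" using br \<kappa> by (intro mult_left_mono) auto
        ultimately show ?thesis by simp
      qed
    qed
  qed
  have "\<exists>t1. \<forall>t\<ge>t1. \<forall>y x. x0 \<le> y \<longrightarrow> y \<le> c * t \<longrightarrow> 0 \<le> x \<longrightarrow> \<kappa> * bump b (x - y) \<le> u t x" if c: "c < c2" for c
  proof (intro exI allI impI)
    fix t y x :: real assume t: "max t0 ((t0 + S) * c2 / (c2 - c)) \<le> t" and y: "x0 \<le> y" "y \<le> c * t" and x: "0 \<le> x"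
    have t1: "t0 \<le> t" "(t0 + S) * c2 / (c2 - c) \<le> t" using t by auto
    then have t2: "c * t \<le> (t - t0 - S) * c2" using c by (simp add: field_simps)
    \<comment> \<open>the number of rounds completed at time \<open>t\<close>\<close>
    define n where "n = nat \<lfloor>(t - t0) / S\<rfloor>"
    have "0 \<le> (t - t0) / S" using t1 S by simp
    then have "real n \<le> (t - t0) / S" "(t - t0) / S - 1 \<le> real n" unfolding n_def by linarith+
    then have n: "real n * S \<le> t - t0" "t - t0 - S \<le> real n * S" using S by (auto simp: field_simps)
    have "(t - t0 - S) * c2 \<le> real n * S * c2" using n(2) c2 by (intro mult_right_mono) auto
    moreover have "0 \<le> x0" using x0(2) R l by simp
    ultimately have "y \<le> x0 + real n * (S * c2)" using y t2 by (simp add: mult.assoc)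
    then show "\<kappa> * bump b (x - y) \<le> u t x" using iter[of n] n(1) y x by simp
  qed
  then show ?thesis using x0(1) by blast
qed

end

section \<open>Ramps and convergence to the steady state\<close>

lemma bump_antimono:
  assumes "0 < b" "\<bar>y\<bar> \<le> \<bar>x\<bar>"
  shows "bump b x \<le> bump b y"
proof -
  have "b * \<bar>y\<bar> \<le> b * \<bar>x\<bar>" using assms by (intro mult_left_mono) auto
  then have "min (pi / 2) (b * \<bar>y\<bar>) \<le> min (pi / 2) (b * \<bar>x\<bar>)" by (intro min.mono) auto
  moreover have "0 \<le> min (pi / 2) (b * \<bar>y\<bar>)" using assms(1) by simp
  moreover have "min (pi / 2) (b * \<bar>x\<bar>) \<le> pi / 2" by simp
  then have "min (pi / 2) (b * \<bar>x\<bar>) \<le> pi" using pi_ge_zero by linarith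
  ultimately show ?thesis unfolding bump_def by (intro cos_monotone_0_pi_le)
qed

text \<open>The supremum of all bumps of height \<open>\<kappa>\<close> centred at
  \<open>X\<close> or to the right of it.\<close>
definition ramp :: "real \<Rightarrow> real \<Rightarrow> real \<Rightarrow> real \<Rightarrow> real" where
  "ramp \<kappa> b X x = \<kappa> * bump b (min 0 (x - X))"

text \<open>At each point the supremum is attained by a bump whose centre is the point
  itself or \<open>X\<close>.\<close>
lemma ramp_eq: "ramp \<kappa> b X x = \<kappa> * bump b (x - max X x)"
  by (cases "x \<le> X") (auto simp: ramp_def min_def max_def)

lemma ramp_ge:
  assumes "0 < b" "0 < \<kappa>" "X \<le> y0" shows "\<kappa> * bump b (y - y0) \<le> ramp \<kappa> b X y"
  unfolding ramp_def using assms by (intro mult_left_mono bump_antimono) (auto simp: min_def)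

lemma ramp_mono:
  assumes "0 < b" "0 < \<kappa>" "x \<le> y" shows "ramp \<kappa> b X x \<le> ramp \<kappa> b X y"
  unfolding ramp_def using assms by (intro mult_left_mono bump_antimono) (auto simp: min_def)

context kinetics
begin

lemma ramp_admissible:
  assumes "0 < b" "0 < \<kappa>" "\<kappa> < ustar"
  shows "admissible (ramp \<kappa> b X)"
proof -
  have "ramp \<kappa> b X \<in> borel_measurable borel" unfolding ramp_def[abs_def] by measurable
  moreover have R: "0 \<le> ramp \<kappa> b X x" "ramp \<kappa> b X x \<le> \<kappa> * 1" for x
    unfolding ramp_def using assms bump_range[OF assms(1)] by (auto intro!: mult_left_mono)
  moreover have "ramp \<kappa> b X x \<le> ustar" for x using R(2)[of x] assms(3) by simp
  ultimately show ?thesis by (simp add: admissible_def)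
qed

text \<open>At \<open>x\<close> the ramp equals one of the bumps below it, and the transform
  of the ramp dominates the transform of this bump.\<close>
lemma ramp_subsolution:
  assumes b: "0 < b" and \<kappa>: "0 < \<kappa>" "\<kappa> < ustar" and r: "0 < r" "\<And>v. 0 \<le> v \<Longrightarrow> v \<le> \<kappa> \<Longrightarrow> r * v \<le> f v" and rC: "1 < r * C"
    and sub: "\<And>x y0. X \<le> y0 \<Longrightarrow> 0 \<le> x \<Longrightarrow> C * bump b (x - y0) \<le> half_int x (bump_window b K y0)"
    and x: "0 \<le> x"
  shows "ramp \<kappa> b X x \<le> step (ramp \<kappa> b X) x"
proof -
  note br = bump_range[OF b]
  define y0 where "y0 = max X x"
  have y0: "X \<le> y0" by (simp add: y0_def)
  note A = ramp_admissible[OF b \<kappa>, of X]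
  have bm: "bounded_measurable (bump_window b K y0)"
    using br by (intro bounded_measurableI[of _ 1]) (auto simp: indicator_def)
  have "ramp \<kappa> b X x = 1 * (\<kappa> * bump b (x - y0))" by (simp add: ramp_eq y0_def)
  also have "\<dots> \<le> (r * C) * (\<kappa> * bump b (x - y0))" using rC \<kappa> br by (intro mult_right_mono) auto
  also have "\<dots> = (r * \<kappa>) * (C * bump b (x - y0))" by simp
  also have "\<dots> \<le> (r * \<kappa>) * half_int x (bump_window b K y0)"
    using r \<kappa> sub[OF y0 x] by (intro mult_left_mono) auto
  also have "\<dots> = half_int x (\<lambda>p. (r * \<kappa>) * (bump_window b K y0) p)" by (simp only: half_cmult)
  also have "\<dots> \<le> half_int x (\<lambda>(s, y). f (ramp \<kappa> b X y))"
  proof (rule half_mono[OF x bounded_measurable_cmult[OF bm] bounded_measurable_space[OF adm_f(1,2)[OF A]]])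
    fix s y :: real
    have 0: "0 \<le> \<kappa> * bump b (y - y0)" using br \<kappa> by simp
    have "\<kappa> * bump b (y - y0) \<le> \<kappa> * 1" using br \<kappa> by (intro mult_left_mono) auto
    then have "r * (\<kappa> * bump b (y - y0)) \<le> f (\<kappa> * bump b (y - y0))" using 0 by (intro r(2)) auto
    also have "\<dots> \<le> f (ramp \<kappa> b X y)" by (rule f_mono[OF 0 ramp_ge[OF b \<kappa>(1) y0]])
    finally show "(r * \<kappa>) * (bump_window b K y0) (s, y) \<le> (\<lambda>(s, y). f (ramp \<kappa> b X y)) (s, y)"
      using adm_f(3)[OF A, of y] by (simp add: indicator_def mult.assoc)
  qed
  also have "\<dots> = step (ramp \<kappa> b X) x" using half_int_green[OF adm_f(1,2)[OF A] x] x by (simp add: step_def max_absorb2)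
  finally show ?thesis .
qed

end

context half_line_solution
begin

lemma step_nonneg_arg: "0 \<le> x \<Longrightarrow> step w x = green (\<lambda>y. f (w y)) x"
  by (simp add: step_def max_absorb2)

lemma upper_iterates: "upper ((step ^^ n) (\<lambda>_. ustar))"
proof (induction n)
  case 0
  show ?case using upper_ustar by simp
next
  case (Suc n)
  have A: "admissible ((step ^^ n) (\<lambda>_. ustar))" by (rule iterates(1)[OF adm_const]) simp
  have "upper (green (\<lambda>y. f ((step ^^ n) (\<lambda>_. ustar) y)))"
    by (rule upper_green[OF Suc, of ustar]) (use A in \<open>auto simp: admissible_def\<close>)
  then show ?case by (rule upper_mono) (simp add: step_nonneg_arg)
qed

lemma lower_iterates:
  assumes c: "0 < c" and w: "admissible w" "\<And>x y. 0 \<le> x \<Longrightarrow> x \<le> y \<Longrightarrow> w x \<le> w y" "lower c w"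
  shows "lower c ((step ^^ n) w)"
proof (induction n)
  case (Suc n)
  have A: "admissible ((step ^^ n) w)" by (rule iterates(1)[OF w(1,2)])
  have "lower c (green (\<lambda>y. f ((step ^^ n) w y)))"
    by (rule lower_green[OF Suc c, of ustar]) (use A in \<open>auto simp: admissible_def\<close>)
  then show ?case unfolding lower_def by (simp add: step_nonneg_arg)
qed (use w in simp)

lemma lower_ramp:
  assumes b: "0 < b" and \<kappa>: "0 < \<kappa>" and c2: "0 < c2" 
    and low: "\<forall>c<c2. \<exists>t1. \<forall>t\<ge>t1. \<forall>y x. x0 \<le> y \<longrightarrow> y \<le> c * t \<longrightarrow> 0 \<le> x \<longrightarrow> \<kappa> * bump b (x - y) \<le> u t x"
  shows "lower c2 (ramp \<kappa> b x0)"
  unfolding lower_def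
proof (intro allI impI)
  fix c' \<eta> :: real assume c': "c' < c2" and \<eta>: "0 < \<eta>"
  define c where "c = max c' (c2 / 2)"
  have c: "c < c2" "0 < c" "c' \<le> c" using c' c2 by (auto simp: c_def)
  from low[rule_format, OF c(1)] obtain t1 where t1: "\<forall>t\<ge>t1. \<forall>y x. x0 \<le> y \<longrightarrow> y \<le> c * t \<longrightarrow> 0 \<le> x \<longrightarrow> \<kappa> * bump b (x - y) \<le> u t x"
    by (elim exE)
  have "ramp \<kappa> b x0 x - \<eta> \<le> u t x" if t: "max (max t1 0) (x0 / c) \<le> t" and x: "0 \<le> x" "x \<le> c' * t" for t x
  proof -
    have "x0 / c \<le> t" "0 \<le> t" "t1 \<le> t" using t by auto
    then have "x0 \<le> c * t" using c by (simp add: field_simps)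
    moreover have "x \<le> c * t" using x mult_right_mono[OF c(3) \<open>0 \<le> t\<close>] by linarith
    ultimately have "\<kappa> * bump b (x - max x0 x) \<le> u t x"
      using t1[rule_format, OF \<open>t1 \<le> t\<close>, of "max x0 x" x] x by simp
    then show ?thesis using \<eta> by (simp add: ramp_eq)
  qed
  then show "\<forall>\<^sub>F t in at_top. \<forall>x. 0 \<le> x \<longrightarrow> x \<le> c' * t \<longrightarrow> ramp \<kappa> b x0 x - \<eta> \<le> u t x"
    by (intro eventually_mono[OF eventually_ge_at_top[of "max (max t1 0) (x0 / c)"]]) simp
qed

text \<open>The solution is squeezed between iterates that are uniformly close to
  \<open>W\<close> from above and from below.\<close>
lemma cone_convergence:
  assumes c: "0 < c1" "c1 < c2" and st: "steady W" and cont: "continuous_on {0..} W"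
    and Wmono: "\<And>x y. 0 \<le> x \<Longrightarrow> x \<le> y \<Longrightarrow> W x \<le> W y" and top: "(W \<longlongrightarrow> ustar) at_top"
    and dn: "\<And>x. (\<lambda>n. (step ^^ n) (\<lambda>_. ustar) x) \<longlonglongrightarrow> W x"
    and w: "admissible w" "\<And>x y. 0 \<le> x \<Longrightarrow> x \<le> y \<Longrightarrow> w x \<le> w y" "lower c2 w"
    and up: "\<And>x. 0 \<le> x \<Longrightarrow> (\<lambda>n. (step ^^ n) w x) \<longlonglongrightarrow> W x"
  shows "((\<lambda>t. SUP x\<in>{0..t * c1}. \<bar>u t x - W x\<bar>) \<longlongrightarrow> 0) at_top"
proof (rule tendstoI)
  fix e :: real assume e: "0 < e"
  define \<eta> where "\<eta> = e / 4"
  have \<eta>: "0 < \<eta>" using e by (simp add: \<eta>_def)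
  have Wb: "0 \<le> W x" "W x \<le> ustar" for x using st by (auto simp: steady_def admissible_def)
  have c2: "0 < c2" using c by simp
  have A1: "admissible ((step ^^ n) (\<lambda>_. ustar))" for n by (rule iterates(1)[OF adm_const]) simp
  have A2: "admissible ((step ^^ n) w)" for n by (rule iterates(1)[OF w(1,2)])
  have "\<exists>n. \<forall>x\<ge>0. \<bar>(step ^^ n) (\<lambda>_. ustar) x - W x\<bar> \<le> \<eta>"
  proof (rule monotone_uniform_approx[OF _ _ _ _ _ top cont \<eta>])
    show "W x \<le> W y" if "0 \<le> x" "x \<le> y" for x y by (rule Wmono[OF that])
    show "(\<lambda>n. (step ^^ n) (\<lambda>_. ustar) x) \<longlonglongrightarrow> W x" for x by (rule dn)
    show "(step ^^ n) (\<lambda>_. ustar) x \<le> (step ^^ n) (\<lambda>_. ustar) y" if "0 \<le> x" "x \<le> y" for n x y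
      by (rule iterates(2)[OF adm_const _ that]) simp
    show "(step ^^ n) (\<lambda>_. ustar) x \<le> ustar" for n x using A1 by (simp add: admissible_def)
  qed (rule Wb)
  then obtain n where n: "\<forall>x\<ge>0. \<bar>(step ^^ n) (\<lambda>_. ustar) x - W x\<bar> \<le> \<eta>" by (elim exE)
  have "\<exists>n. \<forall>x\<ge>0. \<bar>(step ^^ n) w x - W x\<bar> \<le> \<eta>"
  proof (rule monotone_uniform_approx[OF _ _ _ _ _ top cont \<eta>])
    show "W x \<le> W y" if "0 \<le> x" "x \<le> y" for x y by (rule Wmono[OF that])
    show "(\<lambda>n. (step ^^ n) w x) \<longlonglongrightarrow> W x" if "0 \<le> x" for x by (rule up[OF that])
    show "(step ^^ n) w x \<le> (step ^^ n) w y" if "0 \<le> x" "x \<le> y" for n x y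
      by (rule iterates(2)[OF w(1,2) that])
    show "(step ^^ n) w x \<le> ustar" for n x using A2 by (simp add: admissible_def)
  qed (rule Wb)
  then obtain m where m: "\<forall>x\<ge>0. \<bar>(step ^^ m) w x - W x\<bar> \<le> \<eta>" by (elim exE)
  obtain t1 where t1: "\<forall>t\<ge>t1. \<forall>x\<ge>0. u t x \<le> (step ^^ n) (\<lambda>_. ustar) x + \<eta>"
    using upperD[OF upper_iterates[of n] \<eta>] by (elim exE)
  obtain t2 where t2: "\<forall>t\<ge>t2. \<forall>x. 0 \<le> x \<longrightarrow> x \<le> c1 * t \<longrightarrow> (step ^^ m) w x - \<eta> \<le> u t x"
  proof -
    have "lower c2 ((step ^^ m) w)" by (rule lower_iterates[OF c2 w(1) _ w(3)]) (rule w(2))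
    from lowerD[OF this c(2) \<eta>] that show thesis by (elim exE)
  qed
  have "dist (SUP x\<in>{0..t * c1}. \<bar>u t x - W x\<bar>) 0 < e" if t: "max (max t1 t2) 0 \<le> t" for t
  proof -
    have t': "t1 \<le> t" "t2 \<le> t" "0 \<le> t" using t by auto
    have b: "\<bar>u t x - W x\<bar> \<le> 2 * \<eta>" if x: "x \<in> {0..t * c1}" for x
    proof -
      have x': "0 \<le> x" "x \<le> c1 * t" using x by (auto simp: mult.commute)
      have "\<bar>(step ^^ n) (\<lambda>_. ustar) x - W x\<bar> \<le> \<eta>" "\<bar>(step ^^ m) w x - W x\<bar> \<le> \<eta>" using n m x' by auto
      moreover have "u t x \<le> (step ^^ n) (\<lambda>_. ustar) x + \<eta>" using t1 t' x' by blast
      moreover have "(step ^^ m) w x - \<eta> \<le> u t x" using t2 t' x' by blast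
      ultimately show ?thesis by linarith
    qed
    have ne: "{0..t * c1} \<noteq> {}" using t' c by simp
    have "(SUP x\<in>{0..t * c1}. \<bar>u t x - W x\<bar>) \<le> 2 * \<eta>" by (rule cSUP_least[OF ne b])
    moreover have "bdd_above ((\<lambda>x. \<bar>u t x - W x\<bar>) ` {0..t * c1})" using b by (rule bdd_aboveI2)
    then have "\<bar>u t 0 - W 0\<bar> \<le> (SUP x\<in>{0..t * c1}. \<bar>u t x - W x\<bar>)" by (intro cSUP_upper) (use t' c in simp_all)
    then have "0 \<le> (SUP x\<in>{0..t * c1}. \<bar>u t x - W x\<bar>)" by linarith
    ultimately show ?thesis using e by (simp add: dist_real_def \<eta>_def)
  qed
  then show "\<forall>\<^sub>F t in at_top. dist (SUP x\<in>{0..t * c1}. \<bar>u t x - W x\<bar>) 0 < e"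
    by (intro eventually_mono[OF eventually_ge_at_top[of "max (max t1 t2) 0"]]) simp
qed

end

context kinetics
begin

text \<open>The frequency \<open>b\<close> of the bump is chosen such that its eigenvalue
  \<open>C = 2 / (r + 1)\<close> satisfies \<open>r C > 1\<close>. The steady state is the
  limit of the decreasing iterates; the increasing iterates of the ramps have the same limit
  by uniqueness, whatever the position \<open>x0\<close> of the ramp, which depends on the
  solution and on \<open>\<epsilon>\<close>.\<close>
theorem spreading_to_steady_state:
  assumes sp: "is_spreading_speed d \<mu> \<tau> f ustar cstar"
  shows "\<exists>W. connecting_steady_state d \<mu> f ustar W \<and>
           (\<forall>V. connecting_steady_state d \<mu> f ustar V \<longrightarrow> (\<forall>x\<ge>0. V x = W x)) \<and>
           (\<forall>\<epsilon> \<phi> u. 0 < \<epsilon> \<longrightarrow> \<epsilon> < cstar \<longrightarrow>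
              \<phi> \<in> C_plus \<tau> \<longrightarrow> \<not> vanishes_on \<tau> {0..} \<phi> \<longrightarrow> dirichlet_solution d \<mu> \<tau> f \<phi> u \<longrightarrow>
              ((\<lambda>t. SUP x\<in>{0..t * (cstar - \<epsilon>)}. \<bar>u t x - W x\<bar>) \<longlongrightarrow> 0) at_top)"
proof -
  obtain r \<kappa> where r: "1 < r" "0 < \<kappa>" "\<kappa> < ustar" "\<And>v. 0 \<le> v \<Longrightarrow> v \<le> \<kappa> \<Longrightarrow> r * v \<le> f v"
    using f_slope by blast
  have r0: "0 < r" using r by simp
  define b where "b = a * sqrt ((r - 1) / 2)"
  define C where "C = a\<^sup>2 / (a\<^sup>2 + b\<^sup>2)"
  have b: "0 < b" using a_pos r by (simp add: b_def)
  have "a\<^sup>2 + b\<^sup>2 = a\<^sup>2 * ((r + 1) / 2)" using r by (simp add: b_def power_mult_distrib field_simps)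
  then have "C = a\<^sup>2 / (a\<^sup>2 * ((r + 1) / 2))" by (simp only: C_def)
  then have "C = 2 / (r + 1)" using a_pos by simp
  then have rC: "1 < r * C" using r by simp
  have "\<exists>K X. 0 < K \<and> pi / (2 * b) < X \<and> (\<forall>y0 x. X \<le> y0 \<longrightarrow> 0 \<le> x \<longrightarrow>
      C * bump b (x - y0) \<le> half_int x (bump_window b K y0))"
  proof (rule bump_subsolution[OF b])
    fix K X :: real
    assume KX: "0 < K" "pi / (2 * b) < X" and sub: "\<And>x y0. X \<le> y0 \<Longrightarrow> 0 \<le> x \<Longrightarrow>
      a\<^sup>2 / (a\<^sup>2 + b\<^sup>2) * bump b (x - y0) \<le> half_int x (bump_window b K y0)"
    show ?thesis unfolding C_def by (intro exI[of _ K] exI[of _ X] conjI KX allI impI sub)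
  qed
  then obtain K X where K: "0 < K" and X: "pi / (2 * b) < X"
    and sub': "\<forall>y0 x. X \<le> y0 \<longrightarrow> 0 \<le> x \<longrightarrow> C * bump b (x - y0) \<le> half_int x (bump_window b K y0)"
    by (elim exE conjE)
  note sub = sub'[rule_format]
  have rampW: "\<exists>W. steady W \<and> (W \<longlongrightarrow> ustar) at_top \<and> (\<forall>x\<ge>0. (\<lambda>n. (step ^^ n) (ramp \<kappa> b x0) x) \<longlonglongrightarrow> W x)"
    if x0: "X \<le> x0" for x0
  proof -
    have "0 < x0" using X x0 b pi_gt_zero divide_pos_pos[of pi "2 * b"] by linarith
    then have "0 < ramp \<kappa> b x0 x0" "0 \<le> x0" using r by (simp_all add: ramp_def bump_def)
    note pos = this
    have sub0: "C * bump b (x - y0) \<le> half_int x (bump_window b K y0)"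
      if "x0 \<le> y0" "0 \<le> x" for x y0
      using that x0 by (intro sub) auto
    show ?thesis
    proof (rule increasing_iterates)
      show "admissible (ramp \<kappa> b x0)" by (rule ramp_admissible[OF b r(2,3)])
      show "ramp \<kappa> b x0 x \<le> ramp \<kappa> b x0 y" if "x \<le> y" for x y by (rule ramp_mono[OF b r(2) that])
      show "ramp \<kappa> b x0 x \<le> step (ramp \<kappa> b x0) x" if "0 \<le> x" for x
        by (rule ramp_subsolution[OF b r(2,3) r0 r(4) rC sub0 that])
      show "0 < ramp \<kappa> b x0 x0" "0 \<le> x0" by (rule pos)+
      fix W assume W: "steady W" "(W \<longlongrightarrow> ustar) at_top" and lim: "\<And>x. 0 \<le> x \<Longrightarrow> (\<lambda>n. (step ^^ n) (ramp \<kappa> b x0) x) \<longlonglongrightarrow> W x"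
      show ?thesis by (intro exI[of _ W] conjI W allI impI lim)
    qed
  qed
  from rampW[OF order_refl] obtain V0 where V0: "steady V0" "(V0 \<longlongrightarrow> ustar) at_top" by (elim exE conjE)
  have "\<exists>W. steady W \<and> (W \<longlongrightarrow> ustar) at_top \<and> (\<forall>x. (\<lambda>n. (step ^^ n) (\<lambda>_. ustar) x) \<longlonglongrightarrow> W x) \<and>
    (\<forall>x y. 0 \<le> x \<longrightarrow> x \<le> y \<longrightarrow> W x \<le> W y) \<and> (\<forall>V x. steady V \<longrightarrow> V x \<le> W x)"
  proof (rule decreasing_iterates[OF V0])
    fix W assume W: "steady W" "(W \<longlongrightarrow> ustar) at_top" and lim: "\<And>x. (\<lambda>n. (step ^^ n) (\<lambda>_. ustar) x) \<longlonglongrightarrow> W x"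
      and mono: "\<And>x y. 0 \<le> x \<Longrightarrow> x \<le> y \<Longrightarrow> W x \<le> W y" and max: "\<And>V x. steady V \<Longrightarrow> V x \<le> W x"
    show ?thesis by (intro exI[of _ W] conjI W allI impI lim) (erule mono max, assumption?)+
  qed
  then obtain W where W12: "steady W" "(W \<longlongrightarrow> ustar) at_top" and W3: "\<forall>x. (\<lambda>n. (step ^^ n) (\<lambda>_. ustar) x) \<longlonglongrightarrow> W x"
    and W4: "\<forall>x y. 0 \<le> x \<longrightarrow> x \<le> y \<longrightarrow> W x \<le> W y" and W5: "\<forall>V x. steady V \<longrightarrow> V x \<le> W x"
    by (elim exE conjE)
  note W = W12 W3[rule_format] W4[rule_format] W5[rule_format]
  have uniq: "V = W" if "steady V" "(V \<longlongrightarrow> ustar) at_top" for V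
    by (rule steady_unique[OF that W(1,2) W(5)[OF that(1)]])
  show ?thesis
  proof (intro exI[of _ W] conjI allI impI)
    show "connecting_steady_state d \<mu> f ustar W" by (rule steady_imp_connecting[OF W(1,2)])
  next
    fix V x assume V: "connecting_steady_state d \<mu> f ustar V" and x: "0 \<le> (x :: real)"
    have "(V \<longlongrightarrow> ustar) at_top" using V by (simp add: connecting_steady_state_def)
    then have "((\<lambda>x. V (max 0 x)) \<longlongrightarrow> ustar) at_top"
      by (rule Lim_transform_eventually) (rule eventually_mono[OF eventually_ge_at_top[of 0]], simp add: max_absorb2)
    then have "(\<lambda>x. V (max 0 x)) = W" by (rule uniq[OF classical_imp_steady[OF V]])
    from fun_cong[OF this, of x] show "V x = W x" using x by (simp add: max_absorb2)
  next
    fix \<epsilon> \<phi> u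
    assume \<epsilon>: "0 < \<epsilon>" "\<epsilon> < cstar" and \<phi>: "\<phi> \<in> C_plus \<tau>" and nt: "\<not> vanishes_on \<tau> {0..} \<phi>"
      and sol: "dirichlet_solution d \<mu> \<tau> f \<phi> u"
    interpret half_line_solution d \<mu> \<tau> ustar f f' \<phi> u by unfold_locales (fact \<phi> sol)+
    \<comment> \<open>any speed strictly between \<open>cstar - \<epsilon>\<close> and
      \<open>cstar\<close>\<close>
    define c2 where "c2 = cstar - \<epsilon> / 2"
    have c2: "0 < c2" "c2 < cstar" "0 < cstar - \<epsilon>" "cstar - \<epsilon> < c2" using \<epsilon> by (auto simp: c2_def)
    have grow: "\<exists>t0\<ge>0. \<forall>t\<ge>t0. \<forall>x\<ge>0. \<kappa> * bump b (x - y0) \<le> u t x" if y0: "X \<le> y0" for y0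
      by (rule bump_growth[OF nt b r(2) r0 r(4) rC K sub[OF y0]]) (use X y0 in simp_all)
    have "\<exists>x0\<ge>X. \<forall>c<c2. \<exists>t1. \<forall>t\<ge>t1. \<forall>y x. x0 \<le> y \<longrightarrow> y \<le> c * t \<longrightarrow> 0 \<le> x \<longrightarrow> \<kappa> * bump b (x - y) \<le> u t x"
      by (rule bump_spreading[OF sp c2(1,2) b r(2,3)]) (rule grow)
    then obtain x0 where x0: "X \<le> x0"
      and low: "\<forall>c<c2. \<exists>t1. \<forall>t\<ge>t1. \<forall>y x. x0 \<le> y \<longrightarrow> y \<le> c * t \<longrightarrow> 0 \<le> x \<longrightarrow> \<kappa> * bump b (x - y) \<le> u t x"
      by (elim exE conjE)
    from rampW[OF x0] obtain V where V: "steady V" "(V \<longlongrightarrow> ustar) at_top"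
      and Vlim: "\<forall>x\<ge>0. (\<lambda>n. (step ^^ n) (ramp \<kappa> b x0) x) \<longlonglongrightarrow> V x" by (elim exE conjE)
    have VW: "V = W" by (rule uniq[OF V])
    have Wc: "continuous_on {0..} W" by (rule continuous_on_subset[OF steady_cont(1)[OF W(1)]]) simp
    show "((\<lambda>t. SUP x\<in>{0..t * (cstar - \<epsilon>)}. \<bar>u t x - W x\<bar>) \<longlongrightarrow> 0) at_top"
    proof (rule cone_convergence[OF c2(3,4) W(1) Wc])
      show "(W \<longlongrightarrow> ustar) at_top" by (rule W(2))
      show "(\<lambda>n. (step ^^ n) (\<lambda>_. ustar) x) \<longlonglongrightarrow> W x" for x by (rule W(3))
      show "admissible (ramp \<kappa> b x0)" by (rule ramp_admissible[OF b r(2,3)])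
      show "lower c2 (ramp \<kappa> b x0)" by (rule lower_ramp[OF b r(2) c2(1) low])
      show "W x \<le> W y" if "0 \<le> x" "x \<le> y" for x y by (rule W(4)[OF that])
      show "ramp \<kappa> b x0 x \<le> ramp \<kappa> b x0 y" if "x \<le> y" for x y by (rule ramp_mono[OF b r(2) that])
      show "(\<lambda>n. (step ^^ n) (ramp \<kappa> b x0) x) \<longlonglongrightarrow> W x" if "0 \<le> x" for x
        using Vlim that unfolding VW by blast
    qed
  qed
qed

end

theorem theorem6p5:
  fixes d \<mu> \<tau> ustar cstar :: real and f f' :: "real \<Rightarrow> real"
  assumes "0 < d" and "0 < \<mu>" and "0 < \<tau>"
    and "\<And>u. 0 \<le> u \<Longrightarrow> 0 \<le> f u"
    and "\<And>u. 0 \<le> u \<Longrightarrow> (f has_real_derivative f' u) (at u within {0..})"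
    and "continuous_on {0..} f'"
    and "1 < f' 0"
    and "\<And>u. 0 < u \<Longrightarrow> 0 \<le> f' u"
    and "\<And>u. 0 < u \<Longrightarrow> f u < f' 0 * u"
    and "0 < ustar" and "f ustar = ustar"
    and "\<And>u. 0 < u \<Longrightarrow> f u = u \<Longrightarrow> u = ustar"
    and "\<And>u. 0 < u \<Longrightarrow> u < ustar \<Longrightarrow> u < f u"
    and "\<And>u. ustar < u \<Longrightarrow> f u < u"
    and "is_spreading_speed d \<mu> \<tau> f ustar cstar"
  shows "\<exists>W. connecting_steady_state d \<mu> f ustar W \<and>
           (\<forall>V. connecting_steady_state d \<mu> f ustar V \<longrightarrow> (\<forall>x\<ge>0. V x = W x)) \<and>
           (\<forall>\<epsilon> \<phi> u. 0 < \<epsilon> \<longrightarrow> \<epsilon> < cstar \<longrightarrow>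
              \<phi> \<in> C_plus \<tau> \<longrightarrow> \<not> vanishes_on \<tau> {0..} \<phi> \<longrightarrow> dirichlet_solution d \<mu> \<tau> f \<phi> u \<longrightarrow>
              ((\<lambda>t. SUP x\<in>{0..t * (cstar - \<epsilon>)}. \<bar>u t x - W x\<bar>) \<longlongrightarrow> 0) at_top)"
proof -
  interpret kinetics d \<mu> \<tau> ustar f f'
    by unfold_locales (fact assms)+
  show ?thesis by (rule spreading_to_steady_state) fact
qed

end
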